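(* A Borel set $B\subset D^d$ is non-polar, i.e. $\mathbb{P}\{\exists t\in D^N:X_t\in B\}>0$, if and only if there exists a non-trivial finite measure $\mu$ with $\mu(D^d\setminus B)=0$ and $\int\int u(|x-y|)\,\mu(dx)\,\mu(dy)<\infty$.
   Context: $K$ is a local field with non-archimedean absolute value $|\cdot|$ taking values in $\{q^k:k\in\mathbb{Z}\}\cup\{0\}$; $D=\{x:|x|\le1\}$, $\rho\in K$ with $|\rho|=q^{-1}$, $\lambda$ Haar measure on $K$ with $\lambda(D)=1$. Fix positive integers $N,d$; $K^N,K^d$ have norm $|(x_1,\dots)|=\max_i|x_i|$. For $n\ge0$, $\mathcal{D}(N;n)$ is the set of cosets of $\rho^nD^N$ in $D^N$, $\Gamma(N)=\bigcup_n\mathcal{D}(N;n)$. Let $(Z_{C,i})_{C\in\Gamma(N),1\le i\le d}$ be independent, with $Z_{C,i}$ uniformly distributed on $\rho^nD$ for $C\in\mathcal{D}(N;n)$; $Z_C=(Z_{C,i})_{i\le d}$. On the a.s. event where $|Z_{C,i}|\le q^{-n}$ for all $n,C\in\mathcal{D}(N;n),i$, put $X_t=\sum_{n\ge0}\sum_{C\in\mathcal{D}(N;n)}Z_C\mathbf{1}_C(t)$, $t\in D^N$, and $X\equiv0$ otherwise (the probability space is completed). The function $u:\{q^{-k}\}_{k\ge0}\cup\{0\}\to[0,\infty]$ is: for $r\ne0$, $u(r)=\frac{1-q^{-N}}{q^d}\log_q\frac1r$ if $N=d$ and $u(r)=\frac{1-q^{-N}}{q^d}\frac{1}{q^{d-N}-1}\left[r^{-(d-N)}-1\right]$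 if $N\ne d$; $u(0)=\frac{1-q^{-N}}{q^d}\frac{1}{1-q^{d-N}}$ if $N>d$ and $u(0)=\infty$ if $N\le d$. *)

theory Defs
  imports "HOL-Probability.Probability"
begin

definition Dk :: "('k::field \<Rightarrow> real) \<Rightarrow> 'k set" where
  "Dk absv = {x. absv x \<le> 1}"

definition Dpow :: "('k::field \<Rightarrow> real) \<Rightarrow> ('k ^ 'i::finite) set" where
  "Dpow absv = {t. \<forall>i. absv (t $ i) \<le> 1}"

definition vnorm :: "('k::field \<Rightarrow> real) \<Rightarrow> 'k ^ 'i::finite \<Rightarrow> real" where
  "vnorm absv x = Max (range (\<lambda>i. absv (x $ i)))"

definition scaled_disc :: "('k::field \<Rightarrow> real) \<Rightarrow> 'k \<Rightarrow> nat \<Rightarrow> 'k set" where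
  "scaled_disc absv \<rho> n = (\<lambda>x. \<rho> ^ n * x) ` Dk absv"

definition coset :: "('k::field \<Rightarrow> real) \<Rightarrow> 'k \<Rightarrow> nat \<Rightarrow> 'k ^ 'i::finite \<Rightarrow> ('k ^ 'i) set" where
  "coset absv \<rho> n a = (\<lambda>s. \<chi> i. a $ i + \<rho> ^ n * s $ i) ` Dpow absv"

definition cosets :: "('k::field \<Rightarrow> real) \<Rightarrow> 'k \<Rightarrow> nat \<Rightarrow> ('k ^ 'i::finite) set set" where
  "cosets absv \<rho> n = {coset absv \<rho> n a | a. a \<in> Dpow absv}"

(* K is a local field; absv is its normalized non-archimedean absolute value
   (values in q^Z \<union> {0}, q = size of the residue field D / rho D),
   inducing the metric topology of K; rho is a uniformizer (|rho| = 1/q);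
   lam is the Haar measure on the Borel sets of K, normalized by lam(D) = 1. *)
definition local_field_setup ::
  "('k::{field,metric_space} \<Rightarrow> real) \<Rightarrow> nat \<Rightarrow> 'k \<Rightarrow> 'k measure \<Rightarrow> bool" where
  "local_field_setup absv q \<rho> lam \<longleftrightarrow>
     q \<ge> 2 \<and>
     (\<forall>x. absv x = 0 \<longleftrightarrow> x = 0) \<and>
     (\<forall>x y. absv (x * y) = absv x * absv y) \<and>
     (\<forall>x y. absv (x + y) \<le> max (absv x) (absv y)) \<and>
     (\<forall>x. absv x = 0 \<or> (\<exists>k::int. absv x = real q powr real_of_int k)) \<and>
     (\<forall>x y. dist x y = absv (x - y)) \<and>
     absv \<rho> = 1 / real q \<and>
     compact (Dk absv) \<and>
     card {(\<lambda>x. a + \<rho> * x) ` Dk absv | a. a \<in> Dk absv} = q \<and>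
     sets lam = sets borel \<and>
     (\<forall>a A. A \<in> sets borel \<longrightarrow> emeasure lam ((\<lambda>x. a + x) ` A) = emeasure lam A) \<and>
     emeasure lam (Dk absv) = 1"

(* The vector Z_C = (Z_{C,i})_i, where the index C of level n is encoded as the pair (n, C). *)
definition Zvec :: "(nat \<times> ('k ^ 'n::finite) set \<Rightarrow> 'd::finite \<Rightarrow> 'w \<Rightarrow> 'k) \<Rightarrow> nat \<times> ('k ^ 'n) set \<Rightarrow> 'w \<Rightarrow> 'k ^ 'd" where
  "Zvec Z c \<omega> = (\<chi> i. Z c i \<omega>)"

definition proc ::
  "('k::{field,metric_space} \<Rightarrow> real) \<Rightarrow> nat \<Rightarrow> 'k \<Rightarrow>
   (nat \<times> ('k ^ 'n::finite) set \<Rightarrow> 'd::finite \<Rightarrow> 'w \<Rightarrow> 'k) \<Rightarrow> 'k ^ 'n \<Rightarrow> 'w \<Rightarrow> 'k ^ 'd" where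
  "proc absv q \<rho> Z t \<omega> =
     (if (\<forall>n. \<forall>C\<in>cosets absv \<rho> n. \<forall>i. absv (Z (n, C) i \<omega>) \<le> inverse (real q ^ n))
      then (\<Sum>n. \<Sum>C\<in>cosets absv \<rho> n. (if t \<in> C then Zvec Z (n, C) \<omega> else 0))
      else 0)"

(* the kernel u : {q^-k} \<union> {0} \<rightarrow> [0,\<infinity>] *)
definition u_kernel :: "nat \<Rightarrow> nat \<Rightarrow> nat \<Rightarrow> real \<Rightarrow> ennreal" where
  "u_kernel q N d r =
     (let c = (1 - real q powr (- real N)) / real q powr real d in
      if r = 0 then
        (if N > d then ennreal (c / (1 - real q powr (real d - real N))) else \<infinity>)
      else if N = d then ennreal (c * log (real q) (1 / r))
      else ennreal (c / (real q powr (real d - real N) - 1) * (r powr (- (real d - real N)) - 1)))"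

end

theory Submission
  imports Defs
begin

text \<open>
  The balls of \<open>D\<^sup>d\<close> form a tree, and modulo powers of \<open>\<rho>\<close> the process is a branching
  process on it: given the ball \<open>y\<close> of level \<open>n\<close> reached over a coset of level \<open>n - 1\<close>, each
  of the \<open>b = q\<^sup>N\<close> subcosets moves independently to a uniformly chosen one of the \<open>q\<^sup>d\<close>
  children of \<open>y\<close>. So the probability \<open>p\<close> of hitting a compact set \<open>K\<close> from \<open>y\<close> satisfies
  \<open>p = 1 - (1 - a)\<^sup>b\<close> with \<open>a\<close> the average of \<open>p\<close> over the children, and the inequalities
  \<open>(1 / a + (b - 1) / 2) / b \<le> 1 / p \<le> (1 / a + b - 1) / b\<close> make \<open>1 / p\<close> comparable to the
  minimal value of \<open>\<Sum>\<^sub>n (q\<^sup>d / q\<^sup>N)\<^sup>n \<Sum>\<^sub>y \<mu>(y)\<^sup>2\<close>, with \<open>y\<close> ranging over the balls of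
  level \<open>n\<close>, among the probability measures \<open>\<mu>\<close> on \<open>K\<close>. Up to constants this series is the
  energy of \<open>\<mu>\<close>. One direction is Cauchy-Schwarz; for the other, \<open>\<mu>\<close> splits the mass of a
  ball among its children proportionally to \<open>p\<close>. Borel sets reduce to compact sets by Choquet's
  capacitability theorem, which also yields the measurability of the hitting event.
\<close>

section \<open>Capacitability of Borel sets\<close>

text \<open>Reciprocals are natural because they add like resistances. If \<open>S\<close> is the
  sum of \<open>p\<close> over the \<open>q^d\<close> children, then \<open>a = S / q^d\<close>, so
  the term \<open>1 / (a * b)\<close> is \<open>(q^d / q^N) / S\<close>, and the remainder is a cost
  between 1/4 and 1 paid at every ball. Unfolding over the levels gives the weights
  \<open>(q^d / q^N)^n\<close>. The same weights are hidden in the kernel: \<open>u\<close> at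
  distance \<open>q^-j\<close> is a constant times the sum of \<open>(q^d / q^N)^n\<close> over
  \<open>n < j\<close>, and \<open>n < j\<close> means that two points at that distance share a ball
  of level \<open>n + 1\<close>. The cases \<open>N < d\<close>, \<open>N = d\<close>,
  \<open>N > d\<close> are the three behaviours of this geometric sum. The probabilistic obstacle is
  that the recursion conditions on displacements with a continuous law. They are therefore replaced
  by finitely many representatives modulo \<open>\<rho>^m\<close>. In an ultrametric space errors of
  size \<open>q^-m\<close> do not add up, so an event that only sees balls of level \<open>m\<close>
  is unaffected, and conditioning becomes a finite sum. Then \<open>m\<close> tends to infinity, and
  compactness turns a hit at every level into a hit.\<close>

lemma continuous_on_fst_coordinate:
  "continuous_on UNIV (\<lambda>p :: ('i \<Rightarrow> 'b::topological_space) \<times> 'a::topological_space. fst p j)"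
  by (rule continuous_on_product_then_coordinatewise, rule continuous_on_fst, rule continuous_on_id)

lemma continuous_on_reindex_fst:
  "continuous_on UNIV (\<lambda>p :: ('i \<Rightarrow> 'b::topological_space) \<times> 'a::topological_space. (\<lambda>i. fst p (g i), snd p))"
  by (rule continuous_on_Pair, rule continuous_on_coordinatewise_then_product,
      rule continuous_on_fst_coordinate, rule continuous_on_snd, rule continuous_on_id)

text \<open>The head of a sequence names a member of the union and its tail is a witness for that
  member, so one closed set codes all of the \<open>H n\<close>.\<close>

lemma closed_projection_UN:
  fixes A :: "nat \<Rightarrow> 'a::topological_space set"
  assumes "\<And>n. \<exists>H :: ((nat \<Rightarrow> nat) \<times> 'a) set. closed H \<and> A n = snd ` H"
  shows "\<exists>H :: ((nat \<Rightarrow> nat) \<times> 'a) set. closed H \<and> (\<Union>n. A n) = snd ` H"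
proof -
  from assms obtain H :: "nat \<Rightarrow> ((nat \<Rightarrow> nat) \<times> 'a) set"
    where H: "\<And>n. closed (H n)" "\<And>n. A n = snd ` H n" by metis
  \<comment> \<open>The clause for \<open>k\<close> says that the head differs from \<open>k\<close>
    or the tail lies in \<open>H k\<close>; it is closed because \<open>{k}\<close> is open in the
    discrete naturals.\<close>
  let ?G = "\<Inter>k. ((\<lambda>p. fst p 0) -` (- {k})) \<union> ((\<lambda>p. (\<lambda>i. fst p (Suc i), snd p)) -` H k)"
  have "closed ?G"
  proof (intro closed_INT ballI closed_Un closed_vimage H)
    show "closed (- {k})" for k :: nat by (intro closed_Compl discrete_topology_class.open_discrete)
  qed (rule continuous_on_fst_coordinate continuous_on_reindex_fst)+
  moreover have "(\<Union>n. A n) = snd ` ?G"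
  proof (intro equalityI subsetI)
    fix x assume "x \<in> (\<Union>n. A n)"
    then obtain n s where s: "(s, x) \<in> H n" using H(2) by force
    have "(case_nat n s, x) \<in> ?G" using s by auto
    from imageI[OF this, of snd] show "x \<in> snd ` ?G" by simp
  next
    fix x assume "x \<in> snd ` ?G"
    then obtain s where "(s, x) \<in> ?G" by force
    then have "(\<lambda>i. s (Suc i), x) \<in> H (s 0)" by auto
    then show "x \<in> (\<Union>n. A n)" using H(2) by force
  qed
  ultimately show ?thesis by blast
qed

text \<open>A single sequence carries a witness for each \<open>n\<close> as its row
  \<open>n\<close> under \<open>prod_encode\<close>; the point \<open>x\<close> is shared by all
  rows.\<close>

lemma closed_projection_INT:
  fixes A :: "nat \<Rightarrow> 'a::topological_space set"
  assumes "\<And>n. \<exists>H :: ((nat \<Rightarrow> nat) \<times> 'a) set. closed H \<and> A n = snd ` H"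
  shows "\<exists>H :: ((nat \<Rightarrow> nat) \<times> 'a) set. closed H \<and> (\<Inter>n. A n) = snd ` H"
proof -
  from assms obtain H :: "nat \<Rightarrow> ((nat \<Rightarrow> nat) \<times> 'a) set"
    where H: "\<And>n. closed (H n)" "\<And>n. A n = snd ` H n" by metis
  let ?G = "\<Inter>n. ((\<lambda>p. (\<lambda>i. fst p (prod_encode (n, i)), snd p)) -` H n)"
  have "closed ?G"
    by (intro closed_INT ballI closed_vimage H continuous_on_reindex_fst)
  moreover have "(\<Inter>n. A n) = snd ` ?G"
  proof (intro equalityI subsetI)
    fix x assume "x \<in> (\<Inter>n. A n)"
    then have "\<forall>n. \<exists>s. (s, x) \<in> H n" using H(2) by force
    then obtain s where s: "\<And>n. (s n, x) \<in> H n" by metis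
    have "((\<lambda>k. case prod_decode k of (n, i) \<Rightarrow> s n i), x) \<in> ?G" using s by auto
    from imageI[OF this, of snd] show "x \<in> snd ` ?G" by simp
  next
    fix x assume "x \<in> snd ` ?G"
    then obtain s where "(s, x) \<in> ?G" by force
    then have "(\<lambda>i. s (prod_encode (n, i)), x) \<in> H n" for n by auto
    then show "x \<in> (\<Inter>n. A n)" using H(2) by force
  qed
  ultimately show ?thesis by blast
qed

lemma closed_imp_closed_projection:
  fixes C :: "'a::topological_space set"
  assumes "closed C"
  shows "\<exists>H :: ((nat \<Rightarrow> nat) \<times> 'a) set. closed H \<and> C = snd ` H"
  using assms by (intro exI[of _ "UNIV \<times> C"]) (auto intro: closed_Times)

lemma open_eq_UN_closed:
  fixes U :: "'a::metric_space set"
  assumes "open U"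
  shows "\<exists>C :: nat \<Rightarrow> 'a set. (\<forall>n. closed (C n)) \<and> U = (\<Union>n. C n)"
proof (intro exI conjI allI)
  let ?C = "\<lambda>n::nat. - (\<Union>y\<in>-U. ball y (inverse (real (Suc n))))"
  show "closed (?C n)" for n by (auto simp: closed_Compl)
  show "U = (\<Union>n. ?C n)"
  proof (intro equalityI subsetI)
    fix x assume "x \<in> U"
    then obtain e where e: "e > 0" "\<And>y. dist y x < e \<Longrightarrow> y \<in> U"
      using assms open_dist by blast
    obtain n where "inverse (real (Suc n)) < e" using reals_Archimedean e by blast
    then have "x \<in> ?C n" using e(2) by force
    then show "x \<in> (\<Union>n. ?C n)" by blast
  qed force
qed

text \<open>Projections of closed sets are stable under countable unions and intersections but in
  general not under complements, so the induction carries the property for a set and its complement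
  together.\<close>

lemma borel_imp_closed_projection:
  fixes B :: "'a::metric_space set"
  assumes "B \<in> sets borel"
  shows "\<exists>H :: ((nat \<Rightarrow> nat) \<times> 'a) set. closed H \<and> B = snd ` H"
proof -
  let ?S = "\<lambda>B::'a set. \<exists>H :: ((nat \<Rightarrow> nat) \<times> 'a) set. closed H \<and> B = snd ` H"
  have "B \<in> sigma_sets UNIV {S. open S}" using assms by (simp add: sets_borel)
  then have "?S B \<and> ?S (- B)"
  proof (induction rule: sigma_sets.induct)
    case (Basic U)
    then obtain C :: "nat \<Rightarrow> 'a set" where C: "\<And>n. closed (C n)" "U = (\<Union>n. C n)"
      using open_eq_UN_closed by blast
    have "?S U" unfolding C(2)
      by (rule closed_projection_UN) (rule closed_imp_closed_projection, rule C)
    moreover have "?S (- U)" using Basic by (intro closed_imp_closed_projection) auto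
    ultimately show ?case by blast
  next
    case Empty
    show ?case using closed_imp_closed_projection[of "{}"] closed_imp_closed_projection[of UNIV] by simp
  next
    case (Compl a)
    then show ?case by (simp add: Compl_eq_Diff_UNIV Diff_Diff_Int)
  next
    case (Union a)
    have "?S (\<Union>i. a i)" by (rule closed_projection_UN) (use Union in blast)
    moreover have "?S (\<Inter>i. - a i)" by (rule closed_projection_INT) (use Union in blast)
    ultimately show ?case by (simp add: Compl_UN)
  qed
  then show ?thesis by blast
qed

section \<open>Compact boxes of sequences and Choquet's theorem\<close>

lemma bounded_sequences_compact:
  fixes m :: "nat \<Rightarrow> nat"
  shows "compact {s. \<forall>i. s i \<le> m i}"
proof -
  have "compactin (product_topology (\<lambda>i. euclidean) UNIV) (PiE UNIV (\<lambda>i. {..m i}))"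
    unfolding compactin_PiE by (auto intro: finite_imp_compact)
  moreover have "PiE UNIV (\<lambda>i. {..m i}) = {s. \<forall>i. s i \<le> m i}" by (auto simp: PiE_def Pi_def)
  ultimately show ?thesis by (simp add: euclidean_product_topology)
qed

text \<open>Choquet's argument: the bounds \<open>m\<close> are chosen one coordinate at a time so that
  the capacity stays above \<open>c\<close>; the limiting compact set is the intersection of the closures.\<close>

lemma capacity_inner_compact:
  fixes hit :: "'a::metric_space set \<Rightarrow> 'w set"
  assumes mono: "\<And>A A'. A \<subseteq> A' \<Longrightarrow> hit A \<subseteq> hit A'"
    and space: "\<And>A. hit A \<subseteq> space M"
    and up: "\<And>A :: nat \<Rightarrow> 'a set. incseq A \<Longrightarrow> hit (\<Union>i. A i) \<subseteq> (\<Union>i. hit (A i))"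
    and down: "\<And>A :: nat \<Rightarrow> 'a set. (\<And>n. compact (A n)) \<Longrightarrow> decseq A \<Longrightarrow> (\<Inter>n. hit (A n)) \<subseteq> hit (\<Inter>n. A n)"
    and meas: "\<And>K. compact K \<Longrightarrow> K \<subseteq> X \<Longrightarrow> hit K \<in> sets M"
    and fin: "finite_measure M"
    and X: "compact X" and B: "B \<in> sets borel" "B \<subseteq> X"
    and c: "c < outer_measure_of M (hit B)"
  shows "\<exists>K. compact K \<and> K \<subseteq> B \<and> c \<le> emeasure M (hit K)"
proof -
  interpret finite_measure M by (rule fin)
  obtain H :: "((nat \<Rightarrow> nat) \<times> 'a) set" where H: "closed H" "B = snd ` H"
    using borel_imp_closed_projection[OF B(1)] by blast
  \<comment> \<open>The part of \<open>B\<close> that has a code obeying the first \<open>n\<close>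
    bounds. It need not be Borel, so only the outer measure of its hitting set is available.\<close>
  define P where "P n m = snd ` {p\<in>H. \<forall>i<n. fst p i \<le> m i}" for n and m :: "nat \<Rightarrow> nat"
  have P_sub: "P n m \<subseteq> B" for n m unfolding P_def H(2) by auto
  have "\<exists>f. \<forall>n. c < outer_measure_of M (hit (P n (f n))) \<and> (\<exists>j. f (Suc n) = (f n)(n := j))"
  proof (rule dependent_nat_choice)
    have "P 0 m = B" for m unfolding P_def H(2) by auto
    then show "\<exists>x. c < outer_measure_of M (hit (P 0 x))" using c by auto
  next
    fix m :: "nat \<Rightarrow> nat" and n assume m: "c < outer_measure_of M (hit (P n m))"
    let ?A = "\<lambda>j. P (Suc n) (m(n := j))"
    have inc: "incseq ?A" unfolding incseq_def P_def by (fastforce simp: less_Suc_eq)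
    have "P n m \<subseteq> (\<Union>j. ?A j)"
    proof
      fix x assume "x \<in> P n m"
      then obtain s where "(s, x) \<in> H" "\<forall>i<n. s i \<le> m i" unfolding P_def by auto
      then have "x \<in> ?A (s n)" unfolding P_def by (force simp: less_Suc_eq)
      then show "x \<in> (\<Union>j. ?A j)" by blast
    qed
    then have "hit (P n m) \<subseteq> (\<Union>j. hit (?A j))" using mono up[OF inc] by blast
    then have "c < outer_measure_of M (\<Union>j. hit (?A j))"
      using m outer_measure_of_mono order_less_le_trans by blast
    \<comment> \<open>Outer measures are continuous along increasing sequences of arbitrary sets, so
      some bound \<open>j\<close> on coordinate \<open>n\<close> keeps the value above
      \<open>c\<close>.\<close>
    also have "\<dots> = (SUP j. outer_measure_of M (hit (?A j)))"
      by (rule SUP_outer_measure_of_incseq[symmetric])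
         (use space mono inc in \<open>auto simp: incseq_def\<close>)
    finally obtain j where "c < outer_measure_of M (hit (?A j))" by (auto simp: less_SUP_iff)
    then show "\<exists>y. c < outer_measure_of M (hit (P (Suc n) y)) \<and> (\<exists>j. y = m(n := j))" by blast
  qed
  then obtain f where f: "\<And>n. c < outer_measure_of M (hit (P n (f n)))"
      "\<And>n. \<exists>j. f (Suc n) = (f n)(n := j)" by blast
  \<comment> \<open>Stage \<open>n\<close> of the choice changes coordinate \<open>n\<close> only,
    so the coordinates stabilise and the diagonal agrees with \<open>f n\<close> below
    \<open>n\<close>.\<close>
  define m where "m i = f (Suc i) i" for i
  have fm: "f n i = m i" if "i < n" for n i
    using that
  proof (induction n)
    case (Suc n)
    obtain j where j: "f (Suc n) = (f n)(n := j)" using f(2) by blast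
    show ?case using Suc j by (cases "i = n") (auto simp: m_def)
  qed simp
  have "P n (f n) = P n m" for n unfolding P_def using fm by simp
  then have cP: "c < outer_measure_of M (hit (P n m))" for n using f(1)[of n] by simp
  define L where "L n = closure (P n m)" for n
  have LX: "L n \<subseteq> X" for n unfolding L_def
    using P_sub B(2) X by (meson closure_minimal compact_imp_closed order_trans)
  have Lc: "compact (L n)" for n
    using LX X by (metis L_def closed_closure compact_Int_closed inf.absorb2)
  have Ldec: "decseq L" unfolding decseq_def L_def P_def by (auto intro!: closure_mono)
  let ?K = "\<Inter>n. L n"
  have K: "compact ?K" 
  proof -
    have "closed ?K" using Lc by (intro closed_INT ballI compact_imp_closed)
    then have "compact (L 0 \<inter> ?K)" by (intro compact_Int_closed Lc)
    moreover have "L 0 \<inter> ?K = ?K" by blast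
    ultimately show ?thesis by simp
  qed
  have KB: "?K \<subseteq> B"
  proof
    fix x assume x: "x \<in> ?K"
    have "\<exists>p\<in>H. (\<forall>i<n. fst p i \<le> m i) \<and> dist (snd p) x < inverse (real (Suc n))" for n
    proof -
      have "x \<in> closure (P n m)" using x L_def by auto
      then obtain y where "y \<in> P n m" "dist y x < inverse (real (Suc n))"
        unfolding closure_approachable by (metis inverse_positive_iff_positive of_nat_0_less_iff zero_less_Suc)
      then show ?thesis unfolding P_def by auto
    qed
    then obtain p where p: "\<And>n. p n \<in> H" "\<And>n i. i < n \<Longrightarrow> fst (p n) i \<le> m i"
        "\<And>n. dist (snd (p n)) x < inverse (real (Suc n))" by metis
    \<comment> \<open>\<open>p n\<close> respects the bound \<open>m i\<close> once
      \<open>i < n\<close>; the finitely many other indices are absorbed by the maximum, so all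
      codes lie in one compact box.\<close>
    define b where "b i = Max (insert (m i) ((\<lambda>n. fst (p n) i) ` {..i}))" for i
    have "fst (p n) i \<le> b i" for n i
    proof (cases "i < n")
      case True
      then show ?thesis using p(2)[of i n] unfolding b_def by (subst Max_ge_iff) auto
    next
      case False
      then show ?thesis unfolding b_def by (subst Max_ge_iff) auto
    qed
    then have "\<forall>n. fst (p n) \<in> {s. \<forall>i. s i \<le> b i}" by blast
    then obtain s r where s: "strict_mono r" "((\<lambda>n. fst (p n)) \<circ> r) \<longlonglongrightarrow> s"
      by (rule seq_compactE[OF compact_imp_seq_compact[OF bounded_sequences_compact[of b]]])
    have "(\<lambda>n. snd (p n)) \<longlonglongrightarrow> x"
    proof (rule metric_LIMSEQ_I)
      fix e :: real assume "e > 0"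
      then obtain N where N: "inverse (real (Suc N)) < e" using reals_Archimedean by blast
      have "dist (snd (p n)) x < e" if "n \<ge> N" for n
      proof -
        have "inverse (real (Suc n)) \<le> inverse (real (Suc N))" using that by (simp add: field_simps)
        then show ?thesis using p(3)[of n] N by linarith
      qed
      then show "\<exists>no. \<forall>n\<ge>no. dist (snd (p n)) x < e" by blast
    qed
    then have "((\<lambda>n. snd (p n)) \<circ> r) \<longlonglongrightarrow> x" using s(1) LIMSEQ_subseq_LIMSEQ by blast
    with s(2) have lim: "(\<lambda>n. (fst (p (r n)), snd (p (r n)))) \<longlonglongrightarrow> (s, x)"
      by (intro tendsto_Pair) (auto simp: o_def)
    have "(s, x) \<in> H" by (rule closed_sequentially[OF H(1) _ lim]) (use p(1) in simp)
    then show "x \<in> B" unfolding H(2) by force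
  qed
  have hitL: "hit (L n) \<in> sets M" for n by (rule meas[OF Lc LX])
  have "c \<le> emeasure M (hit (L n))" for n
  proof -
    have "hit (P n m) \<subseteq> hit (L n)" by (intro mono) (simp add: L_def closure_subset)
    then have "outer_measure_of M (hit (P n m)) \<le> outer_measure_of M (hit (L n))"
      by (rule outer_measure_of_mono)
    with cP[of n] show ?thesis using hitL by simp
  qed
  then have "c \<le> (INF n. emeasure M (hit (L n)))" by (rule INF_greatest)
  also have "\<dots> = emeasure M (\<Inter>n. hit (L n))"
    using hitL Ldec mono
    by (intro INF_emeasure_decseq) (auto simp: decseq_def emeasure_eq_measure)
  also have "\<dots> \<le> emeasure M (hit ?K)"
    using down[OF Lc Ldec] KB B(2) by (intro emeasure_mono meas K) auto
  finally show ?thesis using K KB by blast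
qed

text \<open>Compact subsets of \<open>B\<close> exhaust the outer measure of \<open>hit B\<close>
  from inside, and a measurable hull attains it from outside; the gap between the two is null, and
  completeness does the rest.\<close>

lemma capacity_measurable:
  fixes hit :: "'a::metric_space set \<Rightarrow> 'w set"
  assumes mono: "\<And>A A'. A \<subseteq> A' \<Longrightarrow> hit A \<subseteq> hit A'"
    and space: "\<And>A. hit A \<subseteq> space M"
    and up: "\<And>A :: nat \<Rightarrow> 'a set. incseq A \<Longrightarrow> hit (\<Union>i. A i) \<subseteq> (\<Union>i. hit (A i))"
    and down: "\<And>A :: nat \<Rightarrow> 'a set. (\<And>n. compact (A n)) \<Longrightarrow> decseq A \<Longrightarrow> (\<Inter>n. hit (A n)) \<subseteq> hit (\<Inter>n. A n)"
    and meas: "\<And>K. compact K \<Longrightarrow> K \<subseteq> X \<Longrightarrow> hit K \<in> sets M"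
    and fin: "finite_measure M" and compl: "complete_measure M"
    and X: "compact X" and B: "B \<in> sets borel" "B \<subseteq> X"
  shows "hit B \<in> sets M"
proof -
  interpret finite_measure M by (rule fin)
  interpret complete_measure M by (rule compl)
  let ?o = "outer_measure_of M (hit B)"
  obtain G where G: "G \<in> sets M" "hit B \<subseteq> G" "?o = emeasure M G"
    using outer_measure_of_attain[OF space] by blast
  \<comment> \<open>Outer measure 0 is treated apart, since \<open>capacity_inner_compact\<close>
    needs a number strictly below it.\<close>
  show ?thesis
  proof (cases "?o = 0")
    case True
    then have "G \<in> null_sets M" using G by (simp add: null_sets_def)
    then show ?thesis by (rule complete[OF G(2)])
  next
    case False
    have o_fin: "?o < top" using G(3) by (simp add: emeasure_eq_measure)
    obtain r where r: "?o = ennreal r" "r > 0"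
      using False o_fin by (cases ?o) (auto simp: less_le)
    have "\<exists>K. compact K \<and> K \<subseteq> B \<and> ennreal (r - 1 / real (Suc n)) \<le> emeasure M (hit K)" for n :: nat
    proof (rule capacity_inner_compact[where X=X and hit=hit and M=M and B=B])
      show "ennreal (r - 1 / real (Suc n)) < ?o"
        unfolding r(1) using r(2) by (intro ennreal_lessI) auto
    qed (fact assms)+
    then obtain K where K: "\<And>n. compact (K n)" "\<And>n. K n \<subseteq> B"
      "\<And>n::nat. ennreal (r - 1 / real (Suc n)) \<le> emeasure M (hit (K n))" by metis
    let ?A = "\<Union>n. hit (K n)"
    have "hit (K n) \<in> sets M" for n using K(2)[of n] B(2) by (intro meas K) auto
    then have A: "?A \<in> sets M" by blast
    have AB: "?A \<subseteq> hit B" using mono[OF K(2)] by blast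
    have *: "r - 1 / real (Suc n) \<le> measure M ?A" for n
    proof -
      have "ennreal (r - 1 / real (Suc n)) \<le> emeasure M ?A"
        using K(3)[of n] emeasure_mono[OF _ A, of "hit (K n)"] by (meson UN_upper UNIV_I order_trans)
      then show ?thesis by (simp add: emeasure_eq_measure ennreal_le_iff measure_nonneg)
    qed
    have "(\<lambda>n. r - 1 / real (Suc n)) \<longlonglongrightarrow> r - 0"
      by (intro tendsto_diff tendsto_const LIMSEQ_Suc[OF lim_1_over_n])
    then have "r \<le> measure M ?A"
      using * by (intro LIMSEQ_le_const2[of _ "r"]) auto
    then have "measure M (G - ?A) \<le> 0"
      using G A AB r by (subst finite_measure_Diff) (auto simp: emeasure_eq_measure)
    then have "G - ?A \<in> null_sets M"
      using sets.Diff[OF G(1) A] by (simp add: null_sets_def emeasure_eq_measure measure_le_0_iff)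
    then have "hit B - ?A \<in> sets M" by (rule complete[rotated]) (use G(2) in blast)
    then have "?A \<union> (hit B - ?A) \<in> sets M" using A by blast
    moreover have "?A \<union> (hit B - ?A) = hit B" using AB by blast
    ultimately show ?thesis by simp
  qed
qed

section \<open>Balls in a local field\<close>

locale local_field =
  fixes absv :: "'k::{field,metric_space} \<Rightarrow> real" and q :: nat and \<rho> :: 'k
    and lam :: "'k measure"
  assumes local_field: "local_field_setup absv q \<rho> lam"
begin

abbreviation rad :: "nat \<Rightarrow> real" where "rad n \<equiv> inverse (real q ^ n)"
abbreviation DD :: "('k ^ 'i::finite) set" where "DD \<equiv> Dpow absv"
abbreviation cs :: "nat \<Rightarrow> 'k ^ 'i::finite \<Rightarrow> ('k ^ 'i) set" where "cs \<equiv> coset absv \<rho>"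
abbreviation Cs :: "nat \<Rightarrow> ('k ^ 'i::finite) set set" where "Cs \<equiv> cosets absv \<rho>"

lemma q_ge_2: "q \<ge> 2"
  and absv_eq_0_iff: "absv x = 0 \<longleftrightarrow> x = 0"
  and absv_mult: "absv (x * y) = absv x * absv y"
  and absv_add: "absv (x + y) \<le> max (absv x) (absv y)"
  and absv_values: "absv x = 0 \<or> (\<exists>k::int. absv x = real q powr real_of_int k)"
  and dist_absv: "dist x y = absv (x - y)"
  and absv_rho: "absv \<rho> = 1 / real q"
  and compact_Dk: "compact (Dk absv)"
  and card_residues: "card {(\<lambda>x. a + \<rho> * x) ` Dk absv | a. a \<in> Dk absv} = q"
  and sets_lam: "sets lam = sets borel"
  and lam_translate: "A \<in> sets borel \<Longrightarrow> emeasure lam ((\<lambda>x. a + x) ` A) = emeasure lam A"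
  and lam_Dk: "emeasure lam (Dk absv) = 1"
  using local_field unfolding local_field_setup_def by auto

lemma q_pos: "real q > 0" and q_gt_1: "real q > 1" using q_ge_2 by auto

lemma rad_pos: "rad n > 0" using q_pos by simp

lemma rad_mono: "m \<le> n \<Longrightarrow> rad n \<le> rad m"
  using q_ge_2 by (intro le_imp_inverse_le power_increasing) auto

lemma rad_le_1: "rad n \<le> 1" using rad_mono[of 0 n] by simp

lemma rad_tendsto_0: "rad \<longlonglongrightarrow> 0"
  using LIMSEQ_inverse_realpow_zero[OF q_gt_1] by simp

lemma absv_nonneg: "absv x \<ge> 0" using dist_absv[of x 0] by (metis diff_zero zero_le_dist)

lemma absv_0 [simp]: "absv 0 = 0" by (simp add: absv_eq_0_iff)

lemma absv_1 [simp]: "absv 1 = 1"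
  using absv_mult[of 1 1] absv_eq_0_iff[of 1] by auto

lemma absv_minus_commute: "absv (x - y) = absv (y - x)"
  using dist_absv by (metis dist_commute)

lemma absv_uminus [simp]: "absv (- x) = absv x"
  using absv_minus_commute[of 0 x] by simp

lemma absv_diff_le: "absv (x - y) \<le> r \<Longrightarrow> absv (y - z) \<le> r \<Longrightarrow> absv (x - z) \<le> r"
  using absv_add[of "x - y" "y - z"] by simp

lemma absv_add_le: "absv x \<le> r \<Longrightarrow> absv y \<le> r \<Longrightarrow> absv (x + y) \<le> r"
  using absv_add[of x y] by simp

lemma rho_nonzero: "\<rho> \<noteq> 0" using absv_rho absv_0 q_pos by auto

lemma absv_rho_power: "absv (\<rho> ^ n) = rad n"
  by (induction n) (simp_all add: absv_mult absv_rho field_simps)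

lemma absv_divide_rho_power: "absv (x / \<rho> ^ n) = absv x / rad n"
proof -
  have "absv x = absv (x / \<rho> ^ n) * absv (\<rho> ^ n)"
    using rho_nonzero by (subst absv_mult[symmetric]) simp
  then show ?thesis using rad_pos[of n] by (simp add: absv_rho_power field_simps)
qed

lemma scaled_disc_eq: "scaled_disc absv \<rho> n = {x. absv x \<le> rad n}"
proof (intro equalityI subsetI)
  fix x assume "x \<in> scaled_disc absv \<rho> n"
  then obtain y where "x = \<rho> ^ n * y" "absv y \<le> 1" unfolding scaled_disc_def Dk_def by auto
  then show "x \<in> {x. absv x \<le> rad n}"
    using rad_pos[of n] by (simp add: absv_mult absv_rho_power mult_left_le)
next
  fix x assume "x \<in> {x. absv x \<le> rad n}"
  then have "absv (x / \<rho> ^ n) \<le> 1" using rad_pos[of n] by (simp add: absv_divide_rho_power)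
  moreover have "x = \<rho> ^ n * (x / \<rho> ^ n)" using rho_nonzero by simp
  ultimately show "x \<in> scaled_disc absv \<rho> n" unfolding scaled_disc_def Dk_def by blast
qed

lemma affine_disc_eq: "(\<lambda>x. a + \<rho> ^ n * x) ` Dk absv = {x. absv (x - a) \<le> rad n}"
proof -
  have "(\<lambda>x. a + \<rho> ^ n * x) ` Dk absv = (\<lambda>x. a + x) ` scaled_disc absv \<rho> n"
    unfolding scaled_disc_def by (simp add: image_image)
  also have "\<dots> = {x. absv (x - a) \<le> rad n}"
    unfolding scaled_disc_eq by (auto intro!: image_eqI[of _ _ "_ - a"])
  finally show ?thesis .
qed

section \<open>Representatives modulo the uniformizer\<close>

lemma residue_system_exists:
  "\<exists>R. R \<subseteq> Dk absv \<and> finite R \<and> card R = q \<and> (\<forall>x\<in>Dk absv. \<exists>!r. r \<in> R \<and> absv (x - r) \<le> rad 1)"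
proof -
  let ?S = "\<lambda>a. {x. absv (x - a) \<le> rad 1}"
  let ?Q = "?S ` Dk absv"
  have "?Q = {(\<lambda>x. a + \<rho> * x) ` Dk absv | a. a \<in> Dk absv}"
    using affine_disc_eq[of _ 1] by auto
  then have card_Q: "card ?Q = q" using card_residues by simp
  then have fin: "finite ?Q" using q_ge_2 by (metis card.infinite not_numeral_le_zero)
  \<comment> \<open>A disc is determined by any of its points, so choosing a point in each disc is
    injective and the disc can be recovered from it.\<close>
  define e where "e S = (SOME x::'k. x \<in> S)" for S
  have e: "e S \<in> S" "S = ?S (e S)" "e S \<in> Dk absv" if S: "S \<in> ?Q" for S
  proof -
    obtain a where a: "S = ?S a" "a \<in> Dk absv" using S by blast
    have "a \<in> S" using a rad_pos[of 1] by simp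
    then show 1: "e S \<in> S" unfolding e_def by (rule someI)
    have *: "absv (e S - a) \<le> rad 1" "absv (a - e S) \<le> rad 1"
      using 1 a absv_minus_commute by auto
    show "S = ?S (e S)" unfolding a(1) using *[unfolded a(1)] absv_diff_le by blast
    show "e S \<in> Dk absv" using absv_add_le[of "e S - a" 1 a] *(1) a(2) rad_le_1[of 1] by (simp add: Dk_def)
  qed
  have inj: "inj_on e ?Q"
  proof (rule inj_onI)
    fix S T assume "S \<in> ?Q" "T \<in> ?Q" "e S = e T"
    then show "S = T" using e(2)[of S] e(2)[of T] by simp
  qed
  show ?thesis
  proof (intro exI[of _ "e ` ?Q"] conjI ballI)
    show "e ` ?Q \<subseteq> Dk absv" using e(3) by blast
    show "finite (e ` ?Q)" using fin by simp
    show "card (e ` ?Q) = q" using card_image[OF inj] card_Q by simp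
    fix x assume x: "x \<in> Dk absv"
    show "\<exists>!r. r \<in> e ` ?Q \<and> absv (x - r) \<le> rad 1"
    proof (rule ex1I[of _ "e (?S x)"])
      have S: "?S x \<in> ?Q" using x by blast
      then have "absv (e (?S x) - x) \<le> rad 1" using e(1) by blast
      then show "e (?S x) \<in> e ` ?Q \<and> absv (x - e (?S x)) \<le> rad 1"
        using imageI[OF S, of e] absv_minus_commute[of x] by simp
      fix r assume r: "r \<in> e ` ?Q \<and> absv (x - r) \<le> rad 1"
      then obtain S' where S': "S' \<in> ?Q" "r = e S'" by blast
      have "S' = ?S r" using e(2)[OF S'(1)] S'(2) by simp
      moreover have "?S r = ?S x"
      proof -
        have "absv (x - r) \<le> rad 1" "absv (r - x) \<le> rad 1" using r absv_minus_commute by auto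
        then show ?thesis using absv_diff_le by blast
      qed
      ultimately show "r = e (?S x)" using S' by simp
    qed
  qed
qed

definition residues :: "'k set" where
  "residues = (SOME R. R \<subseteq> Dk absv \<and> finite R \<and> card R = q \<and>
     (\<forall>x\<in>Dk absv. \<exists>!r. r \<in> R \<and> absv (x - r) \<le> rad 1))"

lemma residues_Dk: "residues \<subseteq> Dk absv"
  and finite_residues: "finite residues"
  and card_residues_eq: "card residues = q"
  and residues_ex1: "x \<in> Dk absv \<Longrightarrow> \<exists>!r. r \<in> residues \<and> absv (x - r) \<le> rad 1"
  using someI_ex[OF residue_system_exists] unfolding residues_def[symmetric] by auto

lemma residues_cong: "r \<in> residues \<Longrightarrow> s \<in> residues \<Longrightarrow> absv (r - s) \<le> rad 1 \<Longrightarrow> r = s"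
  using residues_ex1[of r] residues_Dk rad_pos[of 1] by (metis absv_0 diff_self less_imp_le subsetD)

definition vresidues :: "('k ^ 'i::finite) set" where "vresidues = {v. \<forall>i. v $ i \<in> residues}"

lemma card_vresidues: "card (vresidues :: ('k ^ 'i::finite) set) = q ^ CARD('i)"
  and finite_vresidues: "finite (vresidues :: ('k ^ 'i::finite) set)"
proof -
  have bij: "bij_betw vec_nth (vresidues :: ('k ^ 'i) set) (PiE UNIV (\<lambda>_. residues))"
    by (rule bij_betwI[where g = vec_lambda]) (auto simp: vresidues_def PiE_def Pi_def vec_lambda_inverse)
  have fin: "finite (PiE (UNIV::'i set) (\<lambda>_. residues))" using finite_residues by (intro finite_PiE) auto
  show "finite (vresidues :: ('k ^ 'i) set)" using bij fin bij_betw_finite by blast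
  show "card (vresidues :: ('k ^ 'i) set) = q ^ CARD('i)"
    using bij_betw_same_card[OF bij] by (simp add: card_PiE card_residues_eq)
qed

lemma DD_iff: "x \<in> DD \<longleftrightarrow> (\<forall>i. absv (x $ i) \<le> 1)" by (simp add: Dpow_def)

lemma DD_add: "x \<in> DD \<Longrightarrow> y \<in> DD \<Longrightarrow> x + y \<in> DD" by (simp add: DD_iff absv_add_le)

lemma zero_in_DD [simp]: "0 \<in> DD" by (simp add: DD_iff)

lemma coset_iff: "x \<in> cs n a \<longleftrightarrow> (\<forall>i. absv (x $ i - a $ i) \<le> rad n)"
proof
  assume "x \<in> cs n a"
  then obtain s where s: "s \<in> DD" "x = (\<chi> i. a $ i + \<rho> ^ n * s $ i)" unfolding coset_def by blast
  show "\<forall>i. absv (x $ i - a $ i) \<le> rad n"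
  proof
    fix i
    have "x $ i \<in> (\<lambda>x. a $ i + \<rho> ^ n * x) ` Dk absv" using s by (auto simp: DD_iff Dk_def)
    then show "absv (x $ i - a $ i) \<le> rad n" unfolding affine_disc_eq by simp
  qed
next
  assume *: "\<forall>i. absv (x $ i - a $ i) \<le> rad n"
  have "\<forall>i. x $ i \<in> (\<lambda>x. a $ i + \<rho> ^ n * x) ` Dk absv" unfolding affine_disc_eq using * by simp
  then have "\<forall>i. \<exists>y. absv y \<le> 1 \<and> x $ i = a $ i + \<rho> ^ n * y" by (auto simp: Dk_def)
  then obtain f where f: "\<And>i. absv (f i) \<le> 1" "\<And>i. x $ i = a $ i + \<rho> ^ n * f i" by metis
  have "x = (\<chi> i. a $ i + \<rho> ^ n * (\<chi> i. f i) $ i)" using f(2) by (simp add: vec_eq_iff)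
  moreover have "(\<chi> i. f i) \<in> DD" using f(1) by (simp add: DD_iff)
  ultimately show "x \<in> cs n a" unfolding coset_def by blast
qed

lemma coset_refl [simp]: "a \<in> cs n a" using rad_pos[of n] by (simp add: coset_iff)

lemma coset_sym: "x \<in> cs n a \<Longrightarrow> a \<in> cs n x" by (simp add: coset_iff absv_minus_commute)

lemma coset_eq: "x \<in> cs n a \<Longrightarrow> cs n x = cs n a"
  by (auto simp: coset_iff) (metis absv_diff_le absv_minus_commute)+

lemma coset_mono: "m \<le> n \<Longrightarrow> cs n a \<subseteq> cs m a"
  using rad_mono order_trans by (fastforce simp: coset_iff)

lemma coset_0: "a \<in> DD \<Longrightarrow> cs 0 a = DD"
proof -
  assume a: "a \<in> DD"
  have "DD = cs 0 (0::'k^'i)" by (auto simp: coset_iff DD_iff)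
  with a show ?thesis using coset_eq by blast
qed

lemma coset_subset_DD: "a \<in> DD \<Longrightarrow> cs n a \<subseteq> DD"
  using coset_mono[of 0 n a] coset_0 by blast

lemma coset_add: "x \<in> cs n a \<Longrightarrow> y \<in> cs n b \<Longrightarrow> x + y \<in> cs n (a + b)"
proof -
  assume "x \<in> cs n a" "y \<in> cs n b"
  then have "absv ((x $ i - a $ i) + (y $ i - b $ i)) \<le> rad n" for i
    by (auto simp: coset_iff intro!: absv_add_le)
  then show ?thesis by (simp add: coset_iff algebra_simps)
qed

lemma cosets_iff: "y \<in> Cs n \<longleftrightarrow> (\<exists>a\<in>DD. y = cs n a)" unfolding cosets_def by blast

lemma cosets_eq_cs: "y \<in> Cs n \<Longrightarrow> x \<in> y \<Longrightarrow> y = cs n x"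
  using coset_eq by (metis cosets_iff)

lemma cosets_subset_DD: "y \<in> Cs n \<Longrightarrow> y \<subseteq> DD"
  using coset_subset_DD by (metis cosets_iff)

lemma cs_in_Cs: "x \<in> DD \<Longrightarrow> cs n x \<in> Cs n" using cosets_iff by blast

lemma cosets_0: "Cs 0 = {DD :: ('k ^ 'i::finite) set}"
proof (intro equalityI subsetI)
  fix y :: "('k ^ 'i) set" assume "y \<in> Cs 0"
  then show "y \<in> {DD}" using coset_0 by (auto simp: cosets_iff)
next
  fix y assume "y \<in> {DD :: ('k ^ 'i::finite) set}"
  then show "y \<in> Cs 0" using coset_0[of 0] zero_in_DD cosets_iff by blast
qed

lemma cosets_nonempty: "y \<in> Cs n \<Longrightarrow> y \<noteq> {}" using coset_refl by (metis cosets_iff empty_iff)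

lemma cosets_disjoint: "y \<in> Cs n \<Longrightarrow> y' \<in> Cs n \<Longrightarrow> y \<noteq> y' \<Longrightarrow> y \<inter> y' = {}"
  using cosets_eq_cs by (metis disjoint_iff)

section \<open>The tree of balls\<close>

definition chd :: "nat \<Rightarrow> ('k ^ 'i::finite) set \<Rightarrow> ('k ^ 'i) set set" where
  "chd n y = {y' \<in> Cs (Suc n). y' \<subseteq> y}"

text \<open>The affine similarity taking the unit ball onto \<open>cs n a\<close>; it turns residues
  modulo \<open>\<rho>\<close> into the children of that ball.\<close>

definition shift :: "nat \<Rightarrow> 'k ^ 'i::finite \<Rightarrow> 'k ^ 'i \<Rightarrow> 'k ^ 'i" where
  "shift n a s = (\<chi> i. a $ i + \<rho> ^ n * s $ i)"

lemma shift_in_coset: "s \<in> DD \<Longrightarrow> shift n a s \<in> cs n a"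
  unfolding shift_def coset_def by blast

lemma vresidues_DD: "vresidues \<subseteq> DD"
  using residues_Dk by (force simp: vresidues_def DD_iff Dk_def)

lemma vresidues_ex: "s \<in> DD \<Longrightarrow> \<exists>r\<in>vresidues. s \<in> cs 1 r"
proof -
  assume "s \<in> DD"
  then have "\<forall>i. \<exists>r. r \<in> residues \<and> absv (s $ i - r) \<le> rad 1"
    using residues_ex1 by (metis DD_iff Dk_def mem_Collect_eq)
  then obtain f where "\<And>i. f i \<in> residues \<and> absv (s $ i - f i) \<le> rad 1" by metis
  then show ?thesis by (intro bexI[of _ "\<chi> i. f i"]) (auto simp: vresidues_def coset_iff)
qed

text \<open>\<open>shift n a\<close> multiplies every coordinate distance by \<open>rad n\<close>,
  which raises levels by \<open>n\<close>.\<close>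

lemma shift_coset_iff: "shift n a s \<in> cs (n + k) (shift n a r) \<longleftrightarrow> s \<in> cs k r"
proof -
  have "absv (shift n a s $ i - shift n a r $ i) = rad n * absv (s $ i - r $ i)" for i
    unfolding absv_rho_power[symmetric] absv_mult[symmetric] by (simp add: shift_def algebra_simps)
  moreover have "rad n * absv (s $ i - r $ i) \<le> rad (n + k) \<longleftrightarrow> absv (s $ i - r $ i) \<le> rad k" for i
    using rad_pos[of n] q_pos by (simp add: power_add field_simps)
  ultimately show ?thesis by (simp add: coset_iff)
qed

lemma chd_eq:
  assumes a: "a \<in> DD"
  shows "chd n (cs n a) = (\<lambda>r. cs (Suc n) (shift n a r)) ` vresidues" (is "_ = ?R")
proof (intro equalityI subsetI)
  fix y assume "y \<in> chd n (cs n a)"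
  then obtain b where b: "b \<in> DD" "y = cs (Suc n) b" "y \<subseteq> cs n a"
    unfolding chd_def cosets_iff by blast
  then have "b \<in> cs n a" using coset_refl by blast
  then obtain s where s: "s \<in> DD" "b = shift n a s" unfolding coset_def shift_def by blast
  obtain r where r: "r \<in> vresidues" "s \<in> cs 1 r" using vresidues_ex[OF s(1)] by blast
  then have "b \<in> cs (Suc n) (shift n a r)" using shift_coset_iff[of n a s 1 r] s by simp
  then show "y \<in> ?R" using coset_eq b(2) r(1) by blast
next
  fix y assume "y \<in> ?R"
  then obtain r where r: "r \<in> vresidues" "y = cs (Suc n) (shift n a r)" by blast
  have s: "shift n a r \<in> cs n a" using shift_in_coset vresidues_DD r(1) by blast
  then have "shift n a r \<in> DD" using coset_subset_DD[OF a] by blast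
  then have "y \<in> Cs (Suc n)" using r cosets_iff by blast
  moreover have "y \<subseteq> cs n a" using r coset_mono[of n "Suc n"] coset_eq[OF s] by auto
  ultimately show "y \<in> chd n (cs n a)" unfolding chd_def by blast
qed

lemma inj_on_shift: "inj_on (\<lambda>r. cs (Suc n) (shift n a r)) vresidues"
proof (rule inj_onI)
  fix r s assume rs: "r \<in> vresidues" "s \<in> vresidues" "cs (Suc n) (shift n a r) = cs (Suc n) (shift n a s)"
  then have "shift n a r \<in> cs (n + 1) (shift n a s)" using coset_refl by (metis Suc_eq_plus1)
  then have "r \<in> cs 1 s" using shift_coset_iff by blast
  then have "r $ i = s $ i" for i using residues_cong rs by (auto simp: coset_iff vresidues_def)
  then show "r = s" by (simp add: vec_eq_iff)
qed

lemma card_chd: "(y :: ('k ^ 'i::finite) set) \<in> Cs n \<Longrightarrow> card (chd n y) = q ^ CARD('i)"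
  using card_image[OF inj_on_shift] chd_eq card_vresidues cosets_iff by metis

lemma finite_chd: "y \<in> Cs n \<Longrightarrow> finite (chd n y)"
  using finite_vresidues chd_eq cosets_iff by (metis finite_imageI)

lemma chd_Cs: "y' \<in> chd n y \<Longrightarrow> y' \<in> Cs (Suc n)" and chd_subset: "y' \<in> chd n y \<Longrightarrow> y' \<subseteq> y"
  unfolding chd_def by auto

lemma chd_ex:
  assumes "y \<in> Cs n" "x \<in> y"
  shows "cs (Suc n) x \<in> chd n y"
proof -
  have "x \<in> DD" using assms cosets_subset_DD by blast
  moreover have "cs (Suc n) x \<subseteq> y"
    using coset_mono[of n "Suc n" x] cosets_eq_cs[OF assms] by simp
  ultimately show ?thesis unfolding chd_def using cs_in_Cs by blast
qed

lemma Union_chd: "y \<in> Cs n \<Longrightarrow> \<Union>(chd n y) = y"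
  using chd_ex chd_subset coset_refl by blast

lemma chd_disjoint: "y \<in> Cs n \<Longrightarrow> z \<in> Cs n \<Longrightarrow> y \<noteq> z \<Longrightarrow> chd n y \<inter> chd n z = {}"
  using cosets_disjoint[of y n z] chd_subset chd_Cs cosets_nonempty by blast

lemma cosets_Suc: "Cs (Suc n) = (\<Union>y\<in>Cs n. chd n y)"
proof (intro equalityI subsetI)
  fix y assume y: "y \<in> Cs (Suc n)"
  then obtain a where a: "a \<in> DD" "y = cs (Suc n) a" using cosets_iff by blast
  then show "y \<in> (\<Union>y\<in>Cs n. chd n y)" using chd_ex[OF cs_in_Cs coset_refl] cs_in_Cs by blast
qed (use chd_Cs in blast)

lemma finite_cosets: "finite (Cs n :: ('k ^ 'i::finite) set set)"
  by (induction n) (auto simp: cosets_0 cosets_Suc finite_chd)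

lemma sum_cosets_Suc: "(\<Sum>y\<in>Cs (Suc n). f y) = (\<Sum>y\<in>Cs n. \<Sum>y'\<in>chd n y. f y')"
  unfolding cosets_Suc
  by (intro sum.UNION_disjoint ballI impI finite_cosets finite_chd chd_disjoint)

section \<open>Balls as an open and closed basis of the topology\<close>

text \<open>By the ultrametric inequality every point of a closed disc is a centre of it, so the
  disc is a union of open balls of its own radius.\<close>

lemma open_absv_le: "r > 0 \<Longrightarrow> open {x. absv (x - a) \<le> r}"
proof -
  assume r: "r > 0"
  have "{x. absv (x - a) \<le> r} = (\<Union>y\<in>{x. absv (x - a) \<le> r}. ball y r)"
  proof (intro equalityI subsetI)
    fix x assume "x \<in> (\<Union>y\<in>{x. absv (x - a) \<le> r}. ball y r)"
    then obtain y where "absv (y - a) \<le> r" "absv (x - y) \<le> r"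
      by (auto simp: dist_absv absv_minus_commute[of _ x])
    then show "x \<in> {x. absv (x - a) \<le> r}" using absv_diff_le by blast
  qed (use r in auto)
  then show ?thesis by (metis open_UN open_ball)
qed

lemma closed_absv_le: "closed {x. absv (x - a) \<le> r}"
proof -
  have "{x. absv (x - a) \<le> r} = cball a r" by (auto simp: dist_absv absv_minus_commute)
  then show ?thesis by simp
qed

lemma coset_eq_INT: "cs n a = (\<Inter>i. (\<lambda>x. x $ i) -` {x. absv (x - a $ i) \<le> rad n})"
  by (auto simp: coset_iff)

lemma open_coset: "open (cs n a)"
  unfolding coset_eq_INT by (intro open_INT ballI open_vimage_vec_nth open_absv_le rad_pos) auto

lemma closed_coset: "closed (cs n a)"
  unfolding coset_eq_INT by (intro closed_INT ballI closed_vimage_vec_nth closed_absv_le)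

lemma closed_cosets: "y \<in> Cs n \<Longrightarrow> closed y"
  using closed_coset cosets_iff by metis

lemma open_contains_coset:
  assumes "open U" "x \<in> U"
  shows "\<exists>n. cs n x \<subseteq> U"
proof -
  obtain A where A: "\<And>i. open (A i)" "\<And>i. x $ i \<in> A i" "\<And>y. (\<forall>i. y $ i \<in> A i) \<Longrightarrow> y \<in> U"
    using assms unfolding open_vec_def by metis
  have "\<exists>n. \<forall>y. absv (y - x $ i) \<le> rad n \<longrightarrow> y \<in> A i" for i
  proof -
    obtain e where e: "e > 0" "\<And>y. dist y (x $ i) < e \<Longrightarrow> y \<in> A i"
      using A open_dist by metis
    obtain n where "rad n < e" using order_tendstoD(2)[OF rad_tendsto_0 e(1)] eventually_sequentially by auto
    then show ?thesis using e(2) by (metis dist_absv order_le_less_trans)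
  qed
  then obtain f where f: "\<And>i y. absv (y - x $ i) \<le> rad (f i) \<Longrightarrow> y \<in> A i" by metis
  have "cs (Max (range f)) x \<subseteq> U"
  proof
    fix y assume y: "y \<in> cs (Max (range f)) x"
    have "absv (y $ i - x $ i) \<le> rad (f i)" for i
      using y rad_mono[of "f i" "Max (range f)"] by (auto simp: coset_iff intro: order_trans)
    then show "y \<in> U" using A(3) f by blast
  qed
  then show ?thesis by blast
qed

lemma compact_DD: "compact (DD :: ('k ^ 'i::finite) set)"
proof -
  have "compactin (product_topology (\<lambda>i. euclidean) UNIV) (PiE UNIV (\<lambda>i::'i. Dk absv))"
    unfolding compactin_PiE using compact_Dk by auto
  then have "compact (PiE UNIV (\<lambda>i::'i. Dk absv))" by (simp add: euclidean_product_topology)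
  moreover have "continuous_on A (\<lambda>f::'i \<Rightarrow> 'k. \<chi> i. f i)" for A
    by (intro continuous_on_vec_lambda continuous_on_subset[OF continuous_on_product_coordinates]) auto
  ultimately have "compact ((\<lambda>f. \<chi> i. f i) ` PiE UNIV (\<lambda>i::'i. Dk absv))"
    by (rule compact_continuous_image[rotated])
  moreover have "(\<lambda>f. \<chi> i. f i) ` PiE UNIV (\<lambda>i::'i. Dk absv) = DD"
  proof (intro equalityI subsetI)
    fix x :: "'k^'i" assume "x \<in> DD"
    then have "x = (\<chi> i. (\<lambda>i. x $ i) i)" "(\<lambda>i. x $ i) \<in> PiE UNIV (\<lambda>i::'i. Dk absv)"
      by (auto simp: DD_iff Dk_def)
    then show "x \<in> (\<lambda>f. \<chi> i. f i) ` PiE UNIV (\<lambda>i::'i. Dk absv)" by blast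
  qed (auto simp: DD_iff Dk_def PiE_def Pi_def)
  ultimately show ?thesis by simp
qed

lemma closed_DD: "closed DD" by (rule compact_imp_closed[OF compact_DD])

text \<open>The cosets around a point form a neighbourhood basis, so this is closure expressed on
  the tree.\<close>

lemma closed_iff_cosets_meet:
  assumes "closed K" "\<And>n. cs n x \<inter> K \<noteq> {}"
  shows "x \<in> K"
proof (rule ccontr)
  assume "x \<notin> K"
  then obtain n where "cs n x \<subseteq> - K" using open_contains_coset[of "- K" x] assms(1) by auto
  then show False using assms(2)[of n] by blast
qed

lemma vec_eqI_cosets: "(\<And>n. x \<in> cs n y) \<Longrightarrow> x = y"
  using closed_iff_cosets_meet[of "{x}" y] by fastforce

lemma vnorm_le_iff: "vnorm absv (x - y) \<le> rad n \<longleftrightarrow> x \<in> cs n y"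
  unfolding vnorm_def coset_iff by (subst Max_le_iff) auto

lemma absv_le_1_cases:
  assumes "absv x \<le> 1"
  shows "absv x = 0 \<or> (\<exists>n. absv x = rad n)"
proof (cases "absv x = 0")
  case False
  then obtain k :: int where k: "absv x = real q powr real_of_int k" using absv_values by blast
  have "k \<le> 0"
  proof (rule ccontr)
    assume "\<not> k \<le> 0"
    then have "real q powr real_of_int k > 1" using q_gt_1 by (simp add: powr_less_cancel_iff[of _ 0, simplified])
    then show False using k assms by simp
  qed
  then have "real q powr real_of_int k = rad (nat (- k))"
    using q_pos by (simp add: powr_real_of_int' power_int_def power_inverse)
  then show ?thesis using k by auto
qed simp

text \<open>The kernel is prescribed at the powers \<open>q^-k\<close> and at 0; all distances in
  \<open>DD\<close> are of this kind.\<close>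

lemma vnorm_cases:
  assumes "x \<in> DD" "y \<in> DD"
  shows "(vnorm absv (x - y) = 0 \<and> x = y) \<or> (\<exists>n. vnorm absv (x - y) = rad n)"
proof -
  have "vnorm absv (x - y) \<in> range (\<lambda>i. absv ((x - y) $ i))"
    unfolding vnorm_def by (rule Max_in) auto
  then obtain i where i: "vnorm absv (x - y) = absv ((x - y) $ i)" by auto
  have "absv (x $ i - y $ i) \<le> 1"
    using absv_add_le[of "x $ i" 1 "- (y $ i)"] assms by (simp add: DD_iff)
  then consider "vnorm absv (x - y) = 0" | "\<exists>n. vnorm absv (x - y) = rad n"
    using absv_le_1_cases i by fastforce
  then show ?thesis
  proof cases
    case 1
    then have "x \<in> cs n y" for n using rad_pos[of n] by (simp add: vnorm_le_iff[symmetric])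
    then show ?thesis using 1 vec_eqI_cosets by blast
  qed blast
qed

end

section \<open>Hitting at finitely many levels\<close>

lemma finite_vec_set:
  assumes "finite F"
  shows "finite {z :: 'a ^ 'i::finite. \<forall>i. z $ i \<in> F}"
proof -
  have "finite (PiE (UNIV::'i set) (\<lambda>_. F))" using assms by (intro finite_PiE) auto
  then have "finite (vec_lambda ` PiE (UNIV::'i set) (\<lambda>_. F))" by (rule finite_imageI)
  moreover have "{z :: 'a ^ 'i. \<forall>i. z $ i \<in> F} \<subseteq> vec_lambda ` PiE (UNIV::'i set) (\<lambda>_. F)"
    by (auto intro!: image_eqI[of _ _ "vec_nth _"])
  ultimately show ?thesis using finite_subset by blast
qed

context local_field
begin

section \<open>Haar measure of discs\<close>

lemma disc_borel [measurable]: "{x. absv (x - a) \<le> r} \<in> sets borel"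
  using closed_absv_le by (rule borel_closed)

lemma disc_translate: "emeasure lam {x. absv (x - a) \<le> r} = emeasure lam {x. absv x \<le> r}"
proof -
  have "{x. absv (x - a) \<le> r} = (\<lambda>x. a + x) ` {x. absv x \<le> r}"
    by (auto intro!: image_eqI[of _ _ "_ - a"])
  then show ?thesis using lam_translate[of "{x. absv x \<le> r}" a] disc_borel[of 0 r] by simp
qed

lemma disc_split:
  "{x. absv x \<le> rad n} = (\<Union>r\<in>residues. {x. absv (x - \<rho> ^ n * r) \<le> rad (Suc n)})"
proof -
  have *: "absv (\<rho> ^ n * s - \<rho> ^ n * r) \<le> rad (Suc n) \<longleftrightarrow> absv (s - r) \<le> rad 1" for s r
  proof -
    have "absv (\<rho> ^ n * s - \<rho> ^ n * r) = rad n * absv (s - r)"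
      by (simp add: right_diff_distrib[symmetric] absv_mult absv_rho_power)
    then show ?thesis using rad_pos[of n] q_pos by (simp add: field_simps)
  qed
  show ?thesis
  proof (intro equalityI subsetI)
    fix x assume "x \<in> {x. absv x \<le> rad n}"
    then obtain s where s: "s \<in> Dk absv" "x = \<rho> ^ n * s"
      using scaled_disc_eq[of n] unfolding scaled_disc_def by auto
    then obtain r where "r \<in> residues" "absv (s - r) \<le> rad 1" using residues_ex1 by blast
    then show "x \<in> (\<Union>r\<in>residues. {x. absv (x - \<rho> ^ n * r) \<le> rad (Suc n)})" using * s by blast
  next
    fix x assume "x \<in> (\<Union>r\<in>residues. {x. absv (x - \<rho> ^ n * r) \<le> rad (Suc n)})"
    then obtain r where r: "r \<in> residues" "absv (x - \<rho> ^ n * r) \<le> rad (Suc n)" by blast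
    have "\<rho> ^ n * r \<in> scaled_disc absv \<rho> n" unfolding scaled_disc_def using r residues_Dk by blast
    then have "absv (\<rho> ^ n * r) \<le> rad n" unfolding scaled_disc_eq by simp
    moreover have "absv (x - \<rho> ^ n * r) \<le> rad n" using r(2) rad_mono[of n "Suc n"] by linarith
    ultimately show "x \<in> {x. absv x \<le> rad n}"
      using absv_add_le[of "x - \<rho> ^ n * r" "rad n" "\<rho> ^ n * r"] by simp
  qed
qed

lemma disc_split_disjoint:
  assumes "r \<in> residues" "s \<in> residues" "r \<noteq> s"
  shows "{x. absv (x - \<rho> ^ n * r) \<le> rad (Suc n)} \<inter> {x. absv (x - \<rho> ^ n * s) \<le> rad (Suc n)} = {}"
proof (rule ccontr)
  assume "\<not> ?thesis"
  then obtain x where "absv (x - \<rho> ^ n * r) \<le> rad (Suc n)" "absv (x - \<rho> ^ n * s) \<le> rad (Suc n)" by blast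
  then have "absv (\<rho> ^ n * r - \<rho> ^ n * s) \<le> rad (Suc n)"
    using absv_diff_le[of "\<rho> ^ n * r" x "rad (Suc n)" "\<rho> ^ n * s"] absv_minus_commute by simp
  moreover have "absv (\<rho> ^ n * r - \<rho> ^ n * s) = rad n * absv (r - s)"
    by (simp add: right_diff_distrib[symmetric] absv_mult absv_rho_power)
  ultimately have "absv (r - s) \<le> rad 1" using rad_pos[of n] q_pos by (simp add: field_simps)
  then show False using residues_cong assms by blast
qed

text \<open>A disc of level \<open>n\<close> splits into \<open>q\<close> translates of the disc of
  the next level, so translation invariance divides the measure by \<open>q\<close> at each
  level.\<close>

lemma lam_disc: "emeasure lam {x. absv (x - a) \<le> rad n} = ennreal (rad n)"
proof -
  have "emeasure lam {x. absv x \<le> rad n} = ennreal (rad n)"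
  proof (induction n)
    case 0
    then show ?case using lam_Dk by (simp add: Dk_def)
  next
    case (Suc n)
    let ?e = "emeasure lam {x. absv x \<le> rad (Suc n)}"
    have "ennreal (rad n) = emeasure lam (\<Union>r\<in>residues. {x. absv (x - \<rho> ^ n * r) \<le> rad (Suc n)})"
      using Suc disc_split by simp
    also have "\<dots> = (\<Sum>r\<in>residues. emeasure lam {x. absv (x - \<rho> ^ n * r) \<le> rad (Suc n)})"
      using disc_split_disjoint finite_residues
      by (intro sum_emeasure[symmetric]) (auto simp: disjoint_family_on_def sets_lam disc_borel)
    also have "\<dots> = of_nat q * ?e" unfolding disc_translate by (simp add: card_residues_eq)
    finally have *: "ennreal (rad n) = ennreal (real q) * ?e" by (simp add: ennreal_of_nat_eq_real_of_nat)
    have "?e \<noteq> top" using * q_pos by (auto simp: ennreal_mult_top)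
    then obtain e where e: "?e = ennreal e" "e \<ge> 0" by (cases ?e) auto
    have "ennreal (rad n) = ennreal (real q * e)" using * e by (simp add: ennreal_mult)
    then have "rad n = real q * e" using e rad_pos[of n] by (simp add: ennreal_inj)
    then have "e = rad (Suc n)" using q_pos by (simp add: field_simps)
    then show ?case using e by simp
  qed
  then show ?thesis by (simp add: disc_translate)
qed

section \<open>The finite-level search and its discretisation\<close>

text \<open>A search of the tree below the coset \<open>C\<close>: \<open>x\<close> is the sum of
  the displacements made above level \<open>n\<close>, and \<open>v\<close> assigns a displacement
  to each node. The displacement of \<open>C\<close> is added once and shared by all its children.
  After \<open>k\<close> steps the sum matters only modulo \<open>\<rho>^(n+k)\<close>, hence the
  level of the ball tested at the end.\<close>

fun hits_at :: "('k ^ 'd::finite) set \<Rightarrow> nat \<Rightarrow> nat \<Rightarrow> ('k ^ 'n::finite) set \<Rightarrow> 'k ^ 'd \<Rightarrow>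
    ((nat \<times> ('k ^ 'n) set) \<times> 'd \<Rightarrow> 'k) \<Rightarrow> bool" where
  "hits_at K 0 n C x v \<longleftrightarrow> cs n x \<inter> K \<noteq> {}"
| "hits_at K (Suc k) n C x v \<longleftrightarrow> (\<exists>C'\<in>chd n C. hits_at K k (Suc n) C' (x + (\<chi> i. v ((n, C), i))) v)"

text \<open>The nodes whose displacements a search started at \<open>C\<close> can read. For
  distinct children these sets are disjoint, which is where independence enters.\<close>

definition desc :: "nat \<Rightarrow> ('k ^ 'n::finite) set \<Rightarrow> (nat \<times> ('k ^ 'n) set) set" where
  "desc n C = {(j, C'). n \<le> j \<and> C' \<in> Cs j \<and> C' \<subseteq> C}"

lemma desc_self: "C \<in> Cs n \<Longrightarrow> (n, C) \<in> desc n C" by (simp add: desc_def)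

lemma desc_chd: "C' \<in> chd n C \<Longrightarrow> desc (Suc n) C' \<subseteq> desc n C"
  by (auto simp: desc_def chd_def)

text \<open>Errors do not accumulate: a sum of changes of size at most \<open>rad (n + k)\<close> is
  again that small, and the final test sees only the ball of that radius. This is what permits
  replacing displacements by their reductions.\<close>

lemma hits_at_cong_imp:
  assumes "C \<in> Cs n" "x' \<in> cs (n + k) x"
    "\<And>c i. c \<in> desc n C \<Longrightarrow> absv (v' (c, i) - v (c, i)) \<le> rad (n + k)"
    "hits_at K k n C x v"
  shows "hits_at K k n C x' v'"
  using assms
proof (induction k arbitrary: n C x x')
  case 0
  then show ?case using coset_eq[of x' n x] by simp
next
  case (Suc k)
  then obtain C' where C': "C' \<in> chd n C" "hits_at K k (Suc n) C' (x + (\<chi> i. v ((n, C), i))) v" by auto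
  have "hits_at K k (Suc n) C' (x' + (\<chi> i. v' ((n, C), i))) v'"
  proof (rule Suc.IH[OF chd_Cs[OF C'(1)] _ _ C'(2)])
    have "(\<chi> i. v' ((n, C), i)) \<in> cs (n + Suc k) (\<chi> i. v ((n, C), i))"
      using Suc.prems(3)[OF desc_self[OF Suc.prems(1)]] by (simp add: coset_iff)
    then show "x' + (\<chi> i. v' ((n, C), i)) \<in> cs (Suc n + k) (x + (\<chi> i. v ((n, C), i)))"
      using coset_add[OF Suc.prems(2)] by simp
    show "absv (v' (c, i) - v (c, i)) \<le> rad (Suc n + k)" if "c \<in> desc (Suc n) C'" for c i
      using Suc.prems(3)[of c i] desc_chd[OF C'(1)] that by auto
  qed
  then show ?case using C'(1) by auto
qed

lemma hits_at_cong:
  assumes "C \<in> Cs n" "x' \<in> cs (n + k) x"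
    "\<And>c i. c \<in> desc n C \<Longrightarrow> absv (v' (c, i) - v (c, i)) \<le> rad (n + k)"
  shows "hits_at K k n C x v \<longleftrightarrow> hits_at K k n C x' v'"
  using hits_at_cong_imp[of C n x' k x v' v K] hits_at_cong_imp[of C n x k x' v v' K]
    assms coset_sym[OF assms(2)] absv_minus_commute by metis

lemma hits_at_restrict:
  assumes "C \<in> Cs n" "desc n C \<times> UNIV \<subseteq> J"
  shows "hits_at K k n C x (restrict v J) \<longleftrightarrow> hits_at K k n C x v"
  using assms rad_pos[of "n + k"] by (intro hits_at_cong) (auto simp: less_imp_le)

text \<open>A chain of children descending from \<open>C\<close> is the chain of cosets around a
  point \<open>t\<close> of \<open>C\<close>. This turns the search into a statement about partial
  sums of the process: levels \<open>n\<close> to \<open>n + k - 1\<close> are summed before the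
  test at level \<open>n + k\<close>.\<close>

lemma hits_at_iff:
  assumes "C \<in> Cs n"
  shows "hits_at K k n C x v \<longleftrightarrow>
    (\<exists>t\<in>C. cs (n + k) (x + (\<Sum>j=n..<n + k. \<chi> i. v ((j, cs j t), i))) \<inter> K \<noteq> {})"
  using assms
proof (induction k arbitrary: n C x)
  case 0
  then show ?case using cosets_nonempty by auto
next
  case (Suc k)
  let ?f = "\<lambda>t j. \<chi> i. v ((j, cs j t), i)"
  have eq: "x + (\<chi> i. v ((n, C), i)) + (\<Sum>j=Suc n..<Suc n + k. ?f t j) = x + (\<Sum>j=n..<n + Suc k. ?f t j)"
    if "t \<in> C" for t
  proof -
    have "cs n t = C" using cosets_eq_cs[OF Suc.prems that] by simp
    then show ?thesis 
      using sum.atLeast_Suc_lessThan[of n "n + Suc k" "?f t"] by (simp add: add.assoc del: sum.op_ivl_Suc)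
  qed
  have bex: "(\<exists>C'\<in>chd n C. \<exists>t\<in>C'. P t) \<longleftrightarrow> (\<exists>t\<in>C. P t)" for P
    using Union_chd[OF Suc.prems] by blast
  have "hits_at K (Suc k) n C x v \<longleftrightarrow> (\<exists>C'\<in>chd n C. \<exists>t\<in>C'.
      cs (Suc n + k) (x + (\<chi> i. v ((n, C), i)) + (\<Sum>j=Suc n..<Suc n + k. ?f t j)) \<inter> K \<noteq> {})"
    using Suc.IH[OF chd_Cs] by simp
  also have "\<dots> \<longleftrightarrow> (\<exists>t\<in>C. cs (Suc n + k) (x + (\<chi> i. v ((n, C), i)) + (\<Sum>j=Suc n..<Suc n + k. ?f t j)) \<inter> K \<noteq> {})"
    by (rule bex)
  also have "\<dots> \<longleftrightarrow> (\<exists>t\<in>C. cs (n + Suc k) (x + (\<Sum>j=n..<n + Suc k. ?f t j)) \<inter> K \<noteq> {})"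
    by (intro bex_cong refl) (simp only: eq, simp only: add_Suc_right add_Suc)
  finally show ?case .
qed

text \<open>The reduction modulo \<open>\<rho>\<^sup>m\<close>, with a finite set of representatives; values outside the unit
  disc are irrelevant.\<close>

definition reduce :: "nat \<Rightarrow> 'k \<Rightarrow> 'k" where
  "reduce m x = (if absv x \<le> 1 then (SOME y. y \<in> cs m (\<chi> i::1. x)) $ 1 else 0)"

lemma reduce_close: "absv x \<le> 1 \<Longrightarrow> absv (reduce m x - x) \<le> rad m"
  using someI[of "\<lambda>y. y \<in> cs m (\<chi> i::1. x)", OF coset_refl] by (simp add: reduce_def coset_iff)

lemma reduce_le_1: "absv (reduce m x) \<le> 1"
proof (cases "absv x \<le> 1")
  case True
  then show ?thesis
    using absv_add_le[of "reduce m x - x" 1 x] reduce_close[of x m] rad_le_1[of m] by simp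
qed (simp add: reduce_def)

text \<open>The choice in \<open>reduce\<close> is made from the coset and not from
  \<open>x\<close>, so there is one value per coset; vectors of length 1 make the finiteness of
  \<open>Cs m\<close> applicable.\<close>

lemma finite_range_reduce: "finite (range (reduce m))"
proof -
  have "range (reduce m) \<subseteq> insert 0 ((\<lambda>S. (SOME y. y \<in> S) $ 1) ` (Cs m :: ('k ^ 1) set set))"
  proof
    fix z assume "z \<in> range (reduce m)"
    then obtain x where z: "z = reduce m x" by blast
    show "z \<in> insert 0 ((\<lambda>S. (SOME y. y \<in> S) $ 1) ` (Cs m :: ('k ^ 1) set set))"
    proof (cases "absv x \<le> 1")
      case True
      then have "cs m (\<chi> i::1. x) \<in> Cs m" by (intro cs_in_Cs) (simp add: DD_iff)
      then show ?thesis using z True by (simp add: reduce_def)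
    qed (simp add: z reduce_def)
  qed
  then show ?thesis using finite_cosets finite_subset by blast
qed

lemma reduce_eq:
  assumes "absv x \<le> 1" "absv (y - x) \<le> rad m"
  shows "reduce m y = reduce m x"
proof -
  have "absv y \<le> 1" using absv_add_le[of "y - x" 1 x] assms rad_le_1[of m] by simp
  moreover have "cs m (\<chi> i::1. y) = cs m (\<chi> i::1. x)"
    using assms by (intro coset_eq) (simp add: coset_iff)
  ultimately show ?thesis using assms by (simp add: reduce_def)
qed

text \<open>On the unit disc \<open>reduce\<close> is locally constant, so its fibres there are
  open; off the disc it is the constant 0.\<close>

lemma reduce_measurable [measurable]: "reduce m \<in> measurable borel (count_space (range (reduce m)))"
proof (subst measurable_count_space_eq2[OF finite_range_reduce], intro conjI ballI)
  fix z
  let ?S = "{x. absv x \<le> 1 \<and> reduce m x = z}"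
  have "?S = (\<Union>x\<in>?S. {y. absv (y - x) \<le> rad m})"
  proof (intro equalityI subsetI)
    fix y assume "y \<in> (\<Union>x\<in>?S. {y. absv (y - x) \<le> rad m})"
    then obtain x where x: "absv x \<le> 1" "reduce m x = z" "absv (y - x) \<le> rad m" by blast
    then show "y \<in> ?S"
      using reduce_eq[of x y m] absv_add_le[of "y - x" 1 x] rad_le_1[of m] by simp
  qed (use rad_pos[of m] in \<open>auto simp: less_imp_le\<close>)
  then have "open ?S" using open_absv_le[OF rad_pos] by (metis (no_types, lifting) open_UN)
  moreover have "reduce m -` {z} \<inter> space borel = ?S \<union> (if z = 0 then - Dk absv else {})"
    by (auto simp: reduce_def Dk_def split: if_splits)
  moreover have "- Dk absv \<in> sets borel" using compact_Dk compact_imp_closed by (auto intro!: borel_open)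
  ultimately show "reduce m -` {z} \<inter> space borel \<in> sets borel" by auto
qed auto

text \<open>With values in the finite set \<open>F\<close> the displacement at the top node is one
  of finitely many \<open>z\<close>, and for fixed \<open>z\<close> the search continues from the
  fixed point \<open>x + z\<close>.\<close>

lemma hits_at_measurable:
  fixes F :: "'k set" and C :: "('k ^ 'n::finite) set" and x :: "'k ^ 'd::finite"
  assumes "finite F" "C \<in> Cs n" "desc n C \<times> UNIV \<subseteq> J"
  shows "{v \<in> space (PiM J (\<lambda>_. count_space F)). hits_at K k n C x v} \<in> sets (PiM J (\<lambda>_. count_space F))"
  using assms
proof (induction k arbitrary: n C x)
  case 0
  then show ?case by simp
next
  case (Suc k)
  let ?P = "PiM J (\<lambda>_. count_space F)"
  let ?V = "{z :: 'k ^ 'd. \<forall>i. z $ i \<in> F}"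
  have J: "((n, C), i) \<in> J" for i using desc_self[OF Suc.prems(2)] Suc.prems(3) by blast
  have "{v \<in> space ?P. hits_at K (Suc k) n C x v} =
     (\<Union>z\<in>?V. {v \<in> space ?P. \<forall>i. v ((n, C), i) = z $ i} \<inter>
        (\<Union>C'\<in>chd n C. {v \<in> space ?P. hits_at K k (Suc n) C' (x + z) v}))" (is "?L = ?R")
  proof (intro equalityI subsetI)
    fix v assume v: "v \<in> ?L"
    let ?z = "\<chi> i. v ((n, C), i)"
    have "?z \<in> ?V" using v J by (auto simp: space_PiM PiE_def Pi_def)
    moreover have "v \<in> {v \<in> space ?P. \<forall>i. v ((n, C), i) = ?z $ i} \<inter>
        (\<Union>C'\<in>chd n C. {v \<in> space ?P. hits_at K k (Suc n) C' (x + ?z) v})" using v by auto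
    ultimately show "v \<in> ?R" by blast
  next
    fix v assume "v \<in> ?R"
    then obtain z C' where z: "v \<in> space ?P" "\<forall>i. v ((n, C), i) = z $ i" "C' \<in> chd n C"
      "hits_at K k (Suc n) C' (x + z) v" by blast
    then have "(\<chi> i. v ((n, C), i)) = z" by (simp add: vec_eq_iff)
    then show "v \<in> ?L" using z by auto
  qed
  also have "\<dots> \<in> sets ?P"
  proof (intro sets.finite_UN finite_vec_set Suc.prems(1) sets.Int finite_chd[OF Suc.prems(2)])
    fix z :: "'k ^ 'd" assume z: "z \<in> ?V"
    have "{v \<in> space ?P. \<forall>i. v ((n, C), i) = z $ i} = (\<Inter>i. (\<lambda>v. v ((n, C), i)) -` {z $ i} \<inter> space ?P)"
      by auto
    also have "\<dots> \<in> sets ?P"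
      using z by (intro sets.finite_INT) (auto intro!: measurable_sets[OF measurable_component_singleton[OF J]])
    finally show "{v \<in> space ?P. \<forall>i. v ((n, C), i) = z $ i} \<in> sets ?P" .
    fix C' assume C': "C' \<in> chd n C"
    show "{v \<in> space ?P. hits_at K k (Suc n) C' (x + z) v} \<in> sets ?P"
      using desc_chd[OF C'] Suc.prems by (intro Suc.IH chd_Cs[OF C']) auto
  qed
  finally show ?case .
qed

text \<open>The quantity \<open>a\<close> of the introduction: the chance for one coset of level
  \<open>n\<close> that sits at \<open>y\<close> and has yet to move. Its displacement picks a child
  \<open>y'\<close> uniformly, and then its \<open>b\<close> subcosets try independently from
  \<open>y'\<close>. The chance after branching, \<open>1 - (1 - a) ^ b\<close>, is written
  \<open>p\<close> or \<open>?p\<close> in later proofs.\<close>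

fun hit_prob :: "nat \<Rightarrow> ('k ^ 'd::finite) set \<Rightarrow> nat \<Rightarrow> nat \<Rightarrow> ('k ^ 'd) set \<Rightarrow> real" where
  "hit_prob b K 0 n y = (if y \<inter> K \<noteq> {} then 1 else 0)"
| "hit_prob b K (Suc k) n y =
     (\<Sum>y'\<in>chd n y. 1 - (1 - hit_prob b K k (Suc n) y') ^ b) / real (q ^ CARD('d))"

end

section \<open>The law of the finite-level search\<close>

locale tree_process = local_field absv q \<rho> lam + prob_space M
  for absv :: "'k::{field,metric_space} \<Rightarrow> real" and q \<rho> lam and M :: "'w measure" +
  fixes Z :: "nat \<times> ('k ^ 'n::finite) set \<Rightarrow> 'd::finite \<Rightarrow> 'w \<Rightarrow> 'k"
  assumes indep: "indep_vars (\<lambda>_. borel) (\<lambda>(c, i). Z c i) ({(n, C). C \<in> cosets absv \<rho> n} \<times> UNIV)"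
    and unif: "C \<in> cosets absv \<rho> n \<Longrightarrow>
      distr M borel (Z (n, C) i) = uniform_measure lam (scaled_disc absv \<rho> n)"
begin

lemma Z_measurable: "C \<in> Cs n \<Longrightarrow> Z (n, C) i \<in> borel_measurable M"
  using indep unfolding indep_vars_def by auto

lemma disc_event: "C \<in> Cs n \<Longrightarrow> {\<omega> \<in> space M. absv (Z (n, C) i \<omega> - a) \<le> r} \<in> events"
  using measurable_sets[OF Z_measurable disc_borel, of C n i a r]
  by (simp add: vimage_def Int_def conj_commute)

lemma prob_Z_disc:
  assumes C: "C \<in> Cs n" and m: "n \<le> m" and a: "absv a \<le> rad n"
  shows "prob {\<omega> \<in> space M. absv (Z (n, C) i \<omega> - a) \<le> rad m} = rad m / rad n"
proof -
  let ?A = "{x. absv (x - a) \<le> rad m}" and ?S = "{x. absv x \<le> rad n}"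
  have S: "emeasure lam ?S = ennreal (rad n)" using lam_disc[of 0 n] by simp
  have "?S \<inter> ?A = ?A"
  proof -
    have "absv x \<le> rad n" if "absv (x - a) \<le> rad m" for x
      using absv_add_le[of "x - a" "rad n" a] that a rad_mono[OF m] by simp
    then show ?thesis by blast
  qed
  then have "emeasure (uniform_measure lam ?S) ?A = ennreal (rad m) / ennreal (rad n)"
    using disc_borel[of 0 "rad n"] disc_borel[of a "rad m"] S lam_disc[of a m]
    by (subst emeasure_uniform_measure) (auto simp: sets_lam)
  also have "\<dots> = ennreal (rad m / rad n)" using rad_pos[of m] rad_pos[of n] by (intro divide_ennreal) auto
  finally have "emeasure (distr M borel (Z (n, C) i)) ?A = ennreal (rad m / rad n)"
    using unif[OF C, of i] by (simp add: scaled_disc_eq)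
  then have "emeasure M (Z (n, C) i -` ?A \<inter> space M) = ennreal (rad m / rad n)"
    by (subst (asm) emeasure_distr) (auto intro: Z_measurable[OF C] disc_borel)
  moreover have "Z (n, C) i -` ?A \<inter> space M = {\<omega> \<in> space M. absv (Z (n, C) i \<omega> - a) \<le> rad m}" by auto
  ultimately show ?thesis using rad_pos[of m] rad_pos[of n] by (simp add: measure_def)
qed

definition good :: "'w set" where
  "good = {\<omega> \<in> space M. \<forall>n. \<forall>C\<in>Cs n. \<forall>i. absv (Z (n, C) i \<omega>) \<le> rad n}"

lemma AE_good: "AE \<omega> in M. \<omega> \<in> good"
proof -
  have "AE \<omega> in M. absv (Z (n, C) i \<omega>) \<le> rad n" if C: "C \<in> Cs n" for n C i
  proof -
    have "prob {\<omega> \<in> space M. absv (Z (n, C) i \<omega> - 0) \<le> rad n} = 1"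
      using prob_Z_disc[OF C order_refl, of 0 i] rad_pos[of n] by simp
    then have "AE \<omega> in M. \<omega> \<in> {\<omega> \<in> space M. absv (Z (n, C) i \<omega> - 0) \<le> rad n}"
      using prob_eq_1[OF disc_event[OF C]] by blast
    then show ?thesis by eventually_elim simp
  qed
  then have "AE \<omega> in M. \<forall>n. \<forall>C\<in>Cs n. \<forall>i. absv (Z (n, C) i \<omega>) \<le> rad n"
    by (simp add: AE_all_countable AE_finite_all[OF finite_cosets] AE_finite_allI)
  then show ?thesis using AE_space by eventually_elim (simp add: good_def)
qed

definition W :: "nat \<Rightarrow> 'w \<Rightarrow> (nat \<times> ('k ^ 'n) set) \<times> 'd \<Rightarrow> 'k" where
  "W m \<omega> p = reduce m (Z (fst p) (snd p) \<omega>)"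

abbreviation nodes :: "(nat \<times> ('k ^ 'n) set) set" where "nodes \<equiv> {(n, C). C \<in> Cs n}"

lemma indep_W: "indep_vars (\<lambda>_. count_space (range (reduce m))) (\<lambda>p \<omega>. W m \<omega> p) (nodes \<times> UNIV)"
  using indep_vars_compose2[OF indep, of "\<lambda>_. reduce m" "\<lambda>_. count_space (range (reduce m))"]
  by (simp add: reduce_measurable W_def case_prod_beta)

lemma desc_nodes: "desc n C \<subseteq> nodes" by (auto simp: desc_def)

lemma hits_event:
  assumes C: "C \<in> Cs n"
  shows "{\<omega> \<in> space M. hits_at K k n C x (W m \<omega>)} \<in> events"
proof -
  let ?J = "desc n C \<times> (UNIV :: 'd set)" and ?F = "range (reduce m)"
  let ?P = "PiM ?J (\<lambda>_. count_space ?F)"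
  have "(\<lambda>\<omega>. \<lambda>p\<in>?J. W m \<omega> p) \<in> measurable M ?P"
    using indep_W[of m] desc_nodes[of n C] unfolding indep_vars_def by (intro measurable_restrict) blast
  moreover have "{v \<in> space ?P. hits_at K k n C x v} \<in> sets ?P"
    by (rule hits_at_measurable[OF finite_range_reduce C order_refl])
  ultimately have "(\<lambda>\<omega>. \<lambda>p\<in>?J. W m \<omega> p) -` {v \<in> space ?P. hits_at K k n C x v} \<inter> space M \<in> events"
    by (rule measurable_sets)
  moreover have "(\<lambda>\<omega>. \<lambda>p\<in>?J. W m \<omega> p) -` {v \<in> space ?P. hits_at K k n C x v} \<inter> space M =
      {\<omega> \<in> space M. hits_at K k n C x (W m \<omega>)}"
  proof -
    have "(\<lambda>p\<in>?J. W m \<omega> p) \<in> space ?P" for \<omega> by (auto simp: space_PiM W_def)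
    then show ?thesis using hits_at_restrict[OF C order_refl, of K k x] by auto
  qed
  ultimately show ?thesis by simp
qed

text \<open>The displacement of \<open>C\<close> and the searches below its children read disjoint
  blocks of independent variables. The point \<open>x\<close> is held fixed; in the application it
  already includes the displacement \<open>z\<close>.\<close>

lemma prob_step_independent:
  assumes C: "C \<in> Cs n" and z: "\<And>i. z $ i \<in> range (reduce m)"
  shows "prob {\<omega> \<in> space M. (\<forall>i. W m \<omega> ((n, C), i) = z $ i) \<and>
            (\<forall>C'\<in>chd n C. \<not> hits_at K k (Suc n) C' x (W m \<omega>))}
       = prob {\<omega> \<in> space M. \<forall>i. W m \<omega> ((n, C), i) = z $ i} *
         (\<Prod>C'\<in>chd n C. 1 - prob {\<omega> \<in> space M. hits_at K k (Suc n) C' x (W m \<omega>)})"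
proof -
  let ?F = "range (reduce m)"
  \<comment> \<open>Each block is keyed by its top node: the node \<open>(n, C)\<close> alone, or
    the whole subtree below a child.\<close>
  define J where "J c = (if c = (n, C) then {(n, C)} else desc (fst c) (snd c)) \<times> (UNIV :: 'd set)" for c
  define P where "P c = PiM (J c) (\<lambda>_. count_space ?F)" for c
  define L where "L = insert (n, C) (Pair (Suc n) ` chd n C)"
  define A where "A c = (if c = (n, C) then {v \<in> space (P c). \<forall>i. v ((n, C), i) = z $ i}
    else {v \<in> space (P c). \<not> hits_at K k (Suc n) (snd c) x v})" for c
  define X where "X c \<omega> = (\<lambda>p\<in>J c. W m \<omega> p)" for c \<omega>
  have JL: "J c \<subseteq> nodes \<times> UNIV" if "c \<in> L" for c
    using C desc_nodes unfolding J_def by auto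
  have disj: "disjoint_family_on J L"
  proof -
    have 1: "(n, C) \<notin> desc (Suc n) C'" for C' by (simp add: desc_def)
    have 2: "desc (Suc n) C' \<inter> desc (Suc n) C'' = {}" if "C' \<in> chd n C" "C'' \<in> chd n C" "C' \<noteq> C''" for C' C''
    proof -
      have "C' \<inter> C'' = {}" using cosets_disjoint chd_Cs that by blast
      then show ?thesis using cosets_nonempty unfolding desc_def by blast
    qed
    show ?thesis unfolding disjoint_family_on_def L_def J_def using 1 2 by auto
  qed
  have ind: "indep_vars P X L"
    using indep_vars_restrict[OF indep_W JL disj] unfolding P_def X_def by simp
  have finL: "finite L" unfolding L_def using finite_chd[OF C] by simp
  have A_sets: "A c \<in> sets (P c)" if cL: "c \<in> L" for c
  proof (cases "c = (n, C)")
    case True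
    have J: "((n, C), i) \<in> J c" for i using True by (simp add: J_def)
    have "A c = (\<Inter>i. (\<lambda>v. v ((n, C), i)) -` {z $ i} \<inter> space (P c))" unfolding A_def using True by auto
    also have "\<dots> \<in> sets (P c)" unfolding P_def
      using z by (intro sets.finite_INT) (auto intro!: measurable_sets[OF measurable_component_singleton[OF J]])
    finally show ?thesis .
  next
    case False
    then obtain C' where c: "c = (Suc n, C')" "C' \<in> chd n C" using cL by (auto simp: L_def)
    have "A c = space (P c) - {v \<in> space (P c). hits_at K k (Suc n) C' x v}"
      unfolding A_def using c by auto
    moreover have "{v \<in> space (P c). hits_at K k (Suc n) C' x v} \<in> sets (P c)"
      unfolding P_def by (intro hits_at_measurable finite_range_reduce chd_Cs[OF c(2)]) (simp add: J_def c)
    ultimately show ?thesis by auto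
  qed
  have XP: "X c \<omega> \<in> space (P c)" for c \<omega> unfolding X_def P_def by (auto simp: space_PiM W_def)
  have X_root: "X (n, C) -` A (n, C) \<inter> space M = {\<omega> \<in> space M. \<forall>i. W m \<omega> ((n, C), i) = z $ i}"
  proof -
    have "X (n, C) \<omega> ((n, C), i) = W m \<omega> ((n, C), i)" for \<omega> i by (simp add: X_def J_def)
    then show ?thesis using XP by (auto simp: A_def)
  qed
  have X_chd: "X (Suc n, C') -` A (Suc n, C') \<inter> space M = space M - {\<omega> \<in> space M. hits_at K k (Suc n) C' x (W m \<omega>)}"
    if C': "C' \<in> chd n C" for C'
  proof -
    have "hits_at K k (Suc n) C' x (X (Suc n, C') \<omega>) \<longleftrightarrow> hits_at K k (Suc n) C' x (W m \<omega>)" for \<omega>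
      unfolding X_def by (rule hits_at_restrict[OF chd_Cs[OF C']]) (simp add: J_def)
    then show ?thesis using XP by (auto simp: A_def)
  qed
  have "prob (\<Inter>c\<in>L. X c -` A c \<inter> space M) = (\<Prod>c\<in>L. prob (X c -` A c \<inter> space M))"
    by (rule indep_varsD[OF ind _ finL order_refl A_sets]) (auto simp: L_def)
  also have "\<dots> = prob (X (n, C) -` A (n, C) \<inter> space M) *
      (\<Prod>C'\<in>chd n C. prob (X (Suc n, C') -` A (Suc n, C') \<inter> space M))"
    unfolding L_def using finite_chd[OF C]
    by (subst prod.insert) (auto simp: prod.reindex inj_on_def)
  also have "(\<Prod>C'\<in>chd n C. prob (X (Suc n, C') -` A (Suc n, C') \<inter> space M)) =
      (\<Prod>C'\<in>chd n C. 1 - prob {\<omega> \<in> space M. hits_at K k (Suc n) C' x (W m \<omega>)})"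
    by (intro prod.cong refl) (simp add: X_chd prob_compl hits_event chd_Cs)
  also have "(\<Inter>c\<in>L. X c -` A c \<inter> space M) = {\<omega> \<in> space M. (\<forall>i. W m \<omega> ((n, C), i) = z $ i) \<and>
            (\<forall>C'\<in>chd n C. \<not> hits_at K k (Suc n) C' x (W m \<omega>))}"
  proof -
    have "(\<Inter>c\<in>Pair (Suc n) ` chd n C. X c -` A c \<inter> space M) =
        (\<Inter>C'\<in>chd n C. space M - {\<omega> \<in> space M. hits_at K k (Suc n) C' x (W m \<omega>)})"
      unfolding image_image by (intro INF_cong refl X_chd)
    then show ?thesis unfolding L_def INT_insert X_root by auto
  qed
  finally show ?thesis unfolding X_root .
qed

text \<open>Each of the \<open>d\<close> independent coordinates falls into a given sub-disc of
  relative measure \<open>1 / q\<close>.\<close>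

lemma prob_residue_class:
  assumes C: "C \<in> Cs n" and s: "s \<in> vresidues"
  shows "prob {\<omega> \<in> space M. \<forall>i. absv (Z (n, C) i \<omega> - \<rho> ^ n * s $ i) \<le> rad (Suc n)} = 1 / real (q ^ CARD('d))"
    and "{\<omega> \<in> space M. \<forall>i. absv (Z (n, C) i \<omega> - \<rho> ^ n * s $ i) \<le> rad (Suc n)} \<in> events"
proof -
  let ?J = "{(n, C)} \<times> (UNIV :: 'd set)"
  let ?A = "\<lambda>p. {x. absv (x - \<rho> ^ n * s $ snd p) \<le> rad (Suc n)}"
  let ?X = "\<lambda>(c, i). Z c i"
  have eq: "(\<Inter>p\<in>?J. ?X p -` ?A p \<inter> space M) = {\<omega> \<in> space M. \<forall>i. absv (Z (n, C) i \<omega> - \<rho> ^ n * s $ i) \<le> rad (Suc n)}"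
    by auto
  have 1: "prob (?X p -` ?A p \<inter> space M) = 1 / real q" if "p \<in> ?J" for p
  proof -
    have "absv (\<rho> ^ n * s $ snd p) \<le> rad n"
      using s vresidues_DD rad_pos[of n] by (auto simp: absv_mult absv_rho_power DD_iff intro!: mult_left_le)
    then have "prob {\<omega> \<in> space M. absv (Z (n, C) (snd p) \<omega> - \<rho> ^ n * s $ snd p) \<le> rad (Suc n)} = 1 / real q"
      using prob_Z_disc[OF C, of "Suc n" "\<rho> ^ n * s $ snd p" "snd p"] rad_pos[of n] q_pos
      by (simp add: field_simps)
    moreover have "?X p -` ?A p \<inter> space M = {\<omega> \<in> space M. absv (Z (n, C) (snd p) \<omega> - \<rho> ^ n * s $ snd p) \<le> rad (Suc n)}"
      using that by auto
    ultimately show ?thesis by simp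
  qed
  have "prob (\<Inter>p\<in>?J. ?X p -` ?A p \<inter> space M) = (\<Prod>p\<in>?J. prob (?X p -` ?A p \<inter> space M))"
    using C by (intro indep_varsD[OF indep]) (auto simp: disc_borel)
  also have "\<dots> = (\<Prod>p\<in>?J. 1 / real q)" using 1 by (intro prod.cong) auto
  also have "\<dots> = 1 / real (q ^ CARD('d))" by (simp add: card_cartesian_product power_one_over)
  finally show "prob {\<omega> \<in> space M. \<forall>i. absv (Z (n, C) i \<omega> - \<rho> ^ n * s $ i) \<le> rad (Suc n)} = 1 / real (q ^ CARD('d))"
    unfolding eq .
  have "{\<omega> \<in> space M. \<forall>i. absv (Z (n, C) i \<omega> - \<rho> ^ n * s $ i) \<le> rad (Suc n)} =
     (\<Inter>i. {\<omega> \<in> space M. absv (Z (n, C) i \<omega> - \<rho> ^ n * s $ i) \<le> rad (Suc n)})" by auto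
  also have "\<dots> \<in> events" by (intro sets.finite_INT disc_event[OF C]) auto
  finally show "{\<omega> \<in> space M. \<forall>i. absv (Z (n, C) i \<omega> - \<rho> ^ n * s $ i) \<le> rad (Suc n)} \<in> events" .
qed

text \<open>The displacement of \<open>C\<close> selects a child of \<open>cs n x\<close> uniformly,
  and independence of the subtrees turns failure below all children of \<open>C\<close> into a power
  with exponent their number. The precision \<open>n + k\<close> is unchanged when \<open>n\<close>
  grows and \<open>k\<close> shrinks, so the induction stays within one family
  \<open>W m\<close>.\<close>

lemma prob_hits_at:
  assumes "C \<in> Cs n" "x \<in> DD"
  shows "prob {\<omega> \<in> space M. hits_at K k n C x (W (n + k) \<omega>)} =
    hit_prob (q ^ CARD('n)) K k n (cs n x)"
  using assms
proof (induction k arbitrary: n C x)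
  case 0
  then show ?case by (simp add: prob_space)
next
  case (Suc k)
  define m where "m = n + Suc k"
  have m: "m = Suc n + k" by (simp add: m_def)
  note C = Suc.prems(1) and x = Suc.prems(2)
  let ?b = "q ^ CARD('n)"
  let ?F = "range (reduce m)"
  let ?V = "{z :: 'k ^ 'd. \<forall>i. z $ i \<in> ?F}"
  define E where "E z = {\<omega> \<in> space M. \<forall>i. W m \<omega> ((n, C), i) = z $ i}" for z
  define G where "G z = {\<omega> \<in> space M. (\<forall>i. W m \<omega> ((n, C), i) = z $ i) \<and>
            (\<forall>C'\<in>chd n C. \<not> hits_at K k (Suc n) C' (x + z) (W m \<omega>))}" for z
  define g where "g y = (1 - hit_prob ?b K k (Suc n) y) ^ ?b" for y
  define A where "A s = {\<omega> \<in> space M. \<forall>i. absv (Z (n, C) i \<omega> - \<rho> ^ n * s $ i) \<le> rad (Suc n)}"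
    for s :: "'k ^ 'd"
  have finV: "finite ?V" by (rule finite_vec_set[OF finite_range_reduce])
  have W_meas: "(\<lambda>\<omega>. W m \<omega> ((n, C), i)) \<in> measurable M (count_space ?F)" for i
    using indep_W[of m] C unfolding indep_vars_def by auto
  have E_ev: "E z \<in> events" if z: "z \<in> ?V" for z
  proof -
    have "E z = (\<Inter>i. (\<lambda>\<omega>. W m \<omega> ((n, C), i)) -` {z $ i} \<inter> space M)" unfolding E_def by auto
    also have "\<dots> \<in> events" using z by (intro sets.finite_INT measurable_sets[OF W_meas]) auto
    finally show ?thesis .
  qed
  have G_ev: "G z \<in> events" if z: "z \<in> ?V" for z
  proof -
    have "G z = E z - (\<Union>C'\<in>chd n C. {\<omega> \<in> space M. hits_at K k (Suc n) C' (x + z) (W m \<omega>)})"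
      unfolding G_def E_def by auto
    also have "\<dots> \<in> events"
      using E_ev[OF z] by (intro sets.Diff sets.finite_UN finite_chd[OF C] hits_event chd_Cs) auto
    finally show ?thesis .
  qed
  have V_DD: "z \<in> DD" if "z \<in> ?V" for z
    unfolding DD_iff using that reduce_le_1 by (metis (mono_tags, lifting) mem_Collect_eq rangeE)
  have prob_G: "prob (G z) = prob (E z) * g (cs (Suc n) (x + z))" if z: "z \<in> ?V" for z
  proof -
    have "prob (G z) = prob (E z) * (\<Prod>C'\<in>chd n C. 1 - prob {\<omega> \<in> space M. hits_at K k (Suc n) C' (x + z) (W m \<omega>)})"
      unfolding G_def E_def using z by (intro prob_step_independent[OF C]) auto
    also have "(\<Prod>C'\<in>chd n C. 1 - prob {\<omega> \<in> space M. hits_at K k (Suc n) C' (x + z) (W m \<omega>)}) =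
        (\<Prod>C'\<in>chd n C. 1 - hit_prob ?b K k (Suc n) (cs (Suc n) (x + z)))"
      using Suc.IH[OF chd_Cs DD_add[OF x V_DD[OF z]]] unfolding m by (intro prod.cong refl) simp
    finally show ?thesis by (simp add: card_chd[OF C] g_def)
  qed
  have "space M - {\<omega> \<in> space M. hits_at K (Suc k) n C x (W m \<omega>)} = (\<Union>z\<in>?V. G z)"
  proof (intro equalityI subsetI)
    fix \<omega> assume \<omega>: "\<omega> \<in> space M - {\<omega> \<in> space M. hits_at K (Suc k) n C x (W m \<omega>)}"
    let ?z = "\<chi> i. W m \<omega> ((n, C), i)"
    have "?z \<in> ?V" by (simp add: W_def)
    moreover have "\<omega> \<in> G ?z" using \<omega> unfolding G_def by auto
    ultimately show "\<omega> \<in> (\<Union>z\<in>?V. G z)" by blast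
  next
    fix \<omega> assume "\<omega> \<in> (\<Union>z\<in>?V. G z)"
    then obtain z where z: "\<omega> \<in> G z" by blast
    then have "(\<chi> i. W m \<omega> ((n, C), i)) = z" unfolding G_def by (simp add: vec_eq_iff)
    then show "\<omega> \<in> space M - {\<omega> \<in> space M. hits_at K (Suc k) n C x (W m \<omega>)}"
      using z unfolding G_def by auto
  qed
  then have "1 - prob {\<omega> \<in> space M. hits_at K (Suc k) n C x (W m \<omega>)} = prob (\<Union>z\<in>?V. G z)"
    using prob_compl[OF hits_event[OF C]] by metis
  also have "\<dots> = (\<Sum>z\<in>?V. prob (G z))"
    using G_ev by (intro finite_measure_finite_Union finV) (auto simp: disjoint_family_on_def G_def vec_eq_iff)
  also have "\<dots> = (\<Sum>z\<in>?V. prob (E z) * g (cs (Suc n) (x + z)))" using prob_G by (intro sum.cong) auto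
  \<comment> \<open>The law of the representative \<open>z\<close> is never computed; that of its
    residue class \<open>s\<close> is uniform. Splitting by \<open>s\<close> replaces
    \<open>x + z\<close> by a fixed point of the child ball, after which \<open>z\<close> is summed
    out.\<close>
  also have "\<dots> = (\<Sum>z\<in>?V. \<Sum>s\<in>vresidues. prob (E z \<inter> A s) * g (cs (Suc n) (shift n x s)))"
  proof (intro sum.cong refl)
    fix z assume z: "z \<in> ?V"
    have A_ev: "A s \<in> events" "prob (A s) = 1 / real (q ^ CARD('d))" if "s \<in> vresidues" for s
      using prob_residue_class[OF C that] unfolding A_def by auto
    have A_disj: "A s \<inter> A r = {}" if "s \<in> vresidues" "r \<in> vresidues" "s \<noteq> r" for s r
    proof -
      obtain i where "s $ i \<noteq> r $ i" using \<open>s \<noteq> r\<close> by (auto simp: vec_eq_iff)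
      then show ?thesis
        using disc_split_disjoint[of "s $ i" "r $ i" n] that unfolding A_def by (auto simp: vresidues_def)
    qed
    have disj: "disjoint_family_on A vresidues" using A_disj by (simp add: disjoint_family_on_def)
    have "prob (\<Union>s\<in>vresidues. A s) = (\<Sum>s\<in>(vresidues :: ('k ^ 'd) set). prob (A s))"
      using A_ev by (intro finite_measure_finite_Union finite_vresidues disj) auto
    also have "\<dots> = (\<Sum>s\<in>(vresidues :: ('k ^ 'd) set). 1 / real (q ^ CARD('d)))"
      using A_ev by (intro sum.cong) auto
    also have "\<dots> = 1" using q_pos by (simp add: card_vresidues)
    finally have "AE \<omega> in M. \<omega> \<in> (\<Union>s\<in>vresidues. A s)"
      using A_ev finite_vresidues by (subst (asm) prob_eq_1) auto
    then have "prob (E z) = prob (\<Union>s\<in>vresidues. E z \<inter> A s)"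
      using A_ev E_ev[OF z] finite_vresidues
      by (intro finite_measure_eq_AE) auto
    also have "\<dots> = (\<Sum>s\<in>vresidues. prob (E z \<inter> A s))"
    proof (intro finite_measure_finite_Union finite_vresidues)
      show "(\<lambda>s. E z \<inter> A s) ` vresidues \<subseteq> events" using A_ev E_ev[OF z] by blast
      show "disjoint_family_on (\<lambda>s. E z \<inter> A s) vresidues"
        using A_disj unfolding disjoint_family_on_def by blast
    qed
    finally have "prob (E z) * g (cs (Suc n) (x + z)) = (\<Sum>s\<in>vresidues. prob (E z \<inter> A s) * g (cs (Suc n) (x + z)))"
      by (simp add: sum_distrib_right)
    also have "\<dots> = (\<Sum>s\<in>vresidues. prob (E z \<inter> A s) * g (cs (Suc n) (shift n x s)))"
    proof (intro sum.cong refl)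
      fix s :: "'k ^ 'd" assume s: "s \<in> vresidues"
      show "prob (E z \<inter> A s) * g (cs (Suc n) (x + z)) = prob (E z \<inter> A s) * g (cs (Suc n) (shift n x s))"
      \<comment> \<open>A common outcome of the two events forces \<open>z\<close> into the residue
        class of \<open>s\<close>; without one the weight is 0.\<close>
      proof (cases "E z \<inter> A s = {}")
        case False
        then obtain \<omega> where "\<omega> \<in> E z" "\<omega> \<in> A s" by blast
        then have \<omega>: "z $ i = reduce m (Z (n, C) i \<omega>)"
          "absv (Z (n, C) i \<omega> - \<rho> ^ n * s $ i) \<le> rad (Suc n)" for i unfolding E_def A_def W_def by auto
        have "absv ((x + z) $ i - shift n x s $ i) \<le> rad (Suc n)" for i
        proof -
          have "absv (\<rho> ^ n * s $ i) \<le> 1"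
            using s vresidues_DD rad_pos[of n] rad_le_1[of n]
            by (auto simp: absv_mult absv_rho_power DD_iff absv_nonneg intro!: mult_le_one)
          then have "absv (Z (n, C) i \<omega>) \<le> 1"
            using absv_add_le[of "Z (n, C) i \<omega> - \<rho> ^ n * s $ i" 1 "\<rho> ^ n * s $ i"] \<omega>(2)[of i] rad_le_1[of "Suc n"]
            by simp
          then have "absv (z $ i - Z (n, C) i \<omega>) \<le> rad (Suc n)"
            using reduce_close[of "Z (n, C) i \<omega>" m] \<omega>(1)[of i] rad_mono[of "Suc n" m] m by auto
          then have "absv (z $ i - \<rho> ^ n * s $ i) \<le> rad (Suc n)" using \<omega>(2)[of i] by (rule absv_diff_le)
          then show ?thesis by (simp add: shift_def)
        qed
        then have "cs (Suc n) (x + z) = cs (Suc n) (shift n x s)" by (intro coset_eq) (simp add: coset_iff)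
        then show ?thesis by simp
      qed simp
    qed
    finally show "prob (E z) * g (cs (Suc n) (x + z)) = (\<Sum>s\<in>vresidues. prob (E z \<inter> A s) * g (cs (Suc n) (shift n x s)))" .
  qed
  also have "\<dots> = (\<Sum>s\<in>vresidues. (\<Sum>z\<in>?V. prob (E z \<inter> A s)) * g (cs (Suc n) (shift n x s)))"
    by (subst sum.swap) (simp add: sum_distrib_right)
  also have "\<dots> = (\<Sum>s\<in>vresidues. g (cs (Suc n) (shift n x s)) / real (q ^ CARD('d)))"
  proof (intro sum.cong refl)
    fix s :: "'k ^ 'd" assume s: "s \<in> vresidues"
    have A_ev: "A s \<in> events" "prob (A s) = 1 / real (q ^ CARD('d))"
      using prob_residue_class[OF C s] unfolding A_def by auto
    have "(\<Sum>z\<in>?V. prob (E z \<inter> A s)) = prob (\<Union>z\<in>?V. E z \<inter> A s)"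
      using E_ev A_ev by (intro finite_measure_finite_Union[symmetric] finV) (auto simp: disjoint_family_on_def E_def vec_eq_iff)
    also have "(\<Union>z\<in>?V. E z \<inter> A s) = A s"
    proof (intro equalityI subsetI)
      fix \<omega> assume \<omega>: "\<omega> \<in> A s"
      let ?z = "\<chi> i. W m \<omega> ((n, C), i)"
      have "?z \<in> ?V" by (simp add: W_def)
      moreover have "\<omega> \<in> E ?z \<inter> A s" using \<omega> unfolding E_def A_def by auto
      ultimately show "\<omega> \<in> (\<Union>z\<in>?V. E z \<inter> A s)" by blast
    qed auto
    finally show "(\<Sum>z\<in>?V. prob (E z \<inter> A s)) * g (cs (Suc n) (shift n x s)) = g (cs (Suc n) (shift n x s)) / real (q ^ CARD('d))"
      using A_ev by simp
  qed
  also have "\<dots> = (\<Sum>y\<in>chd n (cs n x). g y) / real (q ^ CARD('d))"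
    unfolding chd_eq[OF x] by (simp add: sum.reindex[OF inj_on_shift] sum_divide_distrib)
  finally have "prob {\<omega> \<in> space M. hits_at K (Suc k) n C x (W m \<omega>)} =
      1 - (\<Sum>y\<in>chd n (cs n x). g y) / real (q ^ CARD('d))" by simp
  also have "\<dots> = hit_prob ?b K (Suc k) n (cs n x)"
    using q_pos card_chd[OF cs_in_Cs[OF x], of n] by (simp add: g_def sum_subtractf diff_divide_distrib)
  finally show ?case unfolding m_def .
qed

end

section \<open>Hitting closed sets\<close>

lemma compact_nested_nonempty:
  fixes F :: "nat \<Rightarrow> 'a::t2_space set"
  assumes "\<And>n. compact (F n)" "\<And>n. F n \<noteq> {}" "\<And>m n. m \<le> n \<Longrightarrow> F n \<subseteq> F m"
  shows "(\<Inter>n. F n) \<noteq> {}"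
proof -
  have "F 0 \<inter> (\<Inter>n\<in>UNIV. F n) \<noteq> {}"
  proof (rule compact_imp_fip_image[OF assms(1)])
    fix I' :: "nat set" assume "finite I'" "I' \<subseteq> UNIV"
    then obtain n where "\<And>i. i \<in> I' \<Longrightarrow> i \<le> n" using finite_nat_set_iff_bounded_le by auto
    then have "F n \<subseteq> F 0 \<inter> (\<Inter>i\<in>I'. F i)" using assms(3) by blast
    then show "F 0 \<inter> (\<Inter>i\<in>I'. F i) \<noteq> {}" using assms(2)[of n] by blast
  qed (use assms(1) compact_imp_closed in blast)
  then show ?thesis by blast
qed

context tree_process
begin

section \<open>Sample paths: convergence, continuity and hitting of compact sets\<close>

abbreviation X :: "'k ^ 'n \<Rightarrow> 'w \<Rightarrow> 'k ^ 'd" where "X \<equiv> proc absv q \<rho> Z"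

abbreviation part :: "'k ^ 'n \<Rightarrow> 'w \<Rightarrow> nat \<Rightarrow> 'k ^ 'd" where
  "part t \<omega> m \<equiv> (\<Sum>j<m. Zvec Z (j, cs j t) \<omega>)"

definition hit :: "('k ^ 'd) set \<Rightarrow> 'w set" where
  "hit E = {\<omega> \<in> space M. \<exists>t\<in>DD. X t \<omega> \<in> E}"

lemma good_iff: "\<omega> \<in> good \<longleftrightarrow> \<omega> \<in> space M \<and> (\<forall>n. \<forall>C\<in>Cs n. \<forall>i. absv (Z (n, C) i \<omega>) \<le> rad n)"
  by (simp add: good_def)

lemma Zvec_small:
  assumes "\<omega> \<in> good" "t \<in> DD"
  shows "Zvec Z (j, cs j t) \<omega> \<in> cs j 0"
  using assms cs_in_Cs[OF assms(2)] by (simp add: good_iff coset_iff Zvec_def)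

lemma part_in_coset:
  assumes "\<omega> \<in> good" "t \<in> DD" "m \<le> k"
  shows "part t \<omega> k \<in> cs m (part t \<omega> m)"
  using assms(3)
proof (induction k rule: dec_induct)
  case (step k)
  have "Zvec Z (k, cs k t) \<omega> \<in> cs m 0"
    using Zvec_small[OF assms(1,2), of k] coset_mono[OF step(1), of "0 :: 'k ^ 'd"] by blast
  with step.IH show ?case using coset_add[of "part t \<omega> k" m "part t \<omega> m"] by fastforce
qed simp

lemma part_in_DD: "\<omega> \<in> good \<Longrightarrow> t \<in> DD \<Longrightarrow> part t \<omega> m \<in> DD"
  using part_in_coset[of \<omega> t 0 m] coset_0[of "0 :: 'k ^ 'd"] by simp

text \<open>Compactness of \<open>DD\<close> supplies a limit point of the partial sums. From index
  \<open>m\<close> on they stay in one closed ball of level \<open>m\<close>, so the limit point is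
  the limit.\<close>

lemma proc_sums:
  assumes "\<omega> \<in> good" "t \<in> DD"
  shows "\<exists>l. (\<lambda>j. Zvec Z (j, cs j t) \<omega>) sums l \<and> (\<forall>m. l \<in> cs m (part t \<omega> m))"
proof -
  have "\<forall>m. part t \<omega> m \<in> DD" using part_in_DD[OF assms] by blast
  then obtain l r where l: "strict_mono r" "(part t \<omega> \<circ> r) \<longlonglongrightarrow> l"
    by (rule seq_compactE[OF compact_imp_seq_compact[OF compact_DD]])
  have lc: "l \<in> cs m (part t \<omega> m)" for m
  proof (rule Lim_in_closed_set[OF closed_coset _ _ l(2)])
    have "(part t \<omega> \<circ> r) k \<in> cs m (part t \<omega> m)" if "k \<ge> m" for k
      using part_in_coset[OF assms, of m "r k"] seq_suble[OF l(1), of k] that by simp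
    then show "\<forall>\<^sub>F k in sequentially. (part t \<omega> \<circ> r) k \<in> cs m (part t \<omega> m)"
      unfolding eventually_sequentially by blast
  qed simp
  have "part t \<omega> \<longlonglongrightarrow> l"
  proof (rule topological_tendstoI)
    fix U assume "open U" "l \<in> U"
    then obtain n where n: "cs n l \<subseteq> U" using open_contains_coset by blast
    have "part t \<omega> m \<in> U" if "m \<ge> n" for m
      using coset_sym[OF lc[of m]] coset_mono[OF that, of l] n by blast
    then show "\<forall>\<^sub>F m in sequentially. part t \<omega> m \<in> U" unfolding eventually_sequentially by blast
  qed
  then show ?thesis using lc unfolding sums_def by blast
qed

text \<open>Each level contributes only through the coset containing \<open>t\<close>, so the
  process is the series of \<open>proc_sums\<close>.\<close>

lemma proc_good:
  assumes "\<omega> \<in> good" "t \<in> DD"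
  shows "X t \<omega> \<in> cs m (part t \<omega> m)"
proof -
  have "(\<Sum>C\<in>Cs j. if t \<in> C then Zvec Z (j, C) \<omega> else 0) = Zvec Z (j, cs j t) \<omega>" for j
  proof -
    have "(\<Sum>C\<in>Cs j. if t \<in> C then Zvec Z (j, C) \<omega> else 0) =
        (\<Sum>C\<in>Cs j. if C = cs j t then Zvec Z (j, C) \<omega> else 0)"
    proof (intro sum.cong refl if_cong)
      fix C :: "('k ^ 'n) set" assume "C \<in> Cs j"
      then show "t \<in> C \<longleftrightarrow> C = cs j t" using cosets_eq_cs[of C j t] coset_refl[of t j] by blast
    qed
    then show ?thesis using cs_in_Cs[OF assms(2)] by (simp add: sum.delta finite_cosets)
  qed
  then have "X t \<omega> = (\<Sum>j. Zvec Z (j, cs j t) \<omega>)"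
    using assms(1) unfolding proc_def good_iff by simp
  moreover obtain l where l: "(\<lambda>j. Zvec Z (j, cs j t) \<omega>) sums l" "\<And>m. l \<in> cs m (part t \<omega> m)"
    using proc_sums[OF assms] by blast
  ultimately show ?thesis using sums_unique[OF l(1)] l(2)[of m] by simp
qed

text \<open>Points of a common coset of level \<open>m\<close> share their first \<open>m\<close>
  displacements, and the later ones move the sum by at most \<open>rad m\<close>: sample paths do
  not increase distances.\<close>

lemma proc_cong:
  assumes "\<omega> \<in> good" "t \<in> DD" "t' \<in> cs m t"
  shows "X t' \<omega> \<in> cs m (X t \<omega>)"
proof -
  have t': "t' \<in> DD" using assms coset_subset_DD by blast
  have "cs j t' = cs j t" if "j < m" for j
    using coset_mono[of j m t] that assms(3) by (intro coset_eq) auto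
  then have "part t' \<omega> m = part t \<omega> m" by simp
  then have "X t' \<omega> \<in> cs m (part t \<omega> m)" using proc_good[OF assms(1) t', of m] by simp
  then show ?thesis using coset_eq[OF proc_good[OF assms(1,2), of m]] by simp
qed

lemma proc_continuous:
  assumes "\<omega> \<in> space M"
  shows "continuous_on DD (\<lambda>t. X t \<omega>)"
proof (cases "\<omega> \<in> good")
  case True
  show ?thesis unfolding continuous_on_topological
  proof (intro ballI allI impI)
    fix t :: "'k ^ 'n" and U assume t: "t \<in> DD" and U: "open U" "X t \<omega> \<in> U"
    obtain n where n: "cs n (X t \<omega>) \<subseteq> U" using open_contains_coset[OF U] by blast
    show "\<exists>A. open A \<and> t \<in> A \<and> (\<forall>y\<in>DD. y \<in> A \<longrightarrow> X y \<omega> \<in> U)"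
      using n proc_cong[OF True t] by (intro exI[of _ "cs n t"]) (auto intro: open_coset)
  qed
next
  case False
  then have "\<not> (\<forall>n. \<forall>C\<in>cosets absv \<rho> n. \<forall>i. absv (Z (n, C) i \<omega>) \<le> inverse (real q ^ n))"
    using assms good_iff by blast
  then have "X t \<omega> = 0" for t unfolding proc_def by (rule if_not_P)
  then show ?thesis by simp
qed

text \<open>By continuity of the path, the times at which it lies in \<open>A n\<close> form nested
  nonempty compact sets; a common time hits the intersection.\<close>

lemma hit_INT_compact:
  assumes "\<And>n. compact (A n)" "decseq A"
  shows "(\<Inter>n. hit (A n)) \<subseteq> hit (\<Inter>n. A n)"
proof
  fix \<omega> assume \<omega>: "\<omega> \<in> (\<Inter>n. hit (A n))"
  then have sp: "\<omega> \<in> space M" by (auto simp: hit_def)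
  let ?S = "\<lambda>n. (\<lambda>t. X t \<omega>) -` A n \<inter> DD"
  have "closed (?S n)" for n
    using proc_continuous[OF sp] assms(1)[of n] compact_imp_closed
    unfolding continuous_on_closed_vimage[OF closed_DD] by blast
  then have "compact (DD \<inter> ?S n)" for n by (intro compact_Int_closed compact_DD)
  moreover have "DD \<inter> ?S n = ?S n" for n by blast
  ultimately have S: "compact (?S n)" for n by simp
  have ne: "?S n \<noteq> {}" for n using \<omega> by (auto simp: hit_def)
  have dec: "?S n \<subseteq> ?S m" if "m \<le> n" for m n using decseqD[OF assms(2) that] by blast
  have "(\<Inter>n. ?S n) \<noteq> {}" by (rule compact_nested_nonempty[OF S ne dec])
  then show "\<omega> \<in> hit (\<Inter>n. A n)" using sp by (auto simp: hit_def)
qed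

lemma hits_at_good:
  assumes "\<omega> \<in> good"
  shows "hits_at K m 0 DD 0 (W m \<omega>) \<longleftrightarrow> (\<exists>t\<in>DD. cs m (X t \<omega>) \<inter> K \<noteq> {})"
proof -
  have root: "DD \<in> Cs 0" by (simp add: cosets_0)
  have "hits_at K m 0 DD 0 (\<lambda>p. Z (fst p) (snd p) \<omega>) \<longleftrightarrow> hits_at K m 0 DD 0 (W m \<omega>)"
  proof (rule hits_at_cong[OF root])
    fix c i assume "c \<in> desc 0 (DD :: ('k ^ 'n) set)"
    then obtain j C where c: "c = (j, C)" "C \<in> Cs j" by (auto simp: desc_def)
    then have "absv (Z c i \<omega>) \<le> rad j" using assms unfolding good_iff by blast
    then have "absv (Z c i \<omega>) \<le> 1" using rad_le_1[of j] by linarith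
    then show "absv (W m \<omega> (c, i) - Z (fst (c, i)) (snd (c, i)) \<omega>) \<le> rad (0 + m)"
      unfolding W_def using reduce_close by simp
  qed simp
  moreover have "hits_at K m 0 DD 0 (\<lambda>p. Z (fst p) (snd p) \<omega>) \<longleftrightarrow> (\<exists>t\<in>DD. cs m (part t \<omega> m) \<inter> K \<noteq> {})"
    unfolding hits_at_iff[OF root] by (simp add: Zvec_def atLeast0LessThan)
  moreover have "cs m (X t \<omega>) = cs m (part t \<omega> m)" if "t \<in> DD" for t
    using proc_good[OF assms that] by (rule coset_eq)
  ultimately show ?thesis by simp
qed

text \<open>A search that succeeds at level \<open>m\<close> yields a time at which the path is in a
  ball of level \<open>m\<close> meeting \<open>K\<close>, but this time may depend on
  \<open>m\<close>. The unions \<open>A m\<close> of such balls are compact and decrease into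
  \<open>K\<close>, so \<open>hit_INT_compact\<close> provides one time for all
  \<open>m\<close>.\<close>

lemma hit_closed_good:
  assumes K: "closed K" and \<omega>: "\<omega> \<in> good"
  shows "\<omega> \<in> hit K \<longleftrightarrow> (\<forall>m. hits_at K m 0 DD 0 (W m \<omega>))"
proof
  assume "\<omega> \<in> hit K"
  then show "\<forall>m. hits_at K m 0 DD 0 (W m \<omega>)"
    unfolding hits_at_good[OF \<omega>] hit_def using coset_refl by blast
next
  assume hits: "\<forall>m. hits_at K m 0 DD 0 (W m \<omega>)"
  define A where "A m = \<Union>{y \<in> Cs m. y \<inter> K \<noteq> {}}" for m
  have A_iff: "x \<in> A m \<longleftrightarrow> x \<in> DD \<and> cs m x \<inter> K \<noteq> {}" for x m
  proof
    assume "x \<in> A m"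
    then obtain y where y: "y \<in> Cs m" "y \<inter> K \<noteq> {}" "x \<in> y" unfolding A_def by blast
    then show "x \<in> DD \<and> cs m x \<inter> K \<noteq> {}" using cosets_eq_cs[OF y(1,3)] cosets_subset_DD[OF y(1)] by auto
  next
    assume "x \<in> DD \<and> cs m x \<inter> K \<noteq> {}"
    then show "x \<in> A m" unfolding A_def using cs_in_Cs coset_refl by blast
  qed
  have "closed (A m)" for m unfolding A_def
    by (intro closed_Union finite_subset[OF _ finite_cosets]) (auto intro: closed_cosets)
  then have "compact (DD \<inter> A m)" for m by (intro compact_Int_closed compact_DD)
  moreover have "DD \<inter> A m = A m" for m using A_iff by blast
  ultimately have "compact (A m)" for m by simp
  moreover have "decseq A" unfolding decseq_def
  proof (intro allI impI subsetI)
    fix m n x assume "m \<le> n" "x \<in> A n"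
    then show "x \<in> A m" unfolding A_iff using coset_mono[of m n x] by blast
  qed
  ultimately have "(\<Inter>m. hit (A m)) \<subseteq> hit (\<Inter>m. A m)" by (rule hit_INT_compact)
  moreover have "\<omega> \<in> hit (A m)" for m
  proof -
    obtain t where t: "t \<in> DD" "cs m (X t \<omega>) \<inter> K \<noteq> {}" using hits hits_at_good[OF \<omega>] by blast
    have "X t \<omega> \<in> DD" using proc_good[OF \<omega> t(1), of 0] coset_0[of "0 :: 'k ^ 'd"] by simp
    then show ?thesis using t \<omega> A_iff unfolding hit_def good_iff by blast
  qed
  ultimately have "\<omega> \<in> hit (\<Inter>m. A m)" by blast
  moreover have "(\<Inter>m. A m) \<subseteq> K"
  proof
    fix x assume "x \<in> (\<Inter>m. A m)"
    then have "cs m x \<inter> K \<noteq> {}" for m using A_iff[of x m] by blast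
    then show "x \<in> K" by (rule closed_iff_cosets_meet[OF K])
  qed
  ultimately show "\<omega> \<in> hit K" unfolding hit_def by blast
qed

lemma hit_closed:
  assumes K: "closed K"
  shows "hit K \<in> sets (completion M)"
    and "(\<lambda>m. hit_prob (q ^ CARD('n)) K m 0 DD) \<longlonglongrightarrow> measure (completion M) (hit K)"
proof -
  define H where "H m = {\<omega> \<in> space M. hits_at K m 0 DD 0 (W m \<omega>)}" for m
  \<comment> \<open>The events \<open>H m\<close> are known to decrease only on \<open>good\<close>;
    their finite intersections decrease everywhere and differ from them by null sets.\<close>
  define G where "G m = (\<Inter>j\<in>{..m}. H j)" for m
  have root: "DD \<in> Cs 0" by (simp add: cosets_0)
  have H_ev: "H m \<in> events" for m unfolding H_def by (rule hits_event[OF root])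
  have G_ev: "G m \<in> events" for m unfolding G_def using H_ev by (intro sets.finite_INT) auto
  have G_dec: "decseq G" unfolding decseq_def G_def by force
  have H_good: "\<omega> \<in> H m \<longleftrightarrow> (\<exists>t\<in>DD. cs m (X t \<omega>) \<inter> K \<noteq> {})" if "\<omega> \<in> good" for \<omega> m
    using hits_at_good[OF that] that unfolding H_def good_iff by auto
  have GH: "\<omega> \<in> G m \<longleftrightarrow> \<omega> \<in> H m" if \<omega>: "\<omega> \<in> good" for \<omega> m
  proof
    assume "\<omega> \<in> H m"
    then obtain t where t: "t \<in> DD" "cs m (X t \<omega>) \<inter> K \<noteq> {}" using H_good[OF \<omega>] by blast
    have "\<omega> \<in> H j" if "j \<le> m" for j
      unfolding H_good[OF \<omega>] using t coset_mono[OF that, of "X t \<omega>"] by blast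
    then show "\<omega> \<in> G m" unfolding G_def by blast
  qed (simp add: G_def)
  have "prob (G m) = prob (H m)" for m
  proof (rule finite_measure_eq_AE)
    show "AE \<omega> in M. \<omega> \<in> G m \<longleftrightarrow> \<omega> \<in> H m" using AE_good by eventually_elim (rule GH)
  qed (use G_ev H_ev in auto)
  then have prob_G: "prob (G m) = hit_prob (q ^ CARD('n)) K m 0 DD" for m
    using prob_hits_at[OF root, of "0 :: 'k ^ 'd" K m] coset_0[of "0 :: 'k ^ 'd"] by (simp add: H_def)
  have GI: "(\<Inter>m. G m) \<in> events" using G_ev by blast
  have hit_G: "\<omega> \<in> hit K \<longleftrightarrow> \<omega> \<in> (\<Inter>m. G m)" if "\<omega> \<in> good" for \<omega>
    using hit_closed_good[OF K that] GH[OF that] that unfolding H_def good_iff by auto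
  obtain N where N: "N \<in> null_sets M" "space M - good \<subseteq> N"
  proof (rule AE_E3[OF AE_good])
    fix N assume "\<And>\<omega>. \<omega> \<in> space M - N \<Longrightarrow> \<omega> \<in> good" "N \<in> null_sets M"
    then show ?thesis using that[of N] by blast
  qed
  have hit_sub: "hit K \<subseteq> space M" unfolding hit_def by blast
  \<comment> \<open>Within the null set \<open>N\<close> the shape of \<open>hit K\<close> is
    uncontrolled, so measurability of that piece comes from completeness.\<close>
  have "hit K = ((\<Inter>m. G m) - N) \<union> (hit K \<inter> N)"
  proof (intro equalityI subsetI)
    fix \<omega> assume "\<omega> \<in> hit K"
    then show "\<omega> \<in> ((\<Inter>m. G m) - N) \<union> (hit K \<inter> N)" using hit_G N(2) hit_sub by blast
  next
    fix \<omega> assume "\<omega> \<in> ((\<Inter>m. G m) - N) \<union> (hit K \<inter> N)"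
    moreover have "\<omega> \<in> space M" if "\<omega> \<in> (\<Inter>m. G m)" using that sets.sets_into_space[OF GI] by blast
    ultimately show "\<omega> \<in> hit K" using hit_G N(2) by blast
  qed
  moreover have "hit K \<inter> N \<in> sets (completion M)"
    by (rule completion.complete[OF _ null_sets_completionI[OF N(1)]]) auto
  moreover have "(\<Inter>m. G m) - N \<in> sets (completion M)" using GI N(1) by (intro sets_completionI_sets sets.Diff) auto
  ultimately show meas: "hit K \<in> sets (completion M)" by (metis sets.Un)
  have "emeasure (completion M) (hit K) = emeasure (completion M) (\<Inter>m. G m)"
  proof (rule emeasure_eq_AE[OF AE_completion])
    show "AE \<omega> in M. \<omega> \<in> hit K \<longleftrightarrow> \<omega> \<in> (\<Inter>m. G m)" using AE_good by eventually_elim (rule hit_G)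
  qed (use meas GI in auto)
  then have "measure (completion M) (hit K) = prob (\<Inter>m. G m)" using GI by (simp add: measure_def)
  moreover have "(\<lambda>m. prob (G m)) \<longlonglongrightarrow> prob (\<Inter>m. G m)"
    using G_ev G_dec by (intro finite_Lim_measure_decseq) auto
  ultimately show "(\<lambda>m. hit_prob (q ^ CARD('n)) K m 0 DD) \<longlonglongrightarrow> measure (completion M) (hit K)"
    unfolding prob_G by simp
qed

end

section \<open>Hitting probabilities and energy\<close>

lemma one_minus_power_lower:
  fixes a :: real
  assumes "0 \<le> a" "a \<le> 1"
  shows "(1 - a) ^ n * (1 + real n * a) \<le> 1"
proof (induction n)
  case (Suc n)
  have "(1 - a) * (1 + real (Suc n) * a) \<le> 1 + real n * a"
    using assms by (simp add: algebra_simps)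
  then have "(1 - a) ^ n * ((1 - a) * (1 + real (Suc n) * a)) \<le> (1 - a) ^ n * (1 + real n * a)"
    using assms by (intro mult_left_mono) auto
  also have "\<dots> \<le> 1" by (rule Suc)
  finally show ?case by (simp add: mult_ac)
qed simp

text \<open>A denominator-free form, suited to induction, of the bound
  \<open>1 - (1 - a)^n \<le> n a / (1 + (n - 1) a / 2)\<close>.\<close>

lemma one_minus_power_upper:
  fixes a :: real
  assumes "0 \<le> a" "a \<le> 1"
  shows "1 - (real n + 1) * a / 2 \<le> (1 - a) ^ n * (1 + (real n - 1) * a / 2)"
proof (induction n)
  case (Suc n)
  let ?c = "1 + (real n - 1) * a / 2"
  have c: "?c > 0"
  proof -
    have "(real n - 1) * a \<ge> - 1 * a" using assms by (intro mult_right_mono) auto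
    then show ?thesis using assms by simp
  qed
  \<comment> \<open>The two products differ by a cubic term only, and its sign is what makes the
    induction step work.\<close>
  have "(1 - (real n + 2) * a / 2) * ?c + real n * (real n + 1) * a ^ 3 / 4 =
      (1 - a) * (1 + real n * a / 2) * (1 - (real n + 1) * a / 2)"
    by (simp add: field_simps power3_eq_cube)
  moreover have "real n * (real n + 1) * a ^ 3 / 4 \<ge> 0" using assms by simp
  ultimately have "(1 - (real n + 2) * a / 2) * ?c \<le> (1 - a) * (1 + real n * a / 2) * (1 - (real n + 1) * a / 2)"
    by linarith
  also have "\<dots> \<le> (1 - a) * (1 + real n * a / 2) * ((1 - a) ^ n * ?c)"
    using assms Suc by (intro mult_left_mono) auto
  finally have "(1 - (real n + 2) * a / 2) * ?c \<le> ((1 - a) ^ Suc n * (1 + real n * a / 2)) * ?c"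
    by (simp add: mult_ac)
  then have "1 - (real n + 2) * a / 2 \<le> (1 - a) ^ Suc n * (1 + real n * a / 2)"
    using c by (simp only: mult_le_cancel_right_pos)
  then show ?case by (simp add: algebra_simps)
qed simp

lemma one_minus_power_pos:
  fixes a :: real
  assumes "0 < a" "a \<le> 1" "b \<ge> 1"
  shows "0 < 1 - (1 - a) ^ b"
proof -
  have "(1 - a) ^ b < 1" using assms by (intro power_Suc_less_one[of _ "b - 1", simplified] | simp add: power_less_one_iff)+
  then show ?thesis by simp
qed

text \<open>Using \<open>one_minus_power_lower\<close> at \<open>b - 1\<close> gives
  \<open>(b - 1) / b\<close> in place of the 1. It is rounded up, so that a ball of mass
  \<open>w\<close> costs exactly \<open>w^2\<close> in the energy series.\<close>

lemma inverse_hit_upper: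
  fixes a :: real
  assumes a: "0 < a" "a \<le> 1" and b: "b \<ge> 1"
  shows "1 / (1 - (1 - a) ^ b) \<le> 1 + 1 / (a * real b)"
proof -
  obtain n where n: "b = Suc n" using b by (cases b) auto
  have pos: "0 < 1 - (1 - a) ^ b" using one_minus_power_pos a b by blast
  have "(1 - a) * ((1 - a) ^ n * (1 + real n * a)) \<le> (1 - a) * 1"
    using one_minus_power_lower[of a n] a by (intro mult_left_mono) auto
  then have "real b * a \<le> (1 - (1 - a) ^ b) * (1 + real n * a)"
    unfolding n by (simp add: algebra_simps)
  also have "\<dots> \<le> (1 - (1 - a) ^ b) * (1 + real b * a)"
    using pos a by (intro mult_left_mono) (auto simp: n)
  finally show ?thesis using pos a b by (simp add: field_simps)
qed

text \<open>The 1/4 is a lower bound for \<open>(b - 1) / (2 b)\<close> when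
  \<open>b \<ge> 2\<close>. Its positivity is what lets the energy be charged to the reciprocal
  hitting probability.\<close>

lemma inverse_hit_lower:
  fixes a :: real
  assumes a: "0 < a" "a \<le> 1" and b: "b \<ge> 2"
  shows "1 / 4 + 1 / (a * real b) \<le> 1 / (1 - (1 - a) ^ b)"
proof -
  have pos: "0 < 1 - (1 - a) ^ b" using one_minus_power_pos a b by simp
  let ?p = "1 - (1 - a) ^ b"
  have "?p * (1 + (real b - 1) * a / 2) \<le> real b * a"
  proof -
    have "?p * (1 + (real b - 1) * a / 2) =
        1 + (real b - 1) * a / 2 - (1 - a) ^ b * (1 + (real b - 1) * a / 2)"
      unfolding left_diff_distrib[of 1] by simp
    also have "\<dots> \<le> 1 + (real b - 1) * a / 2 - (1 - (real b + 1) * a / 2)"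
      using one_minus_power_upper[of a b] a by linarith
    also have "\<dots> = real b * a" by (simp add: field_simps)
    finally show ?thesis .
  qed
  moreover have "?p * (1 + real b * a / 4) \<le> ?p * (1 + (real b - 1) * a / 2)"
    using pos a b by (intro mult_left_mono) (auto simp: field_simps)
  ultimately have "?p * (1 + real b * a / 4) \<le> real b * a" by linarith
  then show ?thesis using pos a b by (simp add: field_simps)
qed

text \<open>Cauchy-Schwarz for \<open>w / sqrt p\<close> and \<open>sqrt p\<close>. Where
  \<open>p\<close> vanishes so does \<open>w\<close>, and the quotient is 0 by the convention for
  division.\<close>

lemma sum_sq_div_le:
  fixes w p :: "'a \<Rightarrow> real"
  assumes w: "\<And>x. x \<in> A \<Longrightarrow> p x \<ge> 0" "\<And>x. x \<in> A \<Longrightarrow> w x \<noteq> 0 \<Longrightarrow> p x > 0"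
    and pos: "(\<Sum>x\<in>A. p x) > 0"
  shows "(\<Sum>x\<in>A. w x)\<^sup>2 / (\<Sum>x\<in>A. p x) \<le> (\<Sum>x\<in>A. (w x)\<^sup>2 / p x)"
proof -
  have "(\<Sum>x\<in>A. w x)\<^sup>2 = (\<Sum>x\<in>A. (w x / sqrt (p x)) * sqrt (p x))\<^sup>2"
    using w by (intro arg_cong[where f="\<lambda>s. s\<^sup>2"] sum.cong) force+
  also have "\<dots> \<le> (\<Sum>x\<in>A. (w x / sqrt (p x))\<^sup>2) * (\<Sum>x\<in>A. (sqrt (p x))\<^sup>2)"
    by (rule Cauchy_Schwarz_ineq_sum)
  also have "\<dots> = (\<Sum>x\<in>A. (w x)\<^sup>2 / p x) * (\<Sum>x\<in>A. p x)"
    using w(1) by (intro arg_cong2[where f="(*)"] sum.cong) (auto simp: power_divide)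
  finally show ?thesis using pos by (simp add: field_simps)
qed

context local_field
begin

section \<open>Finite-level hitting probabilities, their limits and the energy series\<close>

lemma hit_prob_bounds:
  assumes "y \<in> Cs n"
  shows "0 \<le> hit_prob b K k n y \<and> hit_prob b K k n y \<le> 1"
  using assms
proof (induction k arbitrary: n y)
  case (Suc k)
  have b: "0 \<le> 1 - (1 - hit_prob b K k (Suc n) y') ^ b \<and> 1 - (1 - hit_prob b K k (Suc n) y') ^ b \<le> 1"
    if "y' \<in> chd n y" for y'
    using Suc.IH[OF chd_Cs[OF that]] by (auto intro!: power_le_one)
  have "(\<Sum>y'\<in>chd n y. 1 - (1 - hit_prob b K k (Suc n) y') ^ b) \<le> (\<Sum>y'\<in>chd n y. 1)"
    using b by (intro sum_mono) blast
  then show ?case using b q_pos card_chd[OF Suc.prems] by (auto intro!: sum_nonneg simp: divide_simps)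
qed simp

lemma hit_prob_pos:
  assumes "y \<in> Cs n" "y \<inter> K \<noteq> {}" "b \<ge> 1"
  shows "0 < hit_prob b K k n y"
  using assms
proof (induction k arbitrary: n y)
  case (Suc k)
  obtain x where x: "x \<in> y" "x \<in> K" using Suc.prems by blast
  let ?p = "\<lambda>y'. 1 - (1 - hit_prob b K k (Suc n) y') ^ b"
  have c: "cs (Suc n) x \<in> chd n y" using chd_ex[OF Suc.prems(1) x(1)] .
  have "0 < hit_prob b K k (Suc n) (cs (Suc n) x)"
    using Suc.IH[OF chd_Cs[OF c]] x(2) coset_refl[of x "Suc n"] Suc.prems(3) by blast
  then have "0 < ?p (cs (Suc n) x)"
    using hit_prob_bounds[OF chd_Cs[OF c]] Suc.prems(3) by (intro one_minus_power_pos) auto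
  moreover have "0 \<le> ?p y'" if "y' \<in> chd n y" for y'
    using hit_prob_bounds[OF chd_Cs[OF that], of b K k] by (simp add: power_le_one)
  ultimately have "0 < (\<Sum>y'\<in>chd n y. ?p y')"
    using c finite_chd[OF Suc.prems(1)] by (intro sum_pos2[of _ "cs (Suc n) x"]) auto
  then show ?case using q_pos by simp
qed simp

lemma hit_prob_mono:
  assumes "y \<in> Cs n"
  shows "hit_prob b K (Suc k) n y \<le> hit_prob b K k n y"
  using assms
proof (induction k arbitrary: n y)
  case 0
  show ?case
  proof (cases "y \<inter> K = {}")
    case True
    then have "y' \<inter> K = {}" if "y' \<in> chd n y" for y' using chd_subset[OF that] by blast
    then show ?thesis by simp
  next
    case False
    then show ?thesis using hit_prob_bounds[OF 0, of b K "Suc 0"] by simp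
  qed
next
  case (Suc k)
  have "(1 - hit_prob b K k (Suc n) y') ^ b \<le> (1 - hit_prob b K (Suc k) (Suc n) y') ^ b"
    if "y' \<in> chd n y" for y'
    using Suc.IH[OF chd_Cs[OF that]] hit_prob_bounds[OF chd_Cs[OF that], of b K] by (intro power_mono) auto
  then have "(\<Sum>y'\<in>chd n y. 1 - (1 - hit_prob b K (Suc k) (Suc n) y') ^ b) \<le>
      (\<Sum>y'\<in>chd n y. 1 - (1 - hit_prob b K k (Suc n) y') ^ b)" by (intro sum_mono) force
  then show ?case unfolding hit_prob.simps(2)[of b K "Suc k"] hit_prob.simps(2)[of b K k]
    by (intro divide_right_mono) auto
qed

definition ratio :: "nat \<Rightarrow> nat \<Rightarrow> real" where "ratio N d = real q ^ d / real q ^ N"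

lemma ratio_pos: "ratio N d > 0" using q_pos by (simp add: ratio_def)

text \<open>With \<open>p\<close> the hitting probabilities, \<open>\<Sum> w\<^sup>2 / p\<close> over one level is at most
  \<open>\<Sum> w\<^sup>2\<close> plus a multiple of the same sum one level below, by Cauchy-Schwarz.\<close>

lemma energy_bounds_hit_prob:
  fixes w :: "('k ^ 'd::finite) set \<Rightarrow> real" and b N :: nat
  defines "b \<equiv> q ^ N"
  assumes w_add: "\<And>n y. y \<in> Cs n \<Longrightarrow> w y = (\<Sum>y'\<in>chd n y. w y')"
    and w_K: "\<And>n y. y \<in> Cs n \<Longrightarrow> w y \<noteq> 0 \<Longrightarrow> y \<inter> K \<noteq> {}"
  shows "ratio N CARD('d) ^ n * (\<Sum>y\<in>Cs n. (w y)\<^sup>2 / (1 - (1 - hit_prob b K k n y) ^ b)) \<le>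
    (\<Sum>j=n..n + k. ratio N CARD('d) ^ j * (\<Sum>y\<in>Cs j. (w y)\<^sup>2))"
proof (induction k arbitrary: n)
  case 0
  have b: "b \<ge> 1" using q_ge_2 by (simp add: b_def)
  have "(w y)\<^sup>2 / (1 - (1 - hit_prob b K 0 n y) ^ b) = (w y)\<^sup>2" if "y \<in> Cs n" for y
    using w_K[OF that] b by (cases "w y = 0") (auto simp: zero_power)
  then show ?case by simp
next
  case (Suc k)
  let ?r = "ratio N CARD('d)"
  let ?p = "\<lambda>k n y. 1 - (1 - hit_prob b K k n y) ^ b"
  have b: "b \<ge> 1" using q_ge_2 by (simp add: b_def)
  have step: "(w y)\<^sup>2 / ?p (Suc k) n y \<le> (w y)\<^sup>2 + ?r * (\<Sum>y'\<in>chd n y. (w y')\<^sup>2 / ?p k (Suc n) y')"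
    if y: "y \<in> Cs n" for y
  proof -
    have p0: "0 \<le> ?p k (Suc n) y'" if "y' \<in> chd n y" for y'
      using hit_prob_bounds[OF chd_Cs[OF that], of b K k] by (simp add: power_le_one)
    show ?thesis
    proof (cases "w y = 0")
      case True
      have "0 \<le> ?r * (\<Sum>y'\<in>chd n y. (w y')\<^sup>2 / ?p k (Suc n) y')"
        using p0 ratio_pos[of N "CARD('d)"]
        by (intro mult_nonneg_nonneg sum_nonneg divide_nonneg_nonneg) auto
      then show ?thesis using True by simp
    next
      case False
      let ?a = "hit_prob b K (Suc k) n y"
      let ?S = "\<Sum>y'\<in>chd n y. ?p k (Suc n) y'"
      have a: "0 < ?a" "?a \<le> 1"
        using hit_prob_pos[OF y w_K[OF y False] b, of "Suc k"] hit_prob_bounds[OF y, of b K "Suc k"] by blast+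
      have aS: "?a = ?S / real q ^ CARD('d)" by simp
      have S: "?S > 0" using a(1) q_pos unfolding aS by (simp add: zero_less_divide_iff)
      have "(w y)\<^sup>2 / ?p (Suc k) n y = (w y)\<^sup>2 * (1 / ?p (Suc k) n y)" by simp
      also have "\<dots> \<le> (w y)\<^sup>2 * (1 + 1 / (?a * real b))"
        by (intro mult_left_mono inverse_hit_upper a b) auto
      also have "\<dots> = (w y)\<^sup>2 + ?r * ((\<Sum>y'\<in>chd n y. w y')\<^sup>2 / ?S)"
        unfolding aS w_add[OF y, symmetric] using S q_pos by (simp add: ratio_def b_def field_simps)
      also have "\<dots> \<le> (w y)\<^sup>2 + ?r * (\<Sum>y'\<in>chd n y. (w y')\<^sup>2 / ?p k (Suc n) y')"
      proof (intro add_left_mono mult_left_mono sum_sq_div_le p0 S)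
        fix y' assume y': "y' \<in> chd n y" "w y' \<noteq> 0"
        show "0 < ?p k (Suc n) y'"
          using hit_prob_pos[OF chd_Cs[OF y'(1)] w_K[OF chd_Cs[OF y'(1)] y'(2)] b]
            hit_prob_bounds[OF chd_Cs[OF y'(1)]] b by (intro one_minus_power_pos) auto
      qed (use ratio_pos[of N "CARD('d)"] in auto)
      finally show ?thesis .
    qed
  qed
  have "?r ^ n * (\<Sum>y\<in>Cs n. (w y)\<^sup>2 / ?p (Suc k) n y) \<le>
      ?r ^ n * (\<Sum>y\<in>Cs n. (w y)\<^sup>2 + ?r * (\<Sum>y'\<in>chd n y. (w y')\<^sup>2 / ?p k (Suc n) y'))"
    using ratio_pos[of N "CARD('d)"] step by (intro mult_left_mono sum_mono) auto
  also have "\<dots> = ?r ^ n * (\<Sum>y\<in>Cs n. (w y)\<^sup>2) + ?r ^ Suc n * (\<Sum>y\<in>Cs (Suc n). (w y)\<^sup>2 / ?p k (Suc n) y)"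
    unfolding sum_cosets_Suc by (simp add: sum.distrib sum_distrib_left[symmetric] algebra_simps)
  also have "\<dots> \<le> ?r ^ n * (\<Sum>y\<in>Cs n. (w y)\<^sup>2) + (\<Sum>j=Suc n..Suc n + k. ?r ^ j * (\<Sum>y\<in>Cs j. (w y)\<^sup>2))"
    using Suc.IH[of "Suc n"] by linarith
  also have "\<dots> = (\<Sum>j=n..n + Suc k. ?r ^ j * (\<Sum>y\<in>Cs j. (w y)\<^sup>2))"
    using sum.atLeast_Suc_atMost[of n "n + Suc k" "\<lambda>j. ?r ^ j * (\<Sum>y\<in>Cs j. (w y)\<^sup>2)"] by simp
  finally show ?case .
qed

definition hit_lim :: "nat \<Rightarrow> ('k ^ 'd::finite) set \<Rightarrow> nat \<Rightarrow> ('k ^ 'd) set \<Rightarrow> real" where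
  "hit_lim b K n y = lim (\<lambda>k. hit_prob b K k n y)"

lemma hit_lim_tendsto:
  assumes "y \<in> Cs n"
  shows "(\<lambda>k. hit_prob b K k n y) \<longlonglongrightarrow> hit_lim b K n y"
proof -
  have dec: "decseq (\<lambda>k. hit_prob b K k n y)" using hit_prob_mono[OF assms] by (simp add: decseq_Suc_iff)
  have "\<forall>k. 0 \<le> hit_prob b K k n y" using hit_prob_bounds[OF assms] by simp
  from decseq_convergent[OF dec this] obtain L where "(\<lambda>k. hit_prob b K k n y) \<longlonglongrightarrow> L" by auto
  then have "convergent (\<lambda>k. hit_prob b K k n y)" unfolding convergent_def by blast
  then show ?thesis unfolding hit_lim_def by (simp add: convergent_LIMSEQ_iff)
qed

lemma hit_lim_bounds:
  assumes "y \<in> Cs n"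
  shows "0 \<le> hit_lim b K n y" "hit_lim b K n y \<le> 1"
  by (rule LIMSEQ_le_const[OF hit_lim_tendsto[OF assms]], use hit_prob_bounds[OF assms] in blast)
     (rule LIMSEQ_le_const2[OF hit_lim_tendsto[OF assms]], use hit_prob_bounds[OF assms] in blast)

lemma hit_lim_meets:
  assumes "y \<in> Cs n" "hit_lim b K n y > 0"
  shows "y \<inter> K \<noteq> {}"
proof
  assume "y \<inter> K = {}"
  then have "hit_prob b K 0 n y = 0" by simp
  moreover have "decseq (\<lambda>k. hit_prob b K k n y)" using hit_prob_mono[OF assms(1)] by (simp add: decseq_Suc_iff)
  ultimately have "hit_lim b K n y \<le> 0"
    using decseq_ge[OF _ hit_lim_tendsto[OF assms(1)], of b K 0] by simp
  then show False using assms(2) by simp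
qed

lemma hit_lim_rec:
  fixes y :: "('k ^ 'd::finite) set"
  assumes "y \<in> Cs n"
  shows "hit_lim b K n y = (\<Sum>y'\<in>chd n y. 1 - (1 - hit_lim b K (Suc n) y') ^ b) / real q ^ CARD('d)"
proof -
  have "(\<lambda>k. hit_prob b K (Suc k) n y) \<longlonglongrightarrow> (\<Sum>y'\<in>chd n y. 1 - (1 - hit_lim b K (Suc n) y') ^ b) / real q ^ CARD('d)"
    unfolding hit_prob.simps(2) of_nat_power using q_pos
    by (intro tendsto_divide tendsto_sum tendsto_diff tendsto_power tendsto_const hit_lim_tendsto chd_Cs) auto
  then show ?thesis using LIMSEQ_Suc[OF hit_lim_tendsto[OF assms]] LIMSEQ_unique by blast
qed

text \<open>Splitting mass in proportion to \<open>p\<close> is the equality case of the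
  Cauchy-Schwarz step behind the opposite bound. Hence the weighted sums \<open>\<Phi> n\<close> of
  \<open>w^2 / p\<close> lose at least a quarter of the energy term at each level, and telescoping
  gives the factor 4.\<close>

lemma flow_energy_bound:
  fixes w :: "('k ^ 'd::finite) set \<Rightarrow> real" and b N :: nat and K
  defines "b \<equiv> q ^ N"
  defines "p \<equiv> \<lambda>n y. 1 - (1 - hit_lim b K n y) ^ b"
  assumes N: "N \<ge> 1"
    and w_pos: "\<And>n y. y \<in> Cs n \<Longrightarrow> w y \<noteq> 0 \<Longrightarrow> hit_lim b K n y > 0"
    and w_step: "\<And>n y y'. y \<in> Cs n \<Longrightarrow> y' \<in> chd n y \<Longrightarrow> w y' = w y * (p (Suc n) y' / (\<Sum>z\<in>chd n y. p (Suc n) z))"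
  shows "(\<Sum>j<m. ratio N CARD('d) ^ j * (\<Sum>y\<in>Cs j. (w y)\<^sup>2)) \<le> 4 * ((w DD)\<^sup>2 / p 0 DD)"
proof -
  let ?r = "ratio N CARD('d)"
  define \<Phi> where "\<Phi> n = ?r ^ n * (\<Sum>y\<in>Cs n. (w y)\<^sup>2 / p n y)" for n
  have "q \<le> q ^ N" using q_ge_2 N by (intro self_le_power) auto
  then have b: "b \<ge> 2" using q_ge_2 unfolding b_def by linarith
  have p0: "0 \<le> p n y" if "y \<in> Cs n" for n y
    using hit_lim_bounds[OF that, of b K] by (simp add: p_def power_le_one)
  have step: "(w y)\<^sup>2 / 4 + ?r * (\<Sum>y'\<in>chd n y. (w y')\<^sup>2 / p (Suc n) y') \<le> (w y)\<^sup>2 / p n y"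
    if y: "y \<in> Cs n" for n y
  proof (cases "w y = 0")
    case True
    then have "w y' = 0" if "y' \<in> chd n y" for y' using w_step[OF y that] by simp
    then show ?thesis using True by simp
  next
    case False
    let ?a = "hit_lim b K n y"
    let ?S = "\<Sum>y'\<in>chd n y. p (Suc n) y'"
    have a: "0 < ?a" "?a \<le> 1" using w_pos[OF y False] hit_lim_bounds[OF y] by auto
    have aS: "?a = ?S / real q ^ CARD('d)" unfolding hit_lim_rec[OF y] p_def ..
    have S: "?S > 0" using a(1) q_pos unfolding aS by (simp add: zero_less_divide_iff)
    have "(\<Sum>y'\<in>chd n y. (w y')\<^sup>2 / p (Suc n) y') = (\<Sum>y'\<in>chd n y. (w y)\<^sup>2 / ?S\<^sup>2 * p (Suc n) y')"
      by (intro sum.cong refl) (simp add: w_step[OF y] power2_eq_square)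
    also have "\<dots> = (w y)\<^sup>2 / ?S\<^sup>2 * ?S" by (rule sum_distrib_left[symmetric])
    also have "\<dots> = (w y)\<^sup>2 / ?S" using S by (simp add: power2_eq_square)
    finally have "(w y)\<^sup>2 / 4 + ?r * (\<Sum>y'\<in>chd n y. (w y')\<^sup>2 / p (Suc n) y') = (w y)\<^sup>2 * (1 / 4 + 1 / (?a * real b))"
      unfolding aS using S q_pos by (simp add: ratio_def b_def field_simps)
    also have "\<dots> \<le> (w y)\<^sup>2 * (1 / p n y)"
      unfolding p_def by (intro mult_left_mono inverse_hit_lower a b) auto
    finally show ?thesis by simp
  qed
  have tel: "?r ^ n * (\<Sum>y\<in>Cs n. (w y)\<^sup>2) / 4 + \<Phi> (Suc n) \<le> \<Phi> n" for n
  proof -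
    have "?r ^ n * (\<Sum>y\<in>Cs n. (w y)\<^sup>2) / 4 + \<Phi> (Suc n) =
      ?r ^ n * (\<Sum>y\<in>Cs n. (w y)\<^sup>2 / 4 + ?r * (\<Sum>y'\<in>chd n y. (w y')\<^sup>2 / p (Suc n) y'))"
      unfolding \<Phi>_def sum_cosets_Suc by (simp add: sum.distrib sum_distrib_left[symmetric] sum_divide_distrib[symmetric] algebra_simps)
    also have "\<dots> \<le> \<Phi> n" unfolding \<Phi>_def
      using ratio_pos[of N "CARD('d)"] step by (intro mult_left_mono sum_mono) auto
    finally show ?thesis .
  qed
  have "(\<Sum>j<m. ?r ^ j * (\<Sum>y\<in>Cs j. (w y)\<^sup>2)) / 4 + \<Phi> m \<le> \<Phi> 0"
  proof (induction m)
    case (Suc m)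
    then show ?case using tel[of m] by (simp add: add_divide_distrib)
  qed simp
  moreover have "\<Phi> m \<ge> 0" unfolding \<Phi>_def
    using ratio_pos[of N "CARD('d)"] p0 by (intro mult_nonneg_nonneg sum_nonneg divide_nonneg_nonneg) auto
  moreover have "\<Phi> 0 = (w DD)\<^sup>2 / p 0 DD" unfolding \<Phi>_def by (simp add: cosets_0)
  ultimately show ?thesis by simp
qed

end

section \<open>Energy and measures on the tree of balls\<close>

context local_field
begin

section \<open>The kernel as a geometric series\<close>

lemma ratio_eq_powr: "ratio N d = real q powr (real d - real N)"
  using q_pos by (simp add: ratio_def powr_diff powr_realpow)

lemma rad_le_rad_iff: "rad m \<le> rad n \<longleftrightarrow> n \<le> m"
  using q_gt_1 by (simp add: power_increasing_iff)

definition kernel_const :: "nat \<Rightarrow> nat \<Rightarrow> real" where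
  "kernel_const N d = (1 - real q powr (- real N)) / real q powr real d"

lemma kernel_const_pos: "N \<ge> 1 \<Longrightarrow> kernel_const N d > 0"
proof -
  assume N: "N \<ge> 1"
  have "real q powr (- real N) < real q powr 0" using N q_gt_1 by (intro powr_less_mono) auto
  then show ?thesis using q_pos by (simp add: kernel_const_def)
qed

text \<open>For \<open>N = d\<close> the ratio is 1 and the sum counts up to \<open>j\<close>, which
  is the logarithm; otherwise the closed form of the geometric sum is the power formula for
  \<open>u\<close>.\<close>

lemma u_kernel_rad:
  "u_kernel q N d (rad j) = ennreal (\<Sum>n<j. kernel_const N d * ratio N d ^ n)"
proof (cases "N = d")
  case True
  have "1 / rad j = real q ^ j" by (simp add: divide_inverse)
  then have "log (real q) (1 / rad j) = real j" using q_gt_1 by (simp only: log_pow_cancel less_imp_neq)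
  moreover have "ratio N d = 1" using True q_pos by (simp add: ratio_def)
  ultimately show ?thesis using True rad_pos[of j]
    by (simp add: u_kernel_def kernel_const_def Let_def mult.commute)
next
  case False
  have "ratio N d \<noteq> 1"
    using False q_gt_1 powr_eq_one_iff[of "real q" "real d - real N"] by (auto simp: ratio_eq_powr)
  have "rad j powr (- (real d - real N)) = ratio N d ^ j"
  proof -
    have "rad j powr (- (real d - real N)) = (real q ^ j) powr (real d - real N)"
      using q_pos by (simp only: inverse_powr powr_minus[symmetric] zero_le_power less_imp_le minus_minus)
    also have "\<dots> = (real q powr real j) powr (real d - real N)" using q_pos by (simp add: powr_realpow)
    also have "\<dots> = (real q powr (real d - real N)) powr real j" by (simp add: powr_powr mult.commute)
    also have "\<dots> = ratio N d ^ j" unfolding ratio_eq_powr using q_pos by (intro powr_realpow) simp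
    finally show ?thesis .
  qed
  then have "u_kernel q N d (rad j) = ennreal (kernel_const N d / (ratio N d - 1) * (ratio N d ^ j - 1))"
    using False rad_pos[of j] by (simp add: u_kernel_def kernel_const_def Let_def ratio_eq_powr)
  also have "kernel_const N d / (ratio N d - 1) * (ratio N d ^ j - 1) = (\<Sum>n<j. kernel_const N d * ratio N d ^ n)"
    using \<open>ratio N d \<noteq> 1\<close> by (simp add: sum_distrib_left[symmetric] sum_gp_strict field_simps)
  finally show ?thesis .
qed

text \<open>The value at 0 continues the formula at \<open>rad j\<close> to infinite
  \<open>j\<close>: the series converges exactly when the ratio is below 1, that is for
  \<open>N > d\<close>.\<close>

lemma u_kernel_0:
  assumes "N \<ge> 1"
  shows "u_kernel q N d 0 = (\<Sum>n. ennreal (kernel_const N d * ratio N d ^ n))"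
proof -
  let ?f = "\<lambda>n. kernel_const N d * ratio N d ^ n"
  have nn: "0 \<le> ?f n" for n
    using kernel_const_pos[OF assms, of d] ratio_pos[of N d] by (simp add: less_imp_le)
  show ?thesis
  proof (cases "N > d")
    case True
    then have "ratio N d < 1"
      using powr_less_mono[of "real d - real N" 0 "real q"] q_gt_1 by (simp add: ratio_eq_powr)
    then have "?f sums (kernel_const N d * (1 / (1 - ratio N d)))"
      using ratio_pos[of N d] by (intro sums_mult geometric_sums) simp
    then have "(\<Sum>n. ennreal (?f n)) = ennreal (kernel_const N d / (1 - ratio N d))"
      using suminf_ennreal_eq[OF nn] by simp
    then show ?thesis using True by (simp add: u_kernel_def kernel_const_def Let_def ratio_eq_powr)
  next
    case False
    have "ratio N d \<ge> 1"
      using False ge_one_powr_ge_zero[of "real q" "real d - real N"] q_gt_1 by (simp add: ratio_eq_powr)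
    then have ge: "?f n \<ge> kernel_const N d" for n
      using kernel_const_pos[OF assms, of d] one_le_power[of "ratio N d" n] by (simp add: mult_le_cancel_left1)
    have "(\<Sum>n. ennreal (?f n)) = top"
    proof (rule ccontr)
      assume "(\<Sum>n. ennreal (?f n)) \<noteq> top"
      then have "summable ?f" by (rule summable_suminf_not_top[OF nn])
      then have "?f \<longlonglongrightarrow> 0" by (rule summable_LIMSEQ_zero)
      then have "kernel_const N d \<le> 0" using ge by (intro LIMSEQ_le_const) auto
      then show False using kernel_const_pos[OF assms, of d] by simp
    qed
    then show ?thesis using False by (simp add: u_kernel_def Let_def)
  qed
qed

text \<open>At distance \<open>rad j\<close> two points share a ball of level \<open>n + 1\<close>
  exactly when \<open>n < j\<close>, so the finite geometric sum becomes a full series weighted by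
  shared balls. The level is \<open>Suc n\<close> because all pairs share the root, while
  \<open>u\<close> vanishes at distance 1.\<close>

lemma u_kernel_vnorm:
  fixes x y :: "'k ^ 'd::finite"
  assumes N: "N \<ge> 1" and xy: "x \<in> DD" "y \<in> DD"
  shows "u_kernel q N d (vnorm absv (x - y)) =
    (\<Sum>n. ennreal (kernel_const N d * ratio N d ^ n) * (\<Sum>B\<in>Cs (Suc n). indicator B x * indicator B y))"
proof -
  have ind: "(\<Sum>B\<in>Cs n. indicator B x * indicator B y :: ennreal) = (if x \<in> cs n y then 1 else 0)" for n
  proof -
    have "(\<Sum>B\<in>Cs n. indicator B x * indicator B y :: ennreal) = (\<Sum>B\<in>Cs n. if B = cs n y then (if x \<in> cs n y then 1 else 0) else 0)"
    proof (intro sum.cong refl)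
      fix B :: "('k ^ 'd) set" assume B: "B \<in> Cs n"
      have "y \<in> B \<longleftrightarrow> B = cs n y" using cosets_eq_cs[OF B, of y] coset_refl[of y n] by blast
      then show "(indicator B x * indicator B y :: ennreal) = (if B = cs n y then (if x \<in> cs n y then 1 else 0) else 0)"
        by (cases "B = cs n y") (simp_all add: indicator_def)
    qed
    also have "\<dots> = (if x \<in> cs n y then 1 else 0)"
      using cs_in_Cs[OF xy(2)] by (simp add: finite_cosets)
    finally show ?thesis .
  qed
  from vnorm_cases[OF xy] show ?thesis
  proof
    assume "vnorm absv (x - y) = 0 \<and> x = y"
    then have "vnorm absv (x - y) = 0" "\<And>n. x \<in> cs (Suc n) y" by auto
    then show ?thesis unfolding ind using u_kernel_0[OF N, of d] by simp
  next
    assume "\<exists>j. vnorm absv (x - y) = rad j"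
    then obtain j where j: "vnorm absv (x - y) = rad j" by blast
    have "x \<in> cs (Suc n) y \<longleftrightarrow> n < j" for n
      unfolding vnorm_le_iff[symmetric] j rad_le_rad_iff by auto
    then have "(\<Sum>n. ennreal (kernel_const N d * ratio N d ^ n) * (if x \<in> cs (Suc n) y then 1 else 0)) =
       (\<Sum>n<j. ennreal (kernel_const N d * ratio N d ^ n) * (if x \<in> cs (Suc n) y then 1 else 0))"
      by (intro suminf_finite) auto
    also have "\<dots> = (\<Sum>n<j. ennreal (kernel_const N d * ratio N d ^ n))"
      using \<open>\<And>n. x \<in> cs (Suc n) y \<longleftrightarrow> n < j\<close> by (intro sum.cong) auto
    also have "\<dots> = ennreal (\<Sum>n<j. kernel_const N d * ratio N d ^ n)"
      using kernel_const_pos[OF N, of d] ratio_pos[of N d] by (intro sum_ennreal) (simp add: less_imp_le)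
    finally show ?thesis unfolding ind j u_kernel_rad by simp
  qed
qed

lemma coset_sets:
  assumes "sets \<mu> = sets (restrict_space borel (DD :: ('k ^ 'd::finite) set))" "y \<in> Cs n"
  shows "y \<in> sets \<mu>"
  using cosets_subset_DD[OF assms(2)] borel_closed[OF closed_cosets[OF assms(2)]] borel_closed[OF closed_DD]
  unfolding assms(1) by (subst sets_restrict_space_iff) auto

text \<open>Integrating the series over shared balls in both variables turns the indicators of
  \<open>B\<close> into the squared mass of \<open>B\<close>. What remains is a positive constant
  factor and an index shift by one, neither of which affects convergence.\<close>

lemma energy_finite_iff:
  fixes \<mu> :: "('k ^ 'd::finite) measure"
  assumes N: "N \<ge> 1" and sets: "sets \<mu> = sets (restrict_space borel DD)" and fin: "finite_measure \<mu>"
  shows "(\<integral>\<^sup>+ x. \<integral>\<^sup>+ y. u_kernel q N CARD('d) (vnorm absv (x - y)) \<partial>\<mu> \<partial>\<mu>) < \<infinity> \<longleftrightarrow>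
    summable (\<lambda>n. ratio N CARD('d) ^ n * (\<Sum>y\<in>Cs n. (measure \<mu> y)\<^sup>2))"
proof -
  interpret finite_measure \<mu> by (rule fin)
  let ?c = "kernel_const N CARD('d)" and ?r = "ratio N CARD('d)"
  note [measurable] = coset_sets[OF sets]
  have sp: "space \<mu> = DD" using sets_eq_imp_space_eq[OF sets] by (simp add: space_restrict_space)
  have "(\<integral>\<^sup>+ x. \<integral>\<^sup>+ y. u_kernel q N CARD('d) (vnorm absv (x - y)) \<partial>\<mu> \<partial>\<mu>) =
     (\<integral>\<^sup>+ x. \<integral>\<^sup>+ y. (\<Sum>n. ennreal (?c * ?r ^ n) * (\<Sum>B\<in>Cs (Suc n). indicator B x * indicator B y)) \<partial>\<mu> \<partial>\<mu>)"
    using u_kernel_vnorm[OF N] by (intro nn_integral_cong) (simp add: sp)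
  also have "\<dots> = (\<integral>\<^sup>+ x. (\<Sum>n. ennreal (?c * ?r ^ n) * (\<Sum>B\<in>Cs (Suc n). indicator B x * emeasure \<mu> B)) \<partial>\<mu>)"
  proof (rule nn_integral_cong)
    fix x
    have "(\<integral>\<^sup>+ y. (\<Sum>B\<in>Cs (Suc n). indicator B x * indicator B y) \<partial>\<mu>) = (\<Sum>B\<in>Cs (Suc n). indicator B x * emeasure \<mu> B)" for n
      by (subst nn_integral_sum) (auto intro!: sum.cong simp: nn_integral_cmult)
    then show "(\<integral>\<^sup>+ y. (\<Sum>n. ennreal (?c * ?r ^ n) * (\<Sum>B\<in>Cs (Suc n). indicator B x * indicator B y)) \<partial>\<mu>) =
       (\<Sum>n. ennreal (?c * ?r ^ n) * (\<Sum>B\<in>Cs (Suc n). indicator B x * emeasure \<mu> B))"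
      by (subst nn_integral_suminf) (auto intro!: borel_measurable_times_ennreal borel_measurable_sum simp: nn_integral_cmult)
  qed
  also have "\<dots> = (\<Sum>n. ennreal (?c * ?r ^ n) * (\<Sum>B\<in>Cs (Suc n). emeasure \<mu> B * emeasure \<mu> B))"
  proof -
    have "(\<integral>\<^sup>+ x. (\<Sum>B\<in>Cs (Suc n). indicator B x * emeasure \<mu> B) \<partial>\<mu>) = (\<Sum>B\<in>Cs (Suc n). emeasure \<mu> B * emeasure \<mu> B)" for n
      by (subst nn_integral_sum) (auto intro!: sum.cong simp: nn_integral_multc)
    then show ?thesis
      by (subst nn_integral_suminf) (auto intro!: borel_measurable_times_ennreal borel_measurable_sum simp: nn_integral_cmult)
  qed
  also have "\<dots> = (\<Sum>n. ennreal (?c * ?r ^ n * (\<Sum>B\<in>Cs (Suc n). (measure \<mu> B)\<^sup>2)))"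
  proof (intro arg_cong[where f=suminf] ext)
    fix n
    have "(\<Sum>B\<in>Cs (Suc n). emeasure \<mu> B * emeasure \<mu> B) = ennreal (\<Sum>B\<in>Cs (Suc n). (measure \<mu> B)\<^sup>2)"
      by (subst sum_ennreal[symmetric]) (auto simp: emeasure_eq_measure ennreal_mult[symmetric] power2_eq_square)
    then show "ennreal (?c * ?r ^ n) * (\<Sum>B\<in>Cs (Suc n). emeasure \<mu> B * emeasure \<mu> B) =
       ennreal (?c * ?r ^ n * (\<Sum>B\<in>Cs (Suc n). (measure \<mu> B)\<^sup>2))"
      using kernel_const_pos[OF N, of "CARD('d)"] ratio_pos[of N "CARD('d)"]
      by (simp add: ennreal_mult sum_nonneg less_imp_le)
  qed
  finally have eq: "(\<integral>\<^sup>+ x. \<integral>\<^sup>+ y. u_kernel q N CARD('d) (vnorm absv (x - y)) \<partial>\<mu> \<partial>\<mu>) =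
     (\<Sum>n. ennreal (?c * ?r ^ n * (\<Sum>B\<in>Cs (Suc n). (measure \<mu> B)\<^sup>2)))" .
  let ?g = "\<lambda>n. ?c * ?r ^ n * (\<Sum>B\<in>(Cs (Suc n) :: ('k ^ 'd) set set). (measure \<mu> B)\<^sup>2)"
  have nn: "0 \<le> ?g n" for n
    using kernel_const_pos[OF N, of "CARD('d)"] ratio_pos[of N "CARD('d)"] by (simp add: sum_nonneg less_imp_le)
  have "(\<Sum>n. ennreal (?g n)) < \<infinity> \<longleftrightarrow> summable ?g"
  proof
    assume "(\<Sum>n. ennreal (?g n)) < \<infinity>"
    then show "summable ?g" by (intro summable_suminf_not_top[OF nn]) auto
  next
    assume "summable ?g"
    then show "(\<Sum>n. ennreal (?g n)) < \<infinity>" using suminf_ennreal2[OF nn] by simp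
  qed
  moreover have "?g = (\<lambda>n. (?c / ?r) * (?r ^ Suc n * (\<Sum>B\<in>Cs (Suc n). (measure \<mu> B)\<^sup>2)))"
    using ratio_pos[of N "CARD('d)"] by (auto simp: field_simps)
  moreover have "summable (\<lambda>n. (?c / ?r) * (?r ^ Suc n * (\<Sum>B\<in>Cs (Suc n). (measure \<mu> B)\<^sup>2))) \<longleftrightarrow>
      summable (\<lambda>n. ?r ^ Suc n * (\<Sum>B\<in>Cs (Suc n). (measure \<mu> B)\<^sup>2))"
    using kernel_const_pos[OF N, of "CARD('d)"] ratio_pos[of N "CARD('d)"] by (subst summable_cmult_iff) auto
  moreover have "summable (\<lambda>n. ?r ^ Suc n * (\<Sum>B\<in>Cs (Suc n). (measure \<mu> B)\<^sup>2)) \<longleftrightarrow>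
      summable (\<lambda>n. ?r ^ n * (\<Sum>B\<in>Cs n. (measure \<mu> B)\<^sup>2))"
    by (rule summable_Suc_iff)
  ultimately show ?thesis unfolding eq by (simp only:)
qed

text \<open>Every node of the tree of balls chooses one of its children independently; the limit point of
  the path chosen from the root has the prescribed splitting ratios.\<close>

lemma measure_from_flow:
  fixes \<kappa> :: "nat \<Rightarrow> ('k ^ 'd::finite) set \<Rightarrow> ('k ^ 'd) set \<Rightarrow> real"
  assumes nn: "\<And>n y y'. y \<in> Cs n \<Longrightarrow> y' \<in> chd n y \<Longrightarrow> 0 \<le> \<kappa> n y y'"
    and total: "\<And>n y. y \<in> Cs n \<Longrightarrow> (\<Sum>y'\<in>chd n y. \<kappa> n y y') = 1"
  shows "\<exists>\<mu>. prob_space \<mu> \<and> sets \<mu> = sets (restrict_space borel DD) \<and>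
    (\<forall>n y y'. y \<in> Cs n \<longrightarrow> y' \<in> chd n y \<longrightarrow> measure \<mu> y' = measure \<mu> y * \<kappa> n y y')"
proof -
  define I where "I = {(n, y). y \<in> (Cs n :: ('k ^ 'd) set set)}"
  \<comment> \<open>Pairs off the tree get a point mass at \<open>{}\<close>, so that every factor
    is a probability space.\<close>
  define MM where "MM = (\<lambda>(n, y). if y \<in> Cs n then point_measure (chd n y) (\<lambda>y'. ennreal (\<kappa> n y y'))
      else point_measure {{}} (\<lambda>_. 1))"
  have MM: "MM (n, y) = point_measure (chd n y) (\<lambda>y'. ennreal (\<kappa> n y y'))" if "y \<in> Cs n" for n y
    using that by (simp add: MM_def)
  have "prob_space (MM i)" for i
  proof (cases i)
    case (Pair n y)
    show ?thesis
    proof (cases "y \<in> Cs n")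
      case True
      have "(\<Sum>y'\<in>chd n y. ennreal (\<kappa> n y y')) = 1"
        using nn[OF True] total[OF True] by (subst sum_ennreal) auto
      then show ?thesis unfolding Pair MM[OF True]
        using finite_chd[OF True] by (intro prob_spaceI) (simp add: space_point_measure emeasure_point_measure_finite)
    next
      case False
      then show ?thesis unfolding Pair MM_def
        by (intro prob_spaceI) (simp add: space_point_measure emeasure_point_measure_finite)
    qed
  qed
  then interpret prob_space "MM i" for i .
  interpret product_prob_space MM I by unfold_locales
  let ?P = "PiM I MM"
  define Y where "Y \<omega> = rec_nat (DD :: ('k ^ 'd) set) (\<lambda>n y. \<omega> (n, y))" for \<omega> :: "nat \<times> ('k ^ 'd) set \<Rightarrow> ('k ^ 'd) set"
  have Y0: "Y \<omega> 0 = DD" and YS: "Y \<omega> (Suc n) = \<omega> (n, Y \<omega> n)" for \<omega> n by (simp_all add: Y_def)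
  have chd: "\<omega> (n, y) \<in> chd n y" if "\<omega> \<in> space ?P" "y \<in> Cs n" for \<omega> n y
  proof -
    have "\<omega> (n, y) \<in> space (MM (n, y))" using that by (auto simp: space_PiM I_def)
    then show ?thesis unfolding MM[OF that(2)] by (simp add: space_point_measure)
  qed
  have Y_Cs: "Y \<omega> n \<in> Cs n" if "\<omega> \<in> space ?P" for \<omega> n
    by (induction n) (auto simp: Y0 YS cosets_0 intro: chd_Cs chd that)
  have Y_dec: "Y \<omega> n \<subseteq> Y \<omega> m" if "\<omega> \<in> space ?P" "m \<le> n" for \<omega> m n
    using that(2)
  proof (induction n rule: dec_induct)
    case (step n)
    then show ?case using chd_subset[OF chd[OF that(1) Y_Cs[OF that(1)]], of n] by (simp add: YS)
  qed simp
  have "(\<Inter>n. Y \<omega> n) \<noteq> {}" if \<omega>: "\<omega> \<in> space ?P" for \<omega>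
  proof (rule compact_nested_nonempty)
    show "compact (Y \<omega> n)" for n
      using compact_Int_closed[OF compact_DD closed_cosets[OF Y_Cs[OF \<omega>, of n]]]
        cosets_subset_DD[OF Y_Cs[OF \<omega>, of n]] by (simp add: Int_absorb1)
    show "Y \<omega> n \<noteq> {}" for n using cosets_nonempty[OF Y_Cs[OF \<omega>]] .
    show "m \<le> n \<Longrightarrow> Y \<omega> n \<subseteq> Y \<omega> m" for m n by (rule Y_dec[OF \<omega>])
  qed
  then have "\<forall>\<omega>. \<exists>x. \<omega> \<in> space ?P \<longrightarrow> (\<forall>n. x \<in> Y \<omega> n)" by blast
  then obtain pt where pt: "\<And>\<omega> n. \<omega> \<in> space ?P \<Longrightarrow> pt \<omega> \<in> Y \<omega> n" by metis
  have pt_iff: "pt \<omega> \<in> y \<longleftrightarrow> Y \<omega> n = y" if "\<omega> \<in> space ?P" "y \<in> Cs n" for \<omega> y n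
    using pt[OF that(1), of n] cosets_disjoint[OF that(2) Y_Cs[OF that(1), of n]] by blast
  \<comment> \<open>The limit point lies in \<open>cs n a\<close> when all \<open>n\<close> proper
    ancestors of that ball choose the child towards \<open>a\<close>: a cylinder over finitely many
    distinct coordinates. This yields both measurability and the product formula.\<close>
  have Y_path: "{\<omega> \<in> space ?P. pt \<omega> \<in> cs n a} =
      {\<omega> \<in> space ?P. \<forall>i\<in>(\<lambda>j. (j, cs j a)) ` {..<n}. \<omega> i \<in> {cs (Suc (fst i)) a}}" (is "?L = ?R")
    if a: "a \<in> DD" for a n
  proof (intro equalityI subsetI)
    fix \<omega> assume "\<omega> \<in> ?L"
    then have \<omega>: "\<omega> \<in> space ?P" and "pt \<omega> \<in> cs n a" by auto
    then have Yn: "Y \<omega> n = cs n a" using pt_iff[OF \<omega> cs_in_Cs[OF a]] by simp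
    have Yj: "Y \<omega> j = cs j a" if "j \<le> n" for j
      using Y_dec[OF \<omega> that] Yn coset_refl[of a n] cosets_eq_cs[OF Y_Cs[OF \<omega>]] by blast
    have "\<omega> (j, cs j a) = cs (Suc j) a" if "j < n" for j
      using YS[of \<omega> j] Yj[of j] Yj[of "Suc j"] that by simp
    then show "\<omega> \<in> ?R" using \<omega> by auto
  next
    fix \<omega> assume "\<omega> \<in> ?R"
    then have \<omega>: "\<omega> \<in> space ?P" and *: "\<And>j. j < n \<Longrightarrow> \<omega> (j, cs j a) = cs (Suc j) a" by auto
    have "Y \<omega> j = cs j a" if "j \<le> n" for j
      using that by (induction j) (auto simp: Y0 YS coset_0[OF a] *)
    then show "\<omega> \<in> ?L" using \<omega> pt_iff[OF \<omega> cs_in_Cs[OF a]] by blast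
  qed
  have J: "(\<lambda>j. (j, cs j a)) ` {..<n} \<subseteq> I" if "a \<in> DD" for a n using that by (auto simp: I_def cs_in_Cs)
  have cs_chd: "cs (Suc j) a \<in> chd j (cs j a)" if "a \<in> DD" for a :: "'k ^ 'd" and j
    by (rule chd_ex[OF cs_in_Cs[OF that] coset_refl])
  have X: "{cs (Suc (fst i)) a} \<in> sets (MM i)" if a: "a \<in> DD" and i: "i \<in> (\<lambda>j. (j, cs j a)) ` {..<n}" for a i n
  proof -
    obtain j where j: "i = (j, cs j a)" using i by blast
    show ?thesis using cs_chd[OF a, of j] unfolding j MM[OF cs_in_Cs[OF a]]
      by (simp add: sets_point_measure)
  qed
  have ev: "{\<omega> \<in> space ?P. pt \<omega> \<in> y} \<in> sets ?P" if y: "y \<in> Cs n" for y n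
  proof -
    obtain a where a: "a \<in> DD" "y = cs n a" using y cosets_iff by blast
    have "{\<omega> \<in> space ?P. pt \<omega> \<in> y} = prod_emb I MM ((\<lambda>j. (j, cs j a)) ` {..<n})
        (PiE ((\<lambda>j. (j, cs j a)) ` {..<n}) (\<lambda>i. {cs (Suc (fst i)) a}))"
      unfolding a(2) Y_path[OF a(1)] prod_emb_def using J[OF a(1)] by (auto simp: space_PiM PiE_def Pi_def)
    also have "\<dots> \<in> sets ?P" using J[OF a(1)] X[OF a(1)] by (intro sets_PiM_I) auto
    finally show ?thesis .
  qed
  have pr: "measure ?P {\<omega> \<in> space ?P. pt \<omega> \<in> cs n a} = (\<Prod>j<n. \<kappa> j (cs j a) (cs (Suc j) a))" if a: "a \<in> DD" for a n
  proof -
    have "emeasure ?P {\<omega> \<in> space ?P. pt \<omega> \<in> cs n a} =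
        (\<Prod>i\<in>(\<lambda>j. (j, cs j a)) ` {..<n}. emeasure (MM i) {cs (Suc (fst i)) a})"
      unfolding Y_path[OF a] by (rule emeasure_PiM_Collect[OF J[OF a] _ X[OF a]]) auto
    also have "\<dots> = (\<Prod>j<n. emeasure (MM (j, cs j a)) {cs (Suc j) a})"
      by (subst prod.reindex) (auto simp: inj_on_def)
    also have "\<dots> = (\<Prod>j<n. ennreal (\<kappa> j (cs j a) (cs (Suc j) a)))"
      using cs_chd[OF a] cs_in_Cs[OF a] finite_chd[OF cs_in_Cs[OF a]]
      by (intro prod.cong refl) (simp add: MM emeasure_point_measure_finite)
    also have "\<dots> = ennreal (\<Prod>j<n. \<kappa> j (cs j a) (cs (Suc j) a))"
      using nn[OF cs_in_Cs[OF a] cs_chd[OF a]] by (intro prod_ennreal) auto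
    finally show ?thesis
      using nn[OF cs_in_Cs[OF a] cs_chd[OF a]] by (simp add: measure_def prod_nonneg)
  qed
  have pt_meas: "pt \<in> measurable ?P (restrict_space borel DD)"
  proof (rule measurable_restrict_space2)
    show "pt \<in> space ?P \<rightarrow> DD" using pt[of _ 0] Y0 by auto
    show "pt \<in> borel_measurable ?P"
    proof (rule borel_measurableI)
      fix U :: "('k ^ 'd) set" assume U: "open U"
      have "pt -` U \<inter> space ?P = (\<Union>n. \<Union>y\<in>{y \<in> Cs n. y \<subseteq> U}. {\<omega> \<in> space ?P. pt \<omega> \<in> y})"
      proof (intro equalityI subsetI)
        fix \<omega> assume \<omega>: "\<omega> \<in> pt -` U \<inter> space ?P"
        then obtain n where n: "cs n (pt \<omega>) \<subseteq> U" using open_contains_coset[OF U] by blast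
        have "pt \<omega> \<in> DD" using pt[of \<omega> 0] Y0 \<omega> by auto
        then have "cs n (pt \<omega>) \<in> {y \<in> Cs n. y \<subseteq> U}" using n cs_in_Cs by blast
        then show "\<omega> \<in> (\<Union>n. \<Union>y\<in>{y \<in> Cs n. y \<subseteq> U}. {\<omega> \<in> space ?P. pt \<omega> \<in> y})" using \<omega> coset_refl by blast
      qed blast
      also have "\<dots> \<in> sets ?P"
      proof (intro sets.countable_UN)
        show "range (\<lambda>n. \<Union>y\<in>{y \<in> Cs n. y \<subseteq> U}. {\<omega> \<in> space ?P. pt \<omega> \<in> y}) \<subseteq> sets ?P"
        proof (intro image_subsetI sets.finite_UN)
          show "finite {y \<in> (Cs n :: ('k ^ 'd) set set). y \<subseteq> U}" for n by (rule finite_subset[OF _ finite_cosets[of n]]) auto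
        qed (use ev in auto)
      qed
      finally show "pt -` U \<inter> space ?P \<in> sets ?P" .
    qed
  qed
  define \<mu> where "\<mu> = distr ?P (restrict_space borel DD) pt"
  have sets_\<mu>: "sets \<mu> = sets (restrict_space borel DD)" by (simp add: \<mu>_def)
  have mu: "measure \<mu> (cs n a) = (\<Prod>j<n. \<kappa> j (cs j a) (cs (Suc j) a))" if a: "a \<in> DD" for a n
  proof -
    have "measure \<mu> (cs n a) = measure ?P (pt -` cs n a \<inter> space ?P)"
      unfolding \<mu>_def using coset_sets[OF sets_\<mu> cs_in_Cs[OF a]] sets_\<mu>
      by (intro measure_distr[OF pt_meas]) simp
    also have "pt -` cs n a \<inter> space ?P = {\<omega> \<in> space ?P. pt \<omega> \<in> cs n a}" by auto
    finally show ?thesis using pr[OF a] by simp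
  qed
  have "measure \<mu> y' = measure \<mu> y * \<kappa> n y y'" if y: "y \<in> Cs n" "y' \<in> chd n y" for n y y'
  proof -
    obtain a where a: "a \<in> DD" "y' = cs (Suc n) a" using chd_Cs[OF y(2)] cosets_iff by blast
    have "a \<in> y" using chd_subset[OF y(2)] a coset_refl[of a "Suc n"] by blast
    then have "y = cs n a" using cosets_eq_cs[OF y(1)] by blast
    then show ?thesis using mu[OF a(1)] a(2) by simp
  qed
  moreover have "prob_space \<mu>" unfolding \<mu>_def by (rule P.prob_space_distr[OF pt_meas])
  ultimately show ?thesis using sets_\<mu> by blast
qed

end

section \<open>Non-polar sets\<close>

context tree_process
begin

lemma finite_completion: "finite_measure (completion M)"
  by (rule finite_measureI) (simp add: emeasure_space_1)

lemma hit_mono: "A \<subseteq> A' \<Longrightarrow> hit A \<subseteq> hit A'" by (auto simp: hit_def)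

lemma hit_subset_space: "hit A \<subseteq> space (completion M)" by (auto simp: hit_def)

lemma hit_UN: "hit (\<Union>i. A i) \<subseteq> (\<Union>i. hit (A i))" by (auto simp: hit_def)

lemma hit_compact: "compact K \<Longrightarrow> hit K \<in> sets (completion M)"
  using hit_closed(1) compact_imp_closed by blast

lemma hit_borel: "B \<in> sets borel \<Longrightarrow> B \<subseteq> DD \<Longrightarrow> hit B \<in> sets (completion M)"
  using capacity_measurable[where hit=hit and M="completion M" and X=DD and B=B, OF hit_mono hit_subset_space
    hit_UN hit_INT_compact hit_compact finite_completion completion.complete_measure_axioms compact_DD] .

lemma measure_hit_eq_hit_lim:
  assumes "closed K"
  shows "measure (completion M) (hit K) = hit_lim (q ^ CARD('n)) K 0 DD"
proof -
  have "DD \<in> Cs 0" by (simp add: cosets_0)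
  then show ?thesis using hit_closed(2)[OF assms] hit_lim_tendsto LIMSEQ_unique by blast
qed

text \<open>\<open>B\<close> is first replaced by a compact subset \<open>K\<close> that is still
  hit with positive probability, since for closed sets the hitting probability is the limit of the
  finite-level ones. The measure then follows the flow that \<open>K\<close> defines.\<close>

lemma nonpolar_imp_finite_energy:
  assumes B: "B \<in> sets borel" "B \<subseteq> DD" and pos: "measure (completion M) (hit B) > 0"
  shows "\<exists>\<mu> :: ('k ^ 'd) measure. sets \<mu> = sets (restrict_space borel DD) \<and> finite_measure \<mu> \<and>
    emeasure \<mu> (space \<mu>) \<noteq> 0 \<and> emeasure \<mu> (DD - B) = 0 \<and>
    (\<integral>\<^sup>+ x. \<integral>\<^sup>+ y. u_kernel q CARD('n) CARD('d) (vnorm absv (x - y)) \<partial>\<mu> \<partial>\<mu>) < \<infinity>"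
proof -
  interpret C: finite_measure "completion M" by (rule finite_completion)
  let ?b = "q ^ CARD('n)"
  have N: "CARD('n) \<ge> 1" by (simp add: Suc_leI)
  let ?m = "measure (completion M) (hit B)"
  have "ennreal (?m / 2) < outer_measure_of (completion M) (hit B)"
    using pos hit_borel[OF B] by (simp add: C.emeasure_eq_measure ennreal_lessI)
  from capacity_inner_compact[where hit=hit and M="completion M" and X=DD and B=B, OF hit_mono hit_subset_space
    hit_UN hit_INT_compact hit_compact finite_completion compact_DD B this]
  obtain K where K: "compact K" "K \<subseteq> B" "ennreal (?m / 2) \<le> emeasure (completion M) (hit K)" by blast
  define L where "L = hit_lim ?b K"
  define p where "p n y = 1 - (1 - L n y) ^ ?b" for n y
  have "?m / 2 \<le> measure (completion M) (hit K)"
    using K(3) by (simp add: C.emeasure_eq_measure ennreal_le_iff)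
  then have L0: "L 0 DD > 0"
    using pos measure_hit_eq_hit_lim[OF compact_imp_closed[OF K(1)]] by (simp add: L_def)
  have Lb: "0 \<le> L n y" "L n y \<le> 1" if "y \<in> Cs n" for n y using hit_lim_bounds[OF that] by (auto simp: L_def)
  have p0: "0 \<le> p n y" if "y \<in> Cs n" for n y using Lb[OF that] by (simp add: p_def power_le_one)
  have L_rec: "L n y = (\<Sum>y'\<in>chd n y. p (Suc n) y') / real q ^ CARD('d)" if "y \<in> Cs n" for n y
    unfolding L_def p_def by (rule hit_lim_rec[OF that])
  \<comment> \<open>The second branch makes \<open>\<kappa>\<close> sum to 1 at balls from which
    \<open>K\<close> is hit with probability 0; by \<open>w_pos\<close> such balls carry no
    mass.\<close>
  define \<kappa> where "\<kappa> n y y' = (if L n y > 0 then p (Suc n) y' / (\<Sum>z\<in>chd n y. p (Suc n) z)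
    else 1 / real (card (chd n y)))" for n y y'
  have sum_pos: "(\<Sum>z\<in>chd n y. p (Suc n) z) > 0" if "y \<in> Cs n" "L n y > 0" for n y
    using that L_rec[OF that(1)] q_pos by (simp add: zero_less_divide_iff)
  have nn: "0 \<le> \<kappa> n y y'" if "y \<in> Cs n" "y' \<in> chd n y" for n y y'
    using p0[OF chd_Cs] that unfolding \<kappa>_def by (auto intro!: divide_nonneg_nonneg sum_nonneg)
  have total: "(\<Sum>y'\<in>chd n y. \<kappa> n y y') = 1" if y: "y \<in> Cs n" for n y
  proof (cases "L n y > 0")
    case True
    then show ?thesis using sum_pos[OF y True] by (simp add: \<kappa>_def sum_divide_distrib[symmetric])
  next
    case False
    then show ?thesis using card_chd[OF y] q_pos by (simp add: \<kappa>_def)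
  qed
  obtain \<mu> where \<mu>: "prob_space \<mu>" "sets \<mu> = sets (restrict_space borel DD)"
    "\<And>n y y'. y \<in> Cs n \<Longrightarrow> y' \<in> chd n y \<Longrightarrow> measure \<mu> y' = measure \<mu> y * \<kappa> n y y'"
    using measure_from_flow[of \<kappa>, OF nn total] by blast
  interpret P: prob_space \<mu> by (rule \<mu>(1))
  have w_pos: "L n y > 0" if "y \<in> Cs n" "measure \<mu> y \<noteq> 0" for n y
    using that
  proof (induction n arbitrary: y)
    case 0
    then show ?case using L0 by (simp add: cosets_0)
  next
    case (Suc n)
    then obtain z where z: "z \<in> Cs n" "y \<in> chd n z" unfolding cosets_Suc by blast
    have *: "measure \<mu> z \<noteq> 0" "\<kappa> n z y \<noteq> 0" using Suc.prems(2) \<mu>(3)[OF z] by auto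
    then have "p (Suc n) y \<noteq> 0" using Suc.IH[OF z(1)] by (auto simp: \<kappa>_def)
    then have "L (Suc n) y \<noteq> 0" by (auto simp: p_def)
    then show ?case using Lb[OF Suc.prems(1)] by simp
  qed
  have w_step: "measure \<mu> y' = measure \<mu> y * (p (Suc n) y' / (\<Sum>z\<in>chd n y. p (Suc n) z))"
    if "y \<in> Cs n" "y' \<in> chd n y" for n y y'
    using \<mu>(3)[OF that] w_pos[OF that(1)] by (cases "measure \<mu> y = 0") (auto simp: \<kappa>_def)
  have "(\<Sum>j<m. ratio CARD('n) CARD('d) ^ j * (\<Sum>y\<in>Cs j. (measure \<mu> y)\<^sup>2)) \<le> 4 * ((measure \<mu> DD)\<^sup>2 / p 0 DD)" for m
    unfolding p_def L_def
    by (rule flow_energy_bound[OF N]) (use w_pos w_step in \<open>auto simp: L_def p_def\<close>)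
  then have "summable (\<lambda>j. ratio CARD('n) CARD('d) ^ j * (\<Sum>y\<in>Cs j. (measure \<mu> y)\<^sup>2))"
    using ratio_pos[of "CARD('n)" "CARD('d)"]
    by (intro summableI_nonneg_bounded) (auto intro!: mult_nonneg_nonneg sum_nonneg simp: less_imp_le)
  then have energy: "(\<integral>\<^sup>+ x. \<integral>\<^sup>+ y. u_kernel q CARD('n) CARD('d) (vnorm absv (x - y)) \<partial>\<mu> \<partial>\<mu>) < \<infinity>"
    using energy_finite_iff[OF N \<mu>(2) P.finite_measure_axioms] by blast
  \<comment> \<open>A point off \<open>K\<close> has a ball missing \<open>K\<close>, and such a
    ball has hitting limit 0, hence no mass. There are countably many balls, so \<open>\<mu>\<close>
    is carried by \<open>K\<close>.\<close>
  have cover: "DD - K \<subseteq> (\<Union>n. \<Union>y\<in>{y \<in> Cs n. y \<inter> K = {}}. y)"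
  proof
    fix x assume x: "x \<in> DD - K"
    then obtain n where "cs n x \<inter> K = {}"
      using closed_iff_cosets_meet[OF compact_imp_closed[OF K(1)], of x] by blast
    then have "cs n x \<in> {y \<in> Cs n. y \<inter> K = {}}" using x cs_in_Cs[of x n] by blast
    moreover have "x \<in> cs n x" by simp
    ultimately show "x \<in> (\<Union>n. \<Union>y\<in>{y \<in> Cs n. y \<inter> K = {}}. y)" by blast
  qed
  have null: "(\<Union>n. \<Union>y\<in>{y \<in> Cs n. y \<inter> K = {}}. y) \<in> null_sets \<mu>"
  proof (intro null_sets_UN null_sets_UN')
    fix n
    show "countable {y \<in> (Cs n :: ('k ^ 'd) set set). y \<inter> K = {}}"
      by (rule countable_finite, rule finite_subset[OF _ finite_cosets[of n]]) auto
    fix y :: "('k ^ 'd) set" assume "y \<in> {y \<in> Cs n. y \<inter> K = {}}"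
    then have y: "y \<in> Cs n" "y \<inter> K = {}" by auto
    then have "measure \<mu> y = 0" using w_pos hit_lim_meets[OF y(1), of ?b K] by (auto simp: L_def)
    then show "y \<in> null_sets \<mu>" using coset_sets[OF \<mu>(2) y(1)] by (simp add: null_sets_def P.emeasure_eq_measure)
  qed
  have "DD - B \<in> sets \<mu>"
    unfolding \<mu>(2) using B borel_closed[OF closed_DD] by (subst sets_restrict_space_iff) auto
  moreover have "DD - B \<subseteq> DD - K" using K(2) by blast
  ultimately have "DD - B \<in> null_sets \<mu>" using cover null_sets_subset[OF null] by (meson order_trans)
  then show ?thesis using \<mu>(2) P.finite_measure_axioms P.emeasure_space_1 energy by (intro exI[of _ \<mu>]) auto
qed

text \<open>Restricting \<open>\<mu>\<close> to a compact \<open>K\<close> inside \<open>B\<close>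
  gives additive weights with no larger energy. The resulting lower bound on the finite-level
  hitting probabilities does not depend on the level, so it survives the limit.\<close>

lemma finite_energy_imp_nonpolar:
  fixes \<mu> :: "('k ^ 'd) measure"
  assumes B: "B \<in> sets borel" "B \<subseteq> DD"
    and sets: "sets \<mu> = sets (restrict_space borel DD)" and fin: "finite_measure \<mu>"
    and nontriv: "emeasure \<mu> (space \<mu>) \<noteq> 0" and conc: "emeasure \<mu> (DD - B) = 0"
    and energy: "(\<integral>\<^sup>+ x. \<integral>\<^sup>+ y. u_kernel q CARD('n) CARD('d) (vnorm absv (x - y)) \<partial>\<mu> \<partial>\<mu>) < \<infinity>"
  shows "measure (completion M) (hit B) > 0"
proof -
  interpret C: finite_measure "completion M" by (rule finite_completion)
  interpret F: finite_measure \<mu> by (rule fin)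
  let ?b = "q ^ CARD('n)" and ?r = "ratio CARD('n) CARD('d)"
  have N: "CARD('n) \<ge> 1" by (simp add: Suc_leI)
  have b: "?b \<ge> 1" using q_ge_2 by simp
  have sp: "space \<mu> = DD" using sets_eq_imp_space_eq[OF sets] by (simp add: space_restrict_space)
  have sub: "A \<in> sets \<mu>" if "A \<in> sets borel" "A \<subseteq> DD" for A
    unfolding sets using that borel_closed[OF closed_DD] by (subst sets_restrict_space_iff) auto
  have "emeasure \<mu> (space \<mu>) = emeasure \<mu> B + emeasure \<mu> (DD - B)"
    using sub[OF B] sub[of "DD - B"] B borel_closed[OF closed_DD]
    by (subst plus_emeasure) (auto simp: sp Un_absorb1)
  then have mB: "measure \<mu> B > 0"
    using nontriv conc by (simp add: F.emeasure_eq_measure zero_less_measure_iff)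
  \<comment> \<open>Inner regularity of \<open>\<mu>\<close> is the capacity theorem for the set
    function \<open>A \<inter> DD\<close>.\<close>
  have "\<exists>K. compact K \<and> K \<subseteq> B \<and> ennreal (measure \<mu> B / 2) \<le> emeasure \<mu> (K \<inter> DD)"
  proof (rule capacity_inner_compact[where hit="\<lambda>A. A \<inter> DD" and X=DD and B=B and M=\<mu>])
    show "ennreal (measure \<mu> B / 2) < outer_measure_of \<mu> (B \<inter> DD)"
      using mB sub[OF B] B(2) by (simp add: Int_absorb2 F.emeasure_eq_measure ennreal_lessI)
    show "K \<inter> DD \<in> sets \<mu>" if "compact K" "K \<subseteq> DD" for K :: "('k ^ 'd) set"
      using that by (intro sub sets.Int borel_closed compact_imp_closed closed_DD) auto
  qed (use B sp fin compact_DD in auto)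
  then obtain K where K: "compact K" "K \<subseteq> B" "ennreal (measure \<mu> B / 2) \<le> emeasure \<mu> (K \<inter> DD)" by blast
  have KD: "K \<subseteq> DD" using K(2) B(2) by blast
  have K_sets: "K \<in> sets \<mu>" using K(1) KD by (intro sub borel_closed compact_imp_closed)
  define w where "w y = measure \<mu> (y \<inter> K)" for y
  have "measure \<mu> B / 2 \<le> measure \<mu> K"
    using K(3) KD by (simp add: Int_absorb2 F.emeasure_eq_measure)
  then have wD: "w DD > 0" using mB KD by (simp add: w_def Int_absorb1)
  have y_sets: "y \<inter> K \<in> sets \<mu>" if "y \<in> Cs n" for y n using coset_sets[OF sets that] K_sets by blast
  have w_add: "w y = (\<Sum>y'\<in>chd n y. w y')" if y: "y \<in> Cs n" for n y
  proof -
    have "(\<Union>y'\<in>chd n y. y' \<inter> K) = y \<inter> K" using Union_chd[OF y] by blast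
    moreover have "measure \<mu> (\<Union>y'\<in>chd n y. y' \<inter> K) = (\<Sum>y'\<in>chd n y. measure \<mu> (y' \<inter> K))"
    proof (rule F.finite_measure_finite_Union[OF finite_chd[OF y]])
      show "(\<lambda>y'. y' \<inter> K) ` chd n y \<subseteq> sets \<mu>" using y_sets chd_Cs by blast
      show "disjoint_family_on (\<lambda>y'. y' \<inter> K) (chd n y)"
        unfolding disjoint_family_on_def using cosets_disjoint chd_Cs by blast
    qed
    ultimately show ?thesis by (simp add: w_def)
  qed
  have w_K: "y \<inter> K \<noteq> {}" if "w y \<noteq> 0" for y using that by (auto simp: w_def)
  let ?e = "\<lambda>j. ?r ^ j * (\<Sum>y\<in>(Cs j :: ('k ^ 'd) set set). (measure \<mu> y)\<^sup>2)"
  have sum_e: "summable ?e" using energy energy_finite_iff[OF N sets fin] by blast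
  have e_nn: "0 \<le> ?e j" for j
    using ratio_pos[of "CARD('n)" "CARD('d)"] by (auto intro!: mult_nonneg_nonneg sum_nonneg simp: less_imp_le)
  define S where "S = suminf ?e"
  have root: "DD \<in> Cs 0" by (simp add: cosets_0)
  have bound: "(w DD)\<^sup>2 \<le> S * real ?b * hit_prob ?b K k 0 DD" for k
  proof -
    let ?a = "hit_prob ?b K k 0 (DD :: ('k ^ 'd) set)"
    let ?p = "1 - (1 - ?a) ^ ?b"
    have a: "0 < ?a" "?a \<le> 1"
      using hit_prob_pos[OF root w_K b, of k] wD hit_prob_bounds[OF root, of ?b K k] by auto
    have p: "0 < ?p" by (rule one_minus_power_pos[OF a b])
    have "(w DD)\<^sup>2 / ?p \<le> (\<Sum>j=0..0 + k. ?r ^ j * (\<Sum>y\<in>Cs j. (w y)\<^sup>2))"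
      using energy_bounds_hit_prob[of w K "CARD('n)" 0 k, OF w_add w_K] by (simp add: cosets_0)
    also have "\<dots> \<le> (\<Sum>j=0..0 + k. ?e j)"
    proof (intro sum_mono mult_left_mono)
      fix j and y :: "('k ^ 'd) set" assume "y \<in> Cs j"
      then show "(w y)\<^sup>2 \<le> (measure \<mu> y)\<^sup>2" unfolding w_def
        by (intro power_mono F.finite_measure_mono coset_sets[OF sets]) auto
    qed (use ratio_pos[of "CARD('n)" "CARD('d)"] in auto)
    also have "\<dots> \<le> S" unfolding S_def using e_nn by (intro sum_le_suminf sum_e) auto
    finally have "(w DD)\<^sup>2 \<le> S * ?p" using p by (simp add: divide_le_eq)
    also have "\<dots> \<le> S * (real ?b * ?a)"
    proof (rule mult_left_mono)
      \<comment> \<open>Bernoulli's inequality passes from the chance after branching to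
        \<open>hit_prob\<close> itself, whose limit is the hitting probability of
        \<open>K\<close>.\<close>
      have "1 + real ?b * (- ?a) \<le> (1 + (- ?a)) ^ ?b" using a by (intro Bernoulli_inequality) simp
      then show "?p \<le> real ?b * ?a" by simp
      show "0 \<le> S" unfolding S_def using e_nn by (intro suminf_nonneg sum_e)
    qed
    finally show ?thesis by (simp only: mult.assoc)
  qed
  have "(\<lambda>k. S * real ?b * hit_prob ?b K k 0 DD) \<longlonglongrightarrow> S * real ?b * measure (completion M) (hit K)"
    by (intro tendsto_mult tendsto_const hit_closed(2) compact_imp_closed[OF K(1)])
  then have "(w DD)\<^sup>2 \<le> S * real ?b * measure (completion M) (hit K)"
    using bound by (intro LIMSEQ_le_const) auto
  then have "measure (completion M) (hit K) \<noteq> 0" using wD by auto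
  moreover have "measure (completion M) (hit K) \<le> measure (completion M) (hit B)"
    by (intro C.finite_measure_mono hit_mono K(2) hit_borel[OF B])
  ultimately show ?thesis using measure_nonneg[of "completion M" "hit K"] by linarith
qed

end

text \<open>By \<open>hit_borel\<close> the hitting event is measurable in the completion, so the
  left-hand side is a genuine probability and not the value 0 that \<open>measure\<close> assigns to
  non-measurable sets.\<close>

theorem theorem6p5:
  fixes absv :: "'k::{field,metric_space} \<Rightarrow> real" and q :: nat and \<rho> :: 'k
    and lam :: "'k measure" and M :: "'w measure"
    and Z :: "nat \<times> ('k ^ 'n::finite) set \<Rightarrow> 'd::finite \<Rightarrow> 'w \<Rightarrow> 'k"
    and B :: "('k ^ 'd) set"
  assumes K: "local_field_setup absv q \<rho> lam"
    and M: "prob_space M"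
    and indep: "prob_space.indep_vars M (\<lambda>_. borel) (\<lambda>(c, i). Z c i)
                  ({(n, C). C \<in> cosets absv \<rho> n} \<times> UNIV)"
    and unif: "\<And>n C i. C \<in> cosets absv \<rho> n \<Longrightarrow>
                 distr M borel (Z (n, C) i) = uniform_measure lam (scaled_disc absv \<rho> n)"
    and B_borel: "B \<in> sets borel"
    and B_sub: "B \<subseteq> Dpow absv"
  shows "measure (completion M) {\<omega> \<in> space M. \<exists>t\<in>Dpow absv. proc absv q \<rho> Z t \<omega> \<in> B} > 0
    \<longleftrightarrow> (\<exists>\<mu> :: ('k ^ 'd) measure.
           sets \<mu> = sets (restrict_space borel (Dpow absv)) \<and>
           finite_measure \<mu> \<and> emeasure \<mu> (space \<mu>) \<noteq> 0 \<and>
           emeasure \<mu> (Dpow absv - B) = 0 \<and>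
           (\<integral>\<^sup>+ x. \<integral>\<^sup>+ y. u_kernel q CARD('n) CARD('d) (vnorm absv (x - y)) \<partial>\<mu> \<partial>\<mu>) < \<infinity>)"
proof -
  interpret prob_space M by (rule M)
  interpret tree_process absv q \<rho> lam M Z
    by unfold_locales (use K indep unif in auto)
  show ?thesis
    using nonpolar_imp_finite_energy[OF B_borel B_sub] finite_energy_imp_nonpolar[OF B_borel B_sub]
    unfolding hit_def by blast
qed

end
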